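(* Let $L\to X$ be a positive holomorphic line bundle over a compact complex manifold $X$ of dimension $n$. Fix a test configuration $\rho$ for $L\to X$ and a metric $h_0$ on $L$ with positive curvature $\omega_0=-\frac i2\partial\bar\partial\log h_0$. For each $k$, let $\underline s(k)=\{s_\alpha^{(k)}\}_{\alpha=0}^{N_k}$ be a $\rho$-adapted orthonormal basis of $H^0(X,L^k)$ with weights $\eta_\alpha^{(k)}$ (see context). Then for any $s_\beta^{(1)}$ in $\underline s(1)$ and any $k$, one can write $$(s_\beta^{(1)})^k=\sum_{\alpha:\ \eta_\alpha^{(k)}\le k\eta_\beta^{(1)}}a_{\beta\alpha}\,s_\alpha^{(k)},\qquad a_{\beta\alpha}\in\mathbf{C}.$$ Furthermore, the coefficients satisfy $$|a_{\beta\alpha}|\le V^{1/2}M^k,$$ where $M=\sup_{0\le\beta\le N_1}\sup_X|s_\beta^{(1)}|_{h_0}$ and $V=\int_X\omega_0^n$.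
   Context: Test configuration. A test configuration $\rho$ for $L\to X$ is a homomorphism $\rho:\mathbf{C}^\times\to \mathrm{Aut}(\mathcal L\to\mathcal X\to\mathbf{C})$, where $\pi:\mathcal X\to\mathbf{C}$ is a (proper) flat $\mathbf{C}^\times$-equivariant map of schemes ($\mathbf C^\times$ acting on $\mathbf{C}$ by multiplication), $\mathcal L\to\mathcal X$ is a $\mathbf{C}^\times$-equivariant line bundle that is ample on the fibers, and $(\pi^{-1}(1),\mathcal L|_{\pi^{-1}(1)})$ is isomorphic to $(X,L)$. Write $(X_w,L_w)=(\pi^{-1}(w),\mathcal L|_{\pi^{-1}(w)})$; then $\rho(\tau)$ is an isomorphism $(X_w,L_w)\to(X_{\tau w},L_{\tau w})$. We identify $(X_1,L_1)=(X,L)$. Weights. The action induces, via $S\mapsto \rho(\tau)^{-1}\circ S\circ\rho(\tau)$, a one-parameter group of automorphisms of $H^0(X_0,L_0^k)$, diagonalizable with entries $\tau^{\eta_\alpha^{(k)}}$, $0\le\alpha\le N_k$, where $\eta^{(k)}_\alpha$ are integers (the weights) and $N_k+1=\dim H^0(X_0,L_0^k)$. An ordering of the weights is fixed. Adapted bases. $E_k=\pi_*(\mathcal L^k)$ is a vector bundle over $\mathbf{C}$ of rank $N_k+1$. The $L^2$ metric on $H^0(X,L^k)$ defined by $h_0$ is the one given by the metric $h_0^k$ on $L^k$ and the volume form $\omega_0^n/n!$. A $\rho$-adapted orthonormal basis is a basis $\{s_\alpha^{(k)}\}_{\alpha=0}^{N_k}$ of $H^0(X,L^k)=H^0(X_1,L_1^k)$,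 orthonormal for this $L^2$ metric, such that the sections $S_\alpha(w)=w^{\eta_\alpha^{(k)}}\rho(w)s_\alpha^{(k)}$, $w\in\mathbf{C}^\times$ (where $(\rho(w)s)(x)=\rho(w)\,s(\rho(w)^{-1}x)$), extend over $w=0$ to a basis of the free $\mathbf{C}[w]$-module of sections of $E_k\to\mathbf{C}$; the extended sections satisfy $\rho(\tau)^{-1}S_\alpha(w\tau)=\tau^{\eta_\alpha^{(k)}}S_\alpha(w)$. Such bases are known to exist; it is assumed that $L$ has been replaced by a sufficiently high power so that this holds for all $k\ge1$. Notation: $|s|_{h_0}^2=s\bar s h_0$. *)

theory Defs
  imports
    "HOL-Analysis.Analysis"
    "HOL-Computational_Algebra.Polynomial"
    "HOL-Combinatorics.Permutations"
    "HOL-Algebra.Ideal_Product"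
    "HOL-Algebra.Generated_Rings"
    "HOL-Algebra.Module"
begin

section \<open>Rings and modules\<close>

definition local_ring :: "('a, 'b) ring_scheme \<Rightarrow> bool" where
  "local_ring R \<longleftrightarrow> cring R \<and> (\<exists>!m. maximalideal m R)"

definition max_ideal :: "('a, 'b) ring_scheme \<Rightarrow> 'a set" where
  "max_ideal R = (THE m. maximalideal m R)"

primrec ideal_pow :: "('a, 'b) ring_scheme \<Rightarrow> 'a set \<Rightarrow> nat \<Rightarrow> 'a set" where
  "ideal_pow R I 0 = carrier R"
| "ideal_pow R I (Suc m) = ideal_prod R I (ideal_pow R I m)"

text \<open>A ring homomorphism \<open>\<phi>\<close> from \<open>R\<close> to \<open>A\<close> makes \<open>A\<close> an \<open>R\<close>-module.\<close>

definition alg_module :: "('a, 'b) ring_scheme \<Rightarrow> ('r \<Rightarrow> 'a) \<Rightarrow> ('r, 'a) module" where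
  "alg_module A \<phi> = \<lparr>carrier = carrier A, monoid.mult = monoid.mult A, one = one A,
     zero = zero A, add = add A, smult = (\<lambda>r x. \<phi> r \<otimes>\<^bsub>A\<^esub> x)\<rparr>"

definition ideal_module :: "('r, 'b) ring_scheme \<Rightarrow> 'r set \<Rightarrow> ('r, 'r) module" where
  "ideal_module R I = \<lparr>carrier = I, monoid.mult = monoid.mult R, one = one R,
     zero = zero R, add = add R, smult = monoid.mult R\<rparr>"

text \<open>
  The tensor product of two \<open>R\<close>-modules as a quotient of formal sums: a list of pairs
  \<open>(x, y)\<close> stands for the sum of the elementary tensors of its entries, and
  \<open>tensor_eq R M N\<close> is the congruence generated by commutativity and bilinearity.
\<close>

inductive tensor_eq ::
  "('r, 'b) ring_scheme \<Rightarrow> ('r, 'm) module \<Rightarrow> ('r, 'n) module \<Rightarrow> ('m \<times> 'n) list \<Rightarrow> ('m \<times> 'n) list \<Rightarrow> bool"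
  for R M N where
  tensor_refl: "ts \<in> lists (carrier M \<times> carrier N) \<Longrightarrow> tensor_eq R M N ts ts"
| tensor_sym: "tensor_eq R M N ts us \<Longrightarrow> tensor_eq R M N us ts"
| tensor_trans: "tensor_eq R M N ts us \<Longrightarrow> tensor_eq R M N us vs \<Longrightarrow> tensor_eq R M N ts vs"
| tensor_append: "tensor_eq R M N ts us \<Longrightarrow> tensor_eq R M N ts' us' \<Longrightarrow>
    tensor_eq R M N (ts @ ts') (us @ us')"
| tensor_comm: "ts \<in> lists (carrier M \<times> carrier N) \<Longrightarrow> us \<in> lists (carrier M \<times> carrier N) \<Longrightarrow>
    tensor_eq R M N (ts @ us) (us @ ts)"
| tensor_zero: "y \<in> carrier N \<Longrightarrow> tensor_eq R M N [(\<zero>\<^bsub>M\<^esub>, y)] []"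
| tensor_add_left: "x \<in> carrier M \<Longrightarrow> x' \<in> carrier M \<Longrightarrow> y \<in> carrier N \<Longrightarrow>
    tensor_eq R M N [(x \<oplus>\<^bsub>M\<^esub> x', y)] [(x, y), (x', y)]"
| tensor_add_right: "x \<in> carrier M \<Longrightarrow> y \<in> carrier N \<Longrightarrow> y' \<in> carrier N \<Longrightarrow>
    tensor_eq R M N [(x, y \<oplus>\<^bsub>N\<^esub> y')] [(x, y), (x, y')]"
| tensor_scale: "r \<in> carrier R \<Longrightarrow> x \<in> carrier M \<Longrightarrow> y \<in> carrier N \<Longrightarrow>
    tensor_eq R M N [(r \<odot>\<^bsub>M\<^esub> x, y)] [(x, r \<odot>\<^bsub>N\<^esub> y)]"

text \<open>
  \<open>M\<close> is flat over \<open>R\<close> iff, for every ideal \<open>I\<close>, the map from the tensor product of \<open>I\<close>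
  and \<open>M\<close> to \<open>M\<close> is injective.
\<close>

definition flat_module :: "('r, 'b) ring_scheme \<Rightarrow> ('r, 'm) module \<Rightarrow> bool" where
  "flat_module R M \<longleftrightarrow>
     (\<forall>I. ideal I R \<longrightarrow>
       (\<forall>ts \<in> lists (I \<times> carrier M).
          foldr (\<lambda>(r, x) acc. r \<odot>\<^bsub>M\<^esub> x \<oplus>\<^bsub>M\<^esub> acc) ts \<zero>\<^bsub>M\<^esub> = \<zero>\<^bsub>M\<^esub> \<longrightarrow>
          tensor_eq R (ideal_module R I) M ts []))"

text \<open>The ring homomorphisms \<open>a\<close>, \<open>b\<close> into \<open>T\<close> exhibit \<open>T\<close> as the tensor product over \<open>R\<close>
  of the \<open>R\<close>-algebras \<open>A\<close> (via \<open>\<alpha>\<close>) and \<open>B\<close> (via \<open>\<beta>\<close>).\<close>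

definition is_tensor_product ::
  "'r ring \<Rightarrow> 'a ring \<Rightarrow> 'b ring \<Rightarrow> 't ring \<Rightarrow> ('r \<Rightarrow> 'a) \<Rightarrow> ('r \<Rightarrow> 'b) \<Rightarrow> ('a \<Rightarrow> 't) \<Rightarrow> ('b \<Rightarrow> 't) \<Rightarrow> bool" where
  "is_tensor_product R A B T \<alpha> \<beta> a b \<longleftrightarrow>
     a \<in> ring_hom A T \<and> b \<in> ring_hom B T \<and>
     (let val = (\<lambda>ts. foldr (\<lambda>(x, y) acc. (a x \<otimes>\<^bsub>T\<^esub> b y) \<oplus>\<^bsub>T\<^esub> acc) ts \<zero>\<^bsub>T\<^esub>);
          L = lists (carrier A \<times> carrier B)
      in val ` L = carrier T \<and>
         (\<forall>ts\<in>L. \<forall>us\<in>L. val ts = val us \<longleftrightarrow>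
            tensor_eq R (alg_module A \<alpha>) (alg_module B \<beta>) ts us))"


section \<open>Ringed spaces and their morphisms\<close>

record ('p, 'r) rspace =
  topo :: "'p topology"
  sec :: "'p set \<Rightarrow> 'r ring"
  res :: "'p set \<Rightarrow> 'p set \<Rightarrow> 'r \<Rightarrow> 'r"

abbreviation pts :: "('p, 'r) rspace \<Rightarrow> 'p set" where
  "pts X \<equiv> topspace (topo X)"

definition ringed_space :: "('p, 'r) rspace \<Rightarrow> bool" where
  "ringed_space X \<longleftrightarrow>
     (\<forall>U. openin (topo X) U \<longrightarrow> cring (sec X U)) \<and>
     (\<forall>U V. openin (topo X) U \<longrightarrow> openin (topo X) V \<longrightarrow> V \<subseteq> U \<longrightarrow>
        res X U V \<in> ring_hom (sec X U) (sec X V)) \<and>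
     (\<forall>U f. openin (topo X) U \<longrightarrow> f \<in> carrier (sec X U) \<longrightarrow> res X U U f = f) \<and>
     (\<forall>U V W f. openin (topo X) U \<longrightarrow> openin (topo X) V \<longrightarrow> openin (topo X) W \<longrightarrow>
        W \<subseteq> V \<longrightarrow> V \<subseteq> U \<longrightarrow> f \<in> carrier (sec X U) \<longrightarrow> res X V W (res X U V f) = res X U W f) \<and>
     (\<forall>\<U> s. (\<forall>U\<in>\<U>. openin (topo X) U \<and> s U \<in> carrier (sec X U)) \<longrightarrow>
        (\<forall>U\<in>\<U>. \<forall>V\<in>\<U>. res X U (U \<inter> V) (s U) = res X V (U \<inter> V) (s V)) \<longrightarrow>
        (\<exists>!t. t \<in> carrier (sec X (\<Union>\<U>)) \<and> (\<forall>U\<in>\<U>. res X (\<Union>\<U>) U t = s U)))"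

definition germ :: "('p, 'r) rspace \<Rightarrow> 'p \<Rightarrow> 'p set \<Rightarrow> 'r \<Rightarrow> ('p set \<times> 'r) set" where
  "germ X x U f = {(V, g). openin (topo X) V \<and> x \<in> V \<and> g \<in> carrier (sec X V) \<and>
     (\<exists>W. openin (topo X) W \<and> x \<in> W \<and> W \<subseteq> U \<inter> V \<and> res X U W f = res X V W g)}"

definition germ_op ::
  "('p, 'r) rspace \<Rightarrow> 'p \<Rightarrow> ('p set \<Rightarrow> 'r \<Rightarrow> 'r \<Rightarrow> 'r) \<Rightarrow>
   ('p set \<times> 'r) set \<Rightarrow> ('p set \<times> 'r) set \<Rightarrow> ('p set \<times> 'r) set" where
  "germ_op X x F A B =
     (let (U, f) = (SOME r. r \<in> A); (V, g) = (SOME r. r \<in> B)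
      in germ X x (U \<inter> V) (F (U \<inter> V) (res X U (U \<inter> V) f) (res X V (U \<inter> V) g)))"

definition stalk :: "('p, 'r) rspace \<Rightarrow> 'p \<Rightarrow> ('p set \<times> 'r) set ring" where
  "stalk X x = \<lparr>
     carrier = {germ X x U f | U f. openin (topo X) U \<and> x \<in> U \<and> f \<in> carrier (sec X U)},
     monoid.mult = germ_op X x (\<lambda>W. monoid.mult (sec X W)),
     one = germ X x (pts X) \<one>\<^bsub>sec X (pts X)\<^esub>,
     zero = germ X x (pts X) \<zero>\<^bsub>sec X (pts X)\<^esub>,
     add = germ_op X x (\<lambda>W. add (sec X W))\<rparr>"

definition locally_ringed_space :: "('p, 'r) rspace \<Rightarrow> bool" where
  "locally_ringed_space X \<longleftrightarrow> ringed_space X \<and> (\<forall>x\<in>pts X. local_ring (stalk X x))"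

definition unit_at :: "('p, 'r) rspace \<Rightarrow> 'p \<Rightarrow> 'p set \<Rightarrow> 'r \<Rightarrow> bool" where
  "unit_at X x U f \<longleftrightarrow> germ X x U f \<in> Units (stalk X x)"

record ('p, 'r, 'q, 's) rmor =
  mpt :: "'p \<Rightarrow> 'q"
  mfn :: "'q set \<Rightarrow> 's \<Rightarrow> 'r"

definition pre :: "('p, 'r) rspace \<Rightarrow> ('p, 'r, 'q, 's) rmor \<Rightarrow> 'q set \<Rightarrow> 'p set" where
  "pre X f V = {x \<in> pts X. mpt f x \<in> V}"

definition morphism ::
  "('p, 'r) rspace \<Rightarrow> ('q, 's) rspace \<Rightarrow> ('p, 'r, 'q, 's) rmor \<Rightarrow> bool" where
  "morphism X Y f \<longleftrightarrow>
     continuous_map (topo X) (topo Y) (mpt f) \<and>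
     (\<forall>V. openin (topo Y) V \<longrightarrow> mfn f V \<in> ring_hom (sec Y V) (sec X (pre X f V))) \<and>
     (\<forall>V W g. openin (topo Y) V \<longrightarrow> openin (topo Y) W \<longrightarrow> W \<subseteq> V \<longrightarrow> g \<in> carrier (sec Y V) \<longrightarrow>
        mfn f W (res Y V W g) = res X (pre X f V) (pre X f W) (mfn f V g)) \<and>
     (\<forall>x\<in>pts X. \<forall>V g. openin (topo Y) V \<longrightarrow> mpt f x \<in> V \<longrightarrow> g \<in> carrier (sec Y V) \<longrightarrow>
        unit_at X x (pre X f V) (mfn f V g) \<longrightarrow> unit_at Y (mpt f x) V g)"

definition mor_eq ::
  "('p, 'r) rspace \<Rightarrow> ('q, 's) rspace \<Rightarrow> ('p, 'r, 'q, 's) rmor \<Rightarrow> ('p, 'r, 'q, 's) rmor \<Rightarrow> bool" where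
  "mor_eq X Y f g \<longleftrightarrow> (\<forall>x\<in>pts X. mpt f x = mpt g x) \<and>
     (\<forall>V. openin (topo Y) V \<longrightarrow> (\<forall>s\<in>carrier (sec Y V). mfn f V s = mfn g V s))"

definition mor_id :: "('p, 'r, 'p, 'r) rmor" where
  "mor_id = \<lparr>mpt = (\<lambda>x. x), mfn = (\<lambda>V s. s)\<rparr>"

text \<open>\<open>mor_comp Y g f\<close> is \<open>g\<close> after \<open>f\<close>, where \<open>Y\<close> is the codomain of \<open>f\<close>.\<close>

definition mor_comp ::
  "('q, 's) rspace \<Rightarrow> ('q, 's, 'z, 't) rmor \<Rightarrow> ('p, 'r, 'q, 's) rmor \<Rightarrow> ('p, 'r, 'z, 't) rmor" where
  "mor_comp Y g f = \<lparr>mpt = (\<lambda>x. mpt g (mpt f x)),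
     mfn = (\<lambda>W s. mfn f (pre Y g W) (mfn g W s))\<rparr>"

definition isomorphic :: "('p, 'r) rspace \<Rightarrow> ('q, 's) rspace \<Rightarrow> bool" where
  "isomorphic X Y \<longleftrightarrow> (\<exists>f g. morphism X Y f \<and> morphism Y X g \<and>
     mor_eq X X (mor_comp Y g f) mor_id \<and> mor_eq Y Y (mor_comp X f g) mor_id)"

definition stalk_map ::
  "('p, 'r) rspace \<Rightarrow> ('p, 'r, 'q, 's) rmor \<Rightarrow> 'p \<Rightarrow> ('q set \<times> 's) set \<Rightarrow> ('p set \<times> 'r) set" where
  "stalk_map X f x A = (let (V, g) = (SOME r. r \<in> A) in germ X x (pre X f V) (mfn f V g))"

definition open_sub :: "('p, 'r) rspace \<Rightarrow> 'p set \<Rightarrow> ('p, 'r) rspace" where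
  "open_sub X U = X\<lparr>topo := subtopology (topo X) U\<rparr>"

definition open_incl :: "('p, 'r) rspace \<Rightarrow> 'p set \<Rightarrow> ('p, 'r, 'p, 'r) rmor" where
  "open_incl X U = \<lparr>mpt = (\<lambda>x. x), mfn = (\<lambda>V. res X V (V \<inter> U))\<rparr>"


section \<open>Schemes\<close>

text \<open>The localization of \<open>R\<close> at a prime \<open>q\<close>; \<open>fraction R q a b\<close> is the class of \<open>a / b\<close>.\<close>

definition fraction :: "('r, 'b) ring_scheme \<Rightarrow> 'r set \<Rightarrow> 'r \<Rightarrow> 'r \<Rightarrow> ('r \<times> 'r) set" where
  "fraction R q a b = {(c, d). c \<in> carrier R \<and> d \<in> carrier R - q \<and>
     (\<exists>u\<in>carrier R - q. u \<otimes>\<^bsub>R\<^esub> (a \<otimes>\<^bsub>R\<^esub> d \<ominus>\<^bsub>R\<^esub> c \<otimes>\<^bsub>R\<^esub> b) = \<zero>\<^bsub>R\<^esub>)}"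

definition fraction_mult ::
  "('r, 'b) ring_scheme \<Rightarrow> 'r set \<Rightarrow> ('r \<times> 'r) set \<Rightarrow> ('r \<times> 'r) set \<Rightarrow> ('r \<times> 'r) set" where
  "fraction_mult R q A B = (let (a, b) = (SOME r. r \<in> A); (c, d) = (SOME r. r \<in> B)
     in fraction R q (a \<otimes>\<^bsub>R\<^esub> c) (b \<otimes>\<^bsub>R\<^esub> d))"

definition fraction_add ::
  "('r, 'b) ring_scheme \<Rightarrow> 'r set \<Rightarrow> ('r \<times> 'r) set \<Rightarrow> ('r \<times> 'r) set \<Rightarrow> ('r \<times> 'r) set" where
  "fraction_add R q A B = (let (a, b) = (SOME r. r \<in> A); (c, d) = (SOME r. r \<in> B)
     in fraction R q (a \<otimes>\<^bsub>R\<^esub> d \<oplus>\<^bsub>R\<^esub> c \<otimes>\<^bsub>R\<^esub> b) (b \<otimes>\<^bsub>R\<^esub> d))"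

definition primes :: "('r, 'b) ring_scheme \<Rightarrow> 'r set set" where
  "primes R = {q. primeideal q R}"

definition zariski :: "('r, 'b) ring_scheme \<Rightarrow> 'r set topology" where
  "zariski R = topology (\<lambda>U. \<exists>I\<subseteq>carrier R. U = {q \<in> primes R. \<not> I \<subseteq> q})"

definition spec_sections :: "('r, 'b) ring_scheme \<Rightarrow> 'r set set \<Rightarrow> ('r set \<Rightarrow> ('r \<times> 'r) set) ring" where
  "spec_sections R U = \<lparr>
     carrier = {s \<in> extensional U. \<forall>p\<in>U. \<exists>V a b. openin (zariski R) V \<and> p \<in> V \<and> V \<subseteq> U \<and>
        a \<in> carrier R \<and> b \<in> carrier R \<and> (\<forall>q\<in>V. b \<notin> q \<and> s q = fraction R q a b)},
     monoid.mult = (\<lambda>s t. \<lambda>q\<in>U. fraction_mult R q (s q) (t q)),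
     one = (\<lambda>q\<in>U. fraction R q \<one>\<^bsub>R\<^esub> \<one>\<^bsub>R\<^esub>),
     zero = (\<lambda>q\<in>U. fraction R q \<zero>\<^bsub>R\<^esub> \<one>\<^bsub>R\<^esub>),
     add = (\<lambda>s t. \<lambda>q\<in>U. fraction_add R q (s q) (t q))\<rparr>"

definition Spec :: "('r, 'b) ring_scheme \<Rightarrow> ('r set, 'r set \<Rightarrow> ('r \<times> 'r) set) rspace" where
  "Spec R = \<lparr>topo = zariski R, sec = spec_sections R, res = (\<lambda>U V s. restrict s V)\<rparr>"

text \<open>An element of \<open>R\<close> as a global function on its spectrum.\<close>

definition spec_fn :: "('r, 'b) ring_scheme \<Rightarrow> 'r \<Rightarrow> 'r set \<Rightarrow> ('r \<times> 'r) set" where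
  "spec_fn R a = (\<lambda>q\<in>primes R. fraction R q a \<one>\<^bsub>R\<^esub>)"

text \<open>The morphism from the spectrum of \<open>S\<close> to that of \<open>R\<close> induced by a homomorphism
  \<open>\<phi>\<close> from \<open>R\<close> to \<open>S\<close>.\<close>

definition spec_map ::
  "('r, 'b) ring_scheme \<Rightarrow> ('s, 'c) ring_scheme \<Rightarrow> ('r \<Rightarrow> 's) \<Rightarrow>
   ('s set, 's set \<Rightarrow> ('s \<times> 's) set, 'r set, 'r set \<Rightarrow> ('r \<times> 'r) set) rmor" where
  "spec_map R S \<phi> =
     (let f = (\<lambda>q. {r \<in> carrier R. \<phi> r \<in> q}) in
      \<lparr>mpt = f,
       mfn = (\<lambda>V s. \<lambda>q\<in>{q \<in> primes S. f q \<in> V}.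
          let (a, b) = (SOME r. r \<in> s (f q)) in fraction S q (\<phi> a) (\<phi> b))\<rparr>)"

definition affine_scheme :: "('p, 'r) rspace \<Rightarrow> bool" where
  "affine_scheme X \<longleftrightarrow> locally_ringed_space X \<and> (\<exists>R :: 'r ring. cring R \<and> isomorphic X (Spec R))"

definition affine_open :: "('p, 'r) rspace \<Rightarrow> 'p set \<Rightarrow> bool" where
  "affine_open X U \<longleftrightarrow> openin (topo X) U \<and> affine_scheme (open_sub X U)"

definition is_scheme :: "('p, 'r) rspace \<Rightarrow> bool" where
  "is_scheme X \<longleftrightarrow> locally_ringed_space X \<and> (\<forall>x\<in>pts X. \<exists>U. affine_open X U \<and> x \<in> U)"

text \<open>
  \<open>P\<close> with projections \<open>p\<close>, \<open>q\<close> is the fibre product of \<open>f : X \<rightarrow> S\<close> and \<open>g : Y \<rightarrow> S\<close>: over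
  affine opens \<open>U\<close>, \<open>V\<close> lying over an affine open \<open>W\<close>, it is the spectrum of the tensor
  product of the rings of functions.  The ring homomorphism \<open>mor_ring X f W U\<close> from
  functions on \<open>W\<close> to functions on \<open>U\<close> is the one given by \<open>f\<close>.
\<close>

definition mor_ring ::
  "('p, 'r) rspace \<Rightarrow> ('p, 'r, 'q, 's) rmor \<Rightarrow> 'q set \<Rightarrow> 'p set \<Rightarrow> 's \<Rightarrow> 'r" where
  "mor_ring X f W U g = res X (pre X f W) U (mfn f W g)"

definition fibre_product ::
  "('p, 'r) rspace \<Rightarrow> ('q, 's) rspace \<Rightarrow> ('b, 'c) rspace \<Rightarrow>
   ('p, 'r, 'b, 'c) rmor \<Rightarrow> ('q, 's, 'b, 'c) rmor \<Rightarrow>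
   ('z, 't) rspace \<Rightarrow> ('z, 't, 'p, 'r) rmor \<Rightarrow> ('z, 't, 'q, 's) rmor \<Rightarrow> bool" where
  "fibre_product X Y S f g P p q \<longleftrightarrow>
     is_scheme P \<and> morphism P X p \<and> morphism P Y q \<and>
     mor_eq P S (mor_comp X f p) (mor_comp Y g q) \<and>
     (\<forall>U V W. affine_open X U \<longrightarrow> affine_open Y V \<longrightarrow> affine_open S W \<longrightarrow>
        mpt f ` U \<subseteq> W \<longrightarrow> mpt g ` V \<subseteq> W \<longrightarrow>
        (let Q = pre P p U \<inter> pre P q V in
           affine_open P Q \<and>
           is_tensor_product (sec S W) (sec X U) (sec Y V) (sec P Q)
             (mor_ring X f W U) (mor_ring Y g W V) (mor_ring P p U Q) (mor_ring P q V Q)))"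

definition flat_morphism ::
  "('p, 'r) rspace \<Rightarrow> ('q, 's) rspace \<Rightarrow> ('p, 'r, 'q, 's) rmor \<Rightarrow> bool" where
  "flat_morphism X S f \<longleftrightarrow>
     (\<forall>x\<in>pts X. flat_module (stalk S (mpt f x)) (alg_module (stalk X x) (stalk_map X f x)))"

definition finite_type_morphism ::
  "('p, 'r) rspace \<Rightarrow> ('q, 's) rspace \<Rightarrow> ('p, 'r, 'q, 's) rmor \<Rightarrow> bool" where
  "finite_type_morphism X S f \<longleftrightarrow>
     (\<forall>W. affine_open S W \<longrightarrow> compactin (topo X) (pre X f W) \<and>
       (\<forall>U. affine_open X U \<longrightarrow> mpt f ` U \<subseteq> W \<longrightarrow>
         (\<exists>G. finite G \<and> G \<subseteq> carrier (sec X U) \<and>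
            generate_ring (sec X U) (mor_ring X f W U ` carrier (sec S W) \<union> G) = carrier (sec X U))))"

definition separated_morphism ::
  "('p, 'r) rspace \<Rightarrow> ('q, 's) rspace \<Rightarrow> ('p, 'r, 'q, 's) rmor \<Rightarrow> bool" where
  "separated_morphism X S f \<longleftrightarrow>
     (\<forall>(P :: ('p, 'r) rspace) p q \<Delta>. fibre_product X X S f f P p q \<longrightarrow> morphism X P \<Delta> \<longrightarrow>
        mor_eq X X (mor_comp P p \<Delta>) mor_id \<longrightarrow> mor_eq X X (mor_comp P q \<Delta>) mor_id \<longrightarrow>
        closedin (topo P) (mpt \<Delta> ` pts X))"

text \<open>
  The base changes (like the products used for separatedness) range over schemes carried by the types
  of \<open>X\<close>.  For \<open>X\<close> of finite type over a
  scheme \<open>S\<close> of finite type over the complex numbers, universal closedness can be tested on the base changes to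
  affine spaces over \<open>S\<close>.  If \<open>X\<close> is a scheme over the complex numbers with infinitely many
  points, all the schemes involved have at most continuum many points and functions, so that
  they do occur in these types.
\<close>

definition universally_closed_morphism ::
  "('p, 'r) rspace \<Rightarrow> ('q, 's) rspace \<Rightarrow> ('p, 'r, 'q, 's) rmor \<Rightarrow> bool" where
  "universally_closed_morphism X S f \<longleftrightarrow>
     (\<forall>(Y :: ('p, 'r) rspace) g (P :: ('p, 'r) rspace) p q.
        is_scheme Y \<longrightarrow> morphism Y S g \<longrightarrow> fibre_product X Y S f g P p q \<longrightarrow>
        closed_map (topo P) (topo Y) (mpt q))"

definition proper_morphism ::
  "('p, 'r) rspace \<Rightarrow> ('q, 's) rspace \<Rightarrow> ('p, 'r, 'q, 's) rmor \<Rightarrow> bool" where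
  "proper_morphism X S f \<longleftrightarrow> finite_type_morphism X S f \<and> separated_morphism X S f \<and>
     universally_closed_morphism X S f"


section \<open>Line bundles\<close>

text \<open>
  A line bundle is given by local trivializations over an open cover and its transition functions:
  fibre coordinates over \<open>bdom i \<inter> bdom j\<close> are related by \<open>\<xi>\<^sub>i = btrans i j \<cdot> \<xi>\<^sub>j\<close>.  The
  \<open>k\<close>-th tensor power has the \<open>k\<close>-th powers as transition functions, and the
  \<open>k\<close>-th power of a section is formed in each trivialization.
\<close>

record ('i, 'p, 'r) lbundle =
  idx :: "'i set"
  bdom :: "'i \<Rightarrow> 'p set"
  btrans :: "'i \<Rightarrow> 'i \<Rightarrow> 'r"

definition line_bundle :: "('p, 'r) rspace \<Rightarrow> ('i, 'p, 'r) lbundle \<Rightarrow> bool" where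
  "line_bundle X L \<longleftrightarrow>
     (\<forall>i\<in>idx L. openin (topo X) (bdom L i)) \<and> (\<Union>i\<in>idx L. bdom L i) = pts X \<and>
     (\<forall>i\<in>idx L. \<forall>j\<in>idx L. btrans L i j \<in> Units (sec X (bdom L i \<inter> bdom L j))) \<and>
     (\<forall>i\<in>idx L. \<forall>j\<in>idx L. \<forall>l\<in>idx L.
        let W = bdom L i \<inter> bdom L j \<inter> bdom L l in
        res X (bdom L i \<inter> bdom L j) W (btrans L i j) \<otimes>\<^bsub>sec X W\<^esub>
          res X (bdom L j \<inter> bdom L l) W (btrans L j l)
        = res X (bdom L i \<inter> bdom L l) W (btrans L i l))"

text \<open>\<open>sections X L k\<close> is the space of global sections of the \<open>k\<close>-th power of \<open>L\<close>.\<close>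

definition sections :: "('p, 'r) rspace \<Rightarrow> ('i, 'p, 'r) lbundle \<Rightarrow> nat \<Rightarrow> ('i \<Rightarrow> 'r) set" where
  "sections X L k = {s \<in> extensional (idx L).
     (\<forall>i\<in>idx L. s i \<in> carrier (sec X (bdom L i))) \<and>
     (\<forall>i\<in>idx L. \<forall>j\<in>idx L. let W = bdom L i \<inter> bdom L j in
        res X (bdom L i) W (s i)
        = (btrans L i j [^]\<^bsub>sec X W\<^esub> k) \<otimes>\<^bsub>sec X W\<^esub> res X (bdom L j) W (s j))}"

definition pull_bundle ::
  "('p, 'r) rspace \<Rightarrow> ('p, 'r, 'q, 's) rmor \<Rightarrow> ('i, 'q, 's) lbundle \<Rightarrow> ('i, 'p, 'r) lbundle" where
  "pull_bundle X f L = \<lparr>idx = idx L, bdom = (\<lambda>i. pre X f (bdom L i)),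
     btrans = (\<lambda>i j. mfn f (bdom L i \<inter> bdom L j) (btrans L i j))\<rparr>"

definition pull_section ::
  "('p, 'r, 'q, 's) rmor \<Rightarrow> ('i, 'q, 's) lbundle \<Rightarrow> ('i \<Rightarrow> 's) \<Rightarrow> 'i \<Rightarrow> 'r" where
  "pull_section f L s = (\<lambda>i\<in>idx L. mfn f (bdom L i) (s i))"

text \<open>
  A fibrewise linear isomorphism from \<open>L\<close> to \<open>M\<close> covering \<open>f : X \<rightarrow> Y\<close>: in fibre coordinates it
  is \<open>\<xi>\<^sub>i \<mapsto> \<theta> a i \<cdot> \<xi>\<^sub>i\<close> over the part of \<open>bdom L i\<close> that \<open>f\<close> maps to \<open>bdom M a\<close>.
\<close>

definition bundle_map ::
  "('p, 'r) rspace \<Rightarrow> ('i, 'p, 'r) lbundle \<Rightarrow> ('q, 's) rspace \<Rightarrow> ('j, 'q, 's) lbundle \<Rightarrow>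
   ('p, 'r, 'q, 's) rmor \<Rightarrow> ('j \<Rightarrow> 'i \<Rightarrow> 'r) \<Rightarrow> bool" where
  "bundle_map X L Y M f \<theta> \<longleftrightarrow> morphism X Y f \<and>
     (\<forall>i\<in>idx L. \<forall>a\<in>idx M. \<theta> a i \<in> Units (sec X (bdom L i \<inter> pre X f (bdom M a)))) \<and>
     (\<forall>i\<in>idx L. \<forall>j\<in>idx L. \<forall>a\<in>idx M. \<forall>b\<in>idx M.
        let W = bdom L i \<inter> bdom L j \<inter> pre X f (bdom M a) \<inter> pre X f (bdom M b) in
        res X (bdom L i \<inter> pre X f (bdom M a)) W (\<theta> a i) \<otimes>\<^bsub>sec X W\<^esub>
          res X (bdom L i \<inter> bdom L j) W (btrans L i j)
        = res X (pre X f (bdom M a \<inter> bdom M b)) W (mfn f (bdom M a \<inter> bdom M b) (btrans M a b))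
            \<otimes>\<^bsub>sec X W\<^esub> res X (bdom L j \<inter> pre X f (bdom M b)) W (\<theta> b j))"

text \<open>\<open>s = \<theta>\<^sup>-\<^sup>1 \<circ> t \<circ> f\<close> for sections \<open>s\<close>, \<open>t\<close> of the \<open>k\<close>-th powers of \<open>L\<close>, \<open>M\<close>; when \<open>f\<close> is an
  isomorphism this says \<open>t = \<theta> \<circ> s \<circ> f\<^sup>-\<^sup>1\<close>.\<close>

definition bundle_pull ::
  "('p, 'r) rspace \<Rightarrow> ('i, 'p, 'r) lbundle \<Rightarrow> ('j, 'q, 's) lbundle \<Rightarrow>
   ('p, 'r, 'q, 's) rmor \<Rightarrow> ('j \<Rightarrow> 'i \<Rightarrow> 'r) \<Rightarrow> nat \<Rightarrow> ('i \<Rightarrow> 'r) \<Rightarrow> ('j \<Rightarrow> 's) \<Rightarrow> bool" where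
  "bundle_pull X L M f \<theta> k s t \<longleftrightarrow>
     (\<forall>i\<in>idx L. \<forall>a\<in>idx M. let W = bdom L i \<inter> pre X f (bdom M a) in
        res X (pre X f (bdom M a)) W (mfn f (bdom M a) (t a))
        = (\<theta> a i [^]\<^bsub>sec X W\<^esub> k) \<otimes>\<^bsub>sec X W\<^esub> res X (bdom L i) W (s i))"

definition scale_section ::
  "('p, 'r) rspace \<Rightarrow> ('i, 'p, 'r) lbundle \<Rightarrow> 'r \<Rightarrow> ('i \<Rightarrow> 'r) \<Rightarrow> 'i \<Rightarrow> 'r" where
  "scale_section X L c s = (\<lambda>i\<in>idx L. res X (pts X) (bdom L i) c \<otimes>\<^bsub>sec X (bdom L i)\<^esub> s i)"

text \<open>\<open>s 0, \<dots>, s N\<close> is a basis of the sections of the \<open>k\<close>-th power of \<open>L\<close>, viewed as a module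
  over a ring (here a type) that acts through \<open>sc\<close>, a map to global functions on \<open>X\<close>.\<close>

definition section_basis ::
  "('p, 'r) rspace \<Rightarrow> ('i, 'p, 'r) lbundle \<Rightarrow> ('c \<Rightarrow> 'r) \<Rightarrow> nat \<Rightarrow> nat \<Rightarrow> (nat \<Rightarrow> 'i \<Rightarrow> 'r) \<Rightarrow> bool" where
  "section_basis X L sc k N s \<longleftrightarrow>
     (\<forall>\<alpha>\<le>N. s \<alpha> \<in> sections X L k) \<and>
     (\<forall>t\<in>sections X L k. \<exists>!a. a \<in> extensional {..N} \<and>
        (\<forall>i\<in>idx L. t i = finsum (sec X (bdom L i)) (\<lambda>\<alpha>. scale_section X L (sc (a \<alpha>)) (s \<alpha>) i) {..N}))"

definition nonvanishing :: "('p, 'r) rspace \<Rightarrow> ('i, 'p, 'r) lbundle \<Rightarrow> ('i \<Rightarrow> 'r) \<Rightarrow> 'p set" where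
  "nonvanishing X L s = {x. \<exists>i\<in>idx L. x \<in> bdom L i \<and> unit_at X x (bdom L i) (s i)}"

definition ample :: "('p, 'r) rspace \<Rightarrow> ('i, 'p, 'r) lbundle \<Rightarrow> bool" where
  "ample X L \<longleftrightarrow> compact_space (topo X) \<and>
     (\<forall>x\<in>pts X. \<exists>m\<ge>1. \<exists>s\<in>sections X L m. x \<in> nonvanishing X L s \<and> affine_open X (nonvanishing X L s))"


section \<open>Test configurations\<close>

definition type_ring :: "'a::comm_ring_1 ring" where
  "type_ring = \<lparr>carrier = UNIV, monoid.mult = (*), one = 1, zero = 0, add = (+)\<rparr>"

type_synonym 'a spec_pt = "'a set"
type_synonym 'a spec_sec = "'a set \<Rightarrow> ('a \<times> 'a) set"

definition point :: "(complex spec_pt, complex spec_sec) rspace" where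
  "point = Spec type_ring"

definition line :: "(complex poly spec_pt, complex poly spec_sec) rspace" where
  "line = Spec type_ring"

definition line_str :: "(complex poly spec_pt, complex poly spec_sec, complex spec_pt, complex spec_sec) rmor" where
  "line_str = spec_map type_ring type_ring (\<lambda>c. [:c:])"

definition line_point :: "complex \<Rightarrow> (complex spec_pt, complex spec_sec, complex poly spec_pt, complex poly spec_sec) rmor" where
  "line_point w = spec_map type_ring type_ring (\<lambda>P. poly P w)"

definition line_mult :: "complex \<Rightarrow> (complex poly spec_pt, complex poly spec_sec, complex poly spec_pt, complex poly spec_sec) rmor" where
  "line_mult \<tau> = spec_map type_ring type_ring (\<lambda>P. pcompose P [:0, \<tau>:])"

text \<open>The multiplicative group is the open subscheme of the affine line where the coordinate is
  nonzero.\<close>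

definition punctured :: "complex poly set set" where
  "punctured = {q \<in> pts line. [:0, 1:] \<notin> q}"

definition Gm :: "(complex poly spec_pt, complex poly spec_sec) rspace" where
  "Gm = open_sub line punctured"

definition Gm_str :: "(complex poly spec_pt, complex poly spec_sec, complex spec_pt, complex spec_sec) rmor" where
  "Gm_str = mor_comp line line_str (open_incl line punctured)"

text \<open>
  \<open>act \<tau>\<close> and \<open>lin \<tau>\<close> are the actions of \<open>\<rho>(\<tau>)\<close> on the total space and, linearly on fibres, on the
  line bundle \<open>lb\<close>.  The fibre of \<open>proj\<close> over \<open>w\<close> is only determined up to isomorphism, so the
  record also contains a choice \<open>inc w\<close> from \<open>fib w\<close> to \<open>tot\<close>.
\<close>

record ('p, 'r, 'i) tconf =
  tot :: "('p, 'r) rspace"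
  proj :: "('p, 'r, complex poly spec_pt, complex poly spec_sec) rmor"
  lb :: "('i, 'p, 'r) lbundle"
  act :: "complex \<Rightarrow> ('p, 'r, 'p, 'r) rmor"
  lin :: "complex \<Rightarrow> 'i \<Rightarrow> 'i \<Rightarrow> 'r"
  fib :: "complex \<Rightarrow> ('p, 'r) rspace"
  inc :: "complex \<Rightarrow> ('p, 'r, 'p, 'r) rmor"

definition tot_str :: "('p, 'r, 'i) tconf \<Rightarrow> ('p, 'r, complex spec_pt, complex spec_sec) rmor" where
  "tot_str T = mor_comp line line_str (proj T)"

definition group_action :: "('p, 'r, 'i) tconf \<Rightarrow> bool" where
  "group_action T \<longleftrightarrow>
     (\<forall>\<tau>. \<tau> \<noteq> 0 \<longrightarrow> bundle_map (tot T) (lb T) (tot T) (lb T) (act T \<tau>) (lin T \<tau>)) \<and>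
     mor_eq (tot T) (tot T) (act T 1) mor_id \<and>
     (\<forall>a\<in>idx (lb T). \<forall>i\<in>idx (lb T). lin T 1 a i = btrans (lb T) a i) \<and>
     (\<forall>\<sigma> \<tau>. \<sigma> \<noteq> 0 \<longrightarrow> \<tau> \<noteq> 0 \<longrightarrow>
        mor_eq (tot T) (tot T) (act T (\<sigma> * \<tau>)) (mor_comp (tot T) (act T \<sigma>) (act T \<tau>)) \<and>
        (\<forall>i\<in>idx (lb T). \<forall>a\<in>idx (lb T). \<forall>c\<in>idx (lb T).
          let X = tot T; D = bdom (lb T);
              A = pre X (act T \<tau>) (D a); C = pre X (act T (\<sigma> * \<tau>)) (D c);
              B = D a \<inter> pre X (act T \<sigma>) (D c);
              W = D i \<inter> A \<inter> C
          in res X (D i \<inter> C) W (lin T (\<sigma> * \<tau>) c i)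
             = res X (pre X (act T \<tau>) B) W (mfn (act T \<tau>) B (lin T \<sigma> c a))
                 \<otimes>\<^bsub>sec X W\<^esub> res X (D i \<inter> A) W (lin T \<tau> a i)))"

text \<open>The action comes from a morphism (and a bundle map covering it) on the product of the
  multiplicative group with the total space; \<open>\<iota>\<close> below is the section of the product over \<open>\<tau>\<close>.\<close>

definition algebraic_action :: "('p, 'r, 'i) tconf \<Rightarrow> bool" where
  "algebraic_action T \<longleftrightarrow>
     (\<exists>(P :: ('p, 'r) rspace) p q \<sigma> \<Lambda>.
        fibre_product (tot T) Gm point (tot_str T) Gm_str P p q \<and>
        bundle_map P (pull_bundle P p (lb T)) (tot T) (lb T) \<sigma> \<Lambda> \<and>
        (\<forall>\<tau> \<iota>. \<tau> \<noteq> 0 \<longrightarrow> morphism (tot T) P \<iota> \<longrightarrow>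
           mor_eq (tot T) (tot T) (mor_comp P p \<iota>) mor_id \<longrightarrow>
           mor_eq (tot T) Gm (mor_comp P q \<iota>) (mor_comp point (line_point \<tau>) (tot_str T)) \<longrightarrow>
           mor_eq (tot T) (tot T) (mor_comp P \<sigma> \<iota>) (act T \<tau>) \<and>
           (\<forall>a\<in>idx (lb T). \<forall>i\<in>idx (lb T). lin T \<tau> a i
              = mfn \<iota> (pre P p (bdom (lb T) i) \<inter> pre P \<sigma> (bdom (lb T) a)) (\<Lambda> a i))))"

abbreviation fib_lb :: "('p, 'r, 'i) tconf \<Rightarrow> complex \<Rightarrow> ('i, 'p, 'r) lbundle" where
  "fib_lb T w \<equiv> pull_bundle (fib T w) (inc T w) (lb T)"

definition test_configuration :: "('p, 'r, 'i) tconf \<Rightarrow> bool" where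
  "test_configuration T \<longleftrightarrow>
     is_scheme (tot T) \<and> morphism (tot T) line (proj T) \<and>
     flat_morphism (tot T) line (proj T) \<and> proper_morphism (tot T) line (proj T) \<and>
     line_bundle (tot T) (lb T) \<and>
     group_action T \<and> algebraic_action T \<and>
     (\<forall>\<tau>. \<tau> \<noteq> 0 \<longrightarrow> mor_eq (tot T) line (mor_comp (tot T) (proj T) (act T \<tau>))
                           (mor_comp line (line_mult \<tau>) (proj T))) \<and>
     (\<forall>w. \<exists>str. fibre_product (tot T) point line (proj T) (line_point w) (fib T w) (inc T w) str) \<and>
     (\<forall>w. ample (fib T w) (fib_lb T w))"

text \<open>\<open>t = \<rho>(\<tau>) \<circ> s \<circ> \<rho>(\<tau>)\<^sup>-\<^sup>1\<close>, where \<open>s\<close> and \<open>t\<close> are sections of the \<open>k\<close>-th powers over the fibres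
  at \<open>w\<close> and \<open>\<tau> * w\<close>; \<open>r\<close> is the isomorphism between these fibres induced by \<open>\<rho>(\<tau>)\<close>.\<close>

definition transported ::
  "('p, 'r, 'i) tconf \<Rightarrow> nat \<Rightarrow> complex \<Rightarrow> complex \<Rightarrow> ('i \<Rightarrow> 'r) \<Rightarrow> ('i \<Rightarrow> 'r) \<Rightarrow> bool" where
  "transported T k w \<tau> s t \<longleftrightarrow>
     s \<in> sections (fib T w) (fib_lb T w) k \<and> t \<in> sections (fib T (\<tau> * w)) (fib_lb T (\<tau> * w)) k \<and>
     (\<exists>r. morphism (fib T w) (fib T (\<tau> * w)) r \<and>
        mor_eq (fib T w) (tot T) (mor_comp (fib T (\<tau> * w)) (inc T (\<tau> * w)) r)
                                 (mor_comp (tot T) (act T \<tau>) (inc T w)) \<and>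
        bundle_pull (fib T w) (fib_lb T w) (fib_lb T (\<tau> * w)) r
          (\<lambda>a i. mfn (inc T w) (bdom (lb T) i \<inter> pre (tot T) (act T \<tau>) (bdom (lb T) a)) (lin T \<tau> a i))
          k s t)"

text \<open>Polynomials in the coordinate of the base as functions on the total space, and complex
  constants as functions on the fibre over \<open>w\<close>.\<close>

definition poly_fn :: "('p, 'r, 'i) tconf \<Rightarrow> complex poly \<Rightarrow> 'r" where
  "poly_fn T P = mfn (proj T) (pts line) (spec_fn type_ring P)"

definition const_fn :: "('p, 'r, 'i) tconf \<Rightarrow> complex \<Rightarrow> complex \<Rightarrow> 'r" where
  "const_fn T w c = mfn (inc T w) (pts (tot T)) (poly_fn T [:c:])"

text \<open>The weights of the action on the sections over the central fibre, where
  \<open>\<rho>(\<tau>)\<^sup>-\<^sup>1 \<circ> e \<circ> \<rho>(\<tau>) = \<tau>\<^sup>\<eta> e\<close>; the space of these sections has dimension \<open>N + 1\<close>.\<close>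

definition weights :: "('p, 'r, 'i) tconf \<Rightarrow> nat \<Rightarrow> nat \<Rightarrow> (nat \<Rightarrow> int) \<Rightarrow> bool" where
  "weights T k N \<eta> \<longleftrightarrow>
     (\<exists>e. section_basis (fib T 0) (fib_lb T 0) (const_fn T 0) k N e \<and>
        (\<forall>\<tau> \<alpha>. \<tau> \<noteq> 0 \<longrightarrow> \<alpha> \<le> N \<longrightarrow>
           transported T k 0 \<tau>
             (scale_section (fib T 0) (fib_lb T 0) (const_fn T 0 (\<tau> powi \<eta> \<alpha>)) (e \<alpha>)) (e \<alpha>)))"


section \<open>Compact complex manifolds and Hermitian metrics\<close>

definition holomorphic_map :: "(complex^'n) set \<Rightarrow> (complex^'n \<Rightarrow> 'a::real_normed_vector) \<Rightarrow>
    (complex \<Rightarrow> 'a \<Rightarrow> 'a) \<Rightarrow> bool" where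
  "holomorphic_map S f sm \<longleftrightarrow>
     (\<forall>p\<in>S. \<exists>D. (f has_derivative D) (at p) \<and> (\<forall>c v. D (c *s v) = sm c (D v)))"

type_synonym ('x, 'n) atlas = "('x set \<times> ('x \<Rightarrow> complex^'n)) set"

text \<open>The manifold is the whole type \<open>'x\<close>, of complex dimension \<open>CARD('n)\<close>.\<close>

definition compact_complex_manifold :: "('x::t2_space, 'n::finite) atlas \<Rightarrow> bool" where
  "compact_complex_manifold A \<longleftrightarrow>
     compact (UNIV :: 'x set) \<and> (\<Union>(U, z)\<in>A. U) = UNIV \<and>
     (\<forall>(U, z)\<in>A. open U \<and> open (z ` U) \<and> homeomorphism U (z ` U) z (the_inv_into U z)) \<and>
     (\<forall>(U, z)\<in>A. \<forall>(V, y)\<in>A. holomorphic_map (z ` (U \<inter> V)) (y \<circ> the_inv_into U z) (*s))"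

definition holomorphic_fn :: "('x::t2_space, 'n::finite) atlas \<Rightarrow> 'x set \<Rightarrow> ('x \<Rightarrow> complex) \<Rightarrow> bool" where
  "holomorphic_fn A W f \<longleftrightarrow>
     (\<forall>(U, z)\<in>A. holomorphic_map (z ` (U \<inter> W)) (f \<circ> the_inv_into U z) (*))"

definition hol_space :: "('x::t2_space, 'n::finite) atlas \<Rightarrow> ('x, 'x \<Rightarrow> complex) rspace" where
  "hol_space A = \<lparr>topo = euclidean,
     sec = (\<lambda>W. \<lparr>carrier = {f \<in> extensional W. holomorphic_fn A W f},
        monoid.mult = (\<lambda>f g. \<lambda>x\<in>W. f x * g x), one = (\<lambda>x\<in>W. 1),
        zero = (\<lambda>x\<in>W. 0), add = (\<lambda>f g. \<lambda>x\<in>W. f x + g x)\<rparr>),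
     res = (\<lambda>U V f. restrict f V)\<rparr>"

type_synonym ('i, 'x) hol_bundle = "('i, 'x, 'x \<Rightarrow> complex) lbundle"

text \<open>Infinitely differentiable real functions on an open set: all iterated partial derivatives exist and are
  continuous.\<close>

coinductive smooth_fn :: "'a::euclidean_space set \<Rightarrow> ('a \<Rightarrow> real) \<Rightarrow> bool" for S where
  "continuous_on S f \<Longrightarrow>
   (\<forall>b\<in>Basis. \<exists>g. smooth_fn S g \<and>
      (\<forall>p\<in>S. ((\<lambda>t. f (p + t *\<^sub>R b)) has_vector_derivative g p) (at 0))) \<Longrightarrow>
   smooth_fn S f"

text \<open>A metric \<open>h\<close> is given by positive functions in the trivializations: the norm square of the section \<open>s\<close> is
  \<open>|s\<^sub>i|\<^sup>2 h\<^sub>i\<close>.\<close>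

definition hermitian_metric ::
  "('x::t2_space, 'n::finite) atlas \<Rightarrow> ('i, 'x) hol_bundle \<Rightarrow> ('i \<Rightarrow> 'x \<Rightarrow> real) \<Rightarrow> bool" where
  "hermitian_metric A L h \<longleftrightarrow>
     (\<forall>i\<in>idx L. \<forall>x\<in>bdom L i. h i x > 0) \<and>
     (\<forall>i\<in>idx L. \<forall>j\<in>idx L. \<forall>x\<in>bdom L i \<inter> bdom L j. h j x = (cmod (btrans L i j x))\<^sup>2 * h i x) \<and>
     (\<forall>i\<in>idx L. \<forall>(U, z)\<in>A. smooth_fn (z ` (U \<inter> bdom L i)) (h i \<circ> the_inv_into U z))"

definition triv_at :: "('i, 'x) hol_bundle \<Rightarrow> 'x \<Rightarrow> 'i" where
  "triv_at L x = (SOME i. i \<in> idx L \<and> x \<in> bdom L i)"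

definition dir_deriv :: "complex^'n \<Rightarrow> (complex^'n \<Rightarrow> complex) \<Rightarrow> complex^'n::finite \<Rightarrow> complex" where
  "dir_deriv v u p = vector_derivative (\<lambda>t::real. u (p + t *\<^sub>R v)) (at 0)"

definition del :: "'n \<Rightarrow> (complex^'n \<Rightarrow> complex) \<Rightarrow> complex^'n::finite \<Rightarrow> complex" where
  "del j u p = (dir_deriv (axis j 1) u p - \<i> * dir_deriv (axis j \<i>) u p) / 2"

definition delbar :: "'n \<Rightarrow> (complex^'n \<Rightarrow> complex) \<Rightarrow> complex^'n::finite \<Rightarrow> complex" where
  "delbar j u p = (dir_deriv (axis j 1) u p + \<i> * dir_deriv (axis j \<i>) u p) / 2"

text \<open>The real two-form \<open>- (\<i>/2) \<partial>\<partial>\<^sup>-u\<close> at \<open>p\<close>, evaluated on tangent vectors \<open>v\<close>, \<open>w\<close>.\<close>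

definition ddbar_form :: "(complex^'n \<Rightarrow> complex) \<Rightarrow> complex^'n \<Rightarrow> complex^'n \<Rightarrow> complex^'n::finite \<Rightarrow> real" where
  "ddbar_form u p v w = Re (- (\<i> / 2) *
     (\<Sum>j\<in>UNIV. \<Sum>k\<in>UNIV. del j (delbar k u) p * (v $ j * cnj (w $ k) - w $ j * cnj (v $ k))))"

text \<open>The curvature form in a chart.  It is independent of the trivialization, since the logarithms of
  two local weights differ by a pluriharmonic function.\<close>

definition curvature_form ::
  "('i, 'x) hol_bundle \<Rightarrow> ('i \<Rightarrow> 'x \<Rightarrow> real) \<Rightarrow> 'x set \<times> ('x \<Rightarrow> complex^'n) \<Rightarrow>
   complex^'n \<Rightarrow> complex^'n \<Rightarrow> complex^'n::finite \<Rightarrow> real" where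
  "curvature_form L h c p =
     (let x = the_inv_into (fst c) (snd c) p in
      ddbar_form (\<lambda>p'. complex_of_real (ln (h (triv_at L x) (the_inv_into (fst c) (snd c) p')))) p)"

definition positive_curvature ::
  "('x::t2_space, 'n::finite) atlas \<Rightarrow> ('i, 'x) hol_bundle \<Rightarrow> ('i \<Rightarrow> 'x \<Rightarrow> real) \<Rightarrow> bool" where
  "positive_curvature A L h \<longleftrightarrow>
     (\<forall>c\<in>A. \<forall>p\<in>snd c ` fst c. \<forall>v. v \<noteq> 0 \<longrightarrow> curvature_form L h c p v (\<i> *s v) > 0)"

text \<open>
  The value of the \<open>n\<close>-fold wedge power of a two-form on the positively oriented real basis that consists, for
  each coordinate, of the real unit vector followed by \<open>\<i>\<close> times it.
\<close>

definition top_power :: "(complex^'n \<Rightarrow> complex^'n \<Rightarrow> real) \<Rightarrow> real" where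
  "top_power \<omega> =
     (let e = (\<lambda>(j, b). axis j (if b then \<i> else 1)) :: 'n \<times> bool \<Rightarrow> complex^'n::finite in
      (\<Sum>\<sigma>\<in>{\<sigma>. \<sigma> permutes (UNIV :: ('n \<times> bool) set)}.
         of_int (sign \<sigma>) * (\<Prod>j\<in>UNIV. \<omega> (e (\<sigma> (j, False))) (e (\<sigma> (j, True))))) / 2 ^ CARD('n))"

text \<open>\<open>\<nu>\<close> is integration against the top power of the curvature form of \<open>h\<close>.\<close>

definition curvature_volume ::
  "('x::t2_space, 'n::finite) atlas \<Rightarrow> ('i, 'x) hol_bundle \<Rightarrow> ('i \<Rightarrow> 'x \<Rightarrow> real) \<Rightarrow> 'x measure \<Rightarrow> bool" where
  "curvature_volume A L h \<nu> \<longleftrightarrow> sets \<nu> = sets borel \<and>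
     (\<forall>c\<in>A. \<forall>B\<in>sets borel. B \<subseteq> fst c \<longrightarrow>
        emeasure \<nu> B = (\<integral>\<^sup>+p. ennreal (top_power (curvature_form L h c p)) * indicator (snd c ` B) p \<partial>lborel))"

definition herm ::
  "('i, 'x) hol_bundle \<Rightarrow> ('i \<Rightarrow> 'x \<Rightarrow> real) \<Rightarrow> nat \<Rightarrow> ('i \<Rightarrow> 'x \<Rightarrow> complex) \<Rightarrow> ('i \<Rightarrow> 'x \<Rightarrow> complex) \<Rightarrow> 'x \<Rightarrow> complex" where
  "herm L h k s t x = (let i = triv_at L x in s i x * cnj (t i x) * complex_of_real (h i x ^ k))"

definition pt_norm ::
  "('i, 'x) hol_bundle \<Rightarrow> ('i \<Rightarrow> 'x \<Rightarrow> real) \<Rightarrow> ('i \<Rightarrow> 'x \<Rightarrow> complex) \<Rightarrow> 'x \<Rightarrow> real" where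
  "pt_norm L h s x = sqrt (Re (herm L h 1 s s x))"

text \<open>The \<open>L\<^sup>2\<close> product for the volume form \<open>\<omega>\<^sup>n / n!\<close>, where \<open>\<nu>\<close> is integration against \<open>\<omega>\<^sup>n\<close>.\<close>

definition L2_inner ::
  "nat \<Rightarrow> ('i, 'x) hol_bundle \<Rightarrow> ('i \<Rightarrow> 'x \<Rightarrow> real) \<Rightarrow> 'x measure \<Rightarrow> nat \<Rightarrow>
   ('i \<Rightarrow> 'x \<Rightarrow> complex) \<Rightarrow> ('i \<Rightarrow> 'x \<Rightarrow> complex) \<Rightarrow> complex" where
  "L2_inner n L h \<nu> k s t = (LINT x|\<nu>. herm L h k s t x) / fact n"


section \<open>The general fibre and adapted bases\<close>

text \<open>
  \<open>\<phi>\<close> exhibits the manifold as the analytic space of \<open>Y\<close>: it is a bijection onto the closed points and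
  induces isomorphisms of completed local rings, that is, of the quotients by all powers
  of the maximal ideals.
\<close>

definition analytification ::
  "('p, 'r) rspace \<Rightarrow> ('q, 's) rspace \<Rightarrow> ('p, 'r, 'q, 's) rmor \<Rightarrow> bool" where
  "analytification X Y \<phi> \<longleftrightarrow> morphism X Y \<phi> \<and>
     bij_betw (mpt \<phi>) (pts X) {y \<in> pts Y. closedin (topo Y) {y}} \<and>
     (\<forall>x\<in>pts X. \<forall>m.
        let R = stalk X x; S = stalk Y (mpt \<phi> x);
            I = ideal_pow R (max_ideal R) m; J = ideal_pow S (max_ideal S) m
        in (\<forall>a\<in>carrier S. stalk_map X \<phi> x a \<in> I \<longleftrightarrow> a \<in> J) \<and>
           (\<forall>b\<in>carrier R. \<exists>a\<in>carrier S. b \<ominus>\<^bsub>R\<^esub> stalk_map X \<phi> x a \<in> I))"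

text \<open>The isomorphism of \<open>L \<rightarrow> X\<close> with the fibre over 1; it is compatible with complex constants.\<close>

definition general_fibre ::
  "('x::t2_space, 'n::finite) atlas \<Rightarrow> ('j, 'x) hol_bundle \<Rightarrow> ('p, 'r, 'i) tconf \<Rightarrow>
   ('x, 'x \<Rightarrow> complex, 'p, 'r) rmor \<Rightarrow> ('i \<Rightarrow> 'j \<Rightarrow> 'x \<Rightarrow> complex) \<Rightarrow> bool" where
  "general_fibre A L T \<phi> \<mu> \<longleftrightarrow>
     analytification (hol_space A) (fib T 1) \<phi> \<and>
     (\<forall>c. mfn \<phi> (pts (fib T 1)) (const_fn T 1 c) = (\<lambda>x. c)) \<and>
     bundle_map (hol_space A) L (fib T 1) (fib_lb T 1) \<phi> \<mu>"

text \<open>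
  The sections \<open>s'\<close> are the \<open>s \<alpha>\<close> viewed as sections over the fibre at 1, and \<open>S \<alpha>\<close> is the extension of
  \<open>w \<mapsto> w\<^sup>\<eta> \<rho>(w) s \<alpha>\<close> to a section over the total space, that is, to a section over the base of the direct image.
\<close>

definition adapted_orthonormal_basis ::
  "('x::t2_space, 'n::finite) atlas \<Rightarrow> ('j, 'x) hol_bundle \<Rightarrow> ('j \<Rightarrow> 'x \<Rightarrow> real) \<Rightarrow> 'x measure \<Rightarrow>
   ('p, 'r, 'i) tconf \<Rightarrow> ('x, 'x \<Rightarrow> complex, 'p, 'r) rmor \<Rightarrow> ('i \<Rightarrow> 'j \<Rightarrow> 'x \<Rightarrow> complex) \<Rightarrow>
   nat \<Rightarrow> nat \<Rightarrow> (nat \<Rightarrow> int) \<Rightarrow> (nat \<Rightarrow> 'j \<Rightarrow> 'x \<Rightarrow> complex) \<Rightarrow> bool" where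
  "adapted_orthonormal_basis A L h \<nu> T \<phi> \<mu> k N \<eta> s \<longleftrightarrow>
     section_basis (hol_space A) L (\<lambda>c x. c) k N s \<and>
     (\<forall>\<alpha>\<le>N. \<forall>\<beta>\<le>N. L2_inner CARD('n) L h \<nu> k (s \<alpha>) (s \<beta>) = (if \<alpha> = \<beta> then 1 else 0)) \<and>
     (\<exists>s' S.
        (\<forall>\<alpha>\<le>N. s' \<alpha> \<in> sections (fib T 1) (fib_lb T 1) k \<and>
           bundle_pull (hol_space A) L (fib_lb T 1) \<phi> \<mu> k (s \<alpha>) (s' \<alpha>)) \<and>
        section_basis (tot T) (lb T) (poly_fn T) k N S \<and>
        (\<forall>\<alpha>\<le>N. \<forall>w. w \<noteq> 0 \<longrightarrow>
           (\<exists>t. transported T k 1 w (s' \<alpha>) t \<and>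
              pull_section (inc T w) (lb T) (S \<alpha>)
              = scale_section (fib T w) (fib_lb T w) (const_fn T w (w powi \<eta> \<alpha>)) t)) \<and>
        (\<forall>\<alpha>\<le>N. \<forall>w \<tau>. \<tau> \<noteq> 0 \<longrightarrow>
           transported T k w \<tau>
             (scale_section (fib T w) (fib_lb T w) (const_fn T w (\<tau> powi \<eta> \<alpha>))
                (pull_section (inc T w) (lb T) (S \<alpha>)))
             (pull_section (inc T (\<tau> * w)) (lb T) (S \<alpha>))))"

end

theory Submission
  imports Defs
begin

text \<open>
  The \<open>k\<close>-th power of the extension \<open>S\<^sub>\<beta>\<close> of the basis section \<open>s\<^sub>\<beta>\<close> is a section of the \<open>k\<close>-th power of the
  line bundle over the total space, so it is a combination of the extended basis sections \<open>S\<^sub>\<alpha>\<close> for \<open>k\<close>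
  with polynomial coefficients \<open>P\<^sub>\<alpha>\<close>.  Evaluating this identity at the points \<open>\<rho>(w) x\<close> with \<open>x\<close> in
  the fibre at 1, and comparing with the case \<open>w = 1\<close> by linear independence of the \<open>s\<^sub>\<alpha>\<close>, gives
  \<open>P\<^sub>\<alpha>(w) w\<^sup>p = w\<^sup>q P\<^sub>\<alpha>(1)\<close> for \<open>w \<noteq> 0\<close>, where \<open>p\<close> is the weight of \<open>s\<^sub>\<alpha>\<close> and \<open>q\<close> is \<open>k\<close> times
  the weight of \<open>s\<^sub>\<beta>\<close>.  A polynomial has no pole at 0, so the coefficient \<open>P\<^sub>\<alpha>(1)\<close> vanishes if \<open>q < p\<close>.

  The bound is Parseval's identity.  It requires the volume to be finite.  To avoid
  showing that the curvature is independent of the trivializations, this is derived from ampleness of the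
  fibre at 1, which provides for every point a basis section of some power that does not vanish there;
  such a section is continuous and square integrable, so the volume is locally finite.
\<close>

section \<open>Spectra of integral domains\<close>

lemma type_ring_simps [simp]:
  "carrier type_ring = UNIV" "monoid.mult type_ring = (*)" "one type_ring = 1"
  "zero type_ring = 0" "add type_ring = (+)"
  by (simp_all add: type_ring_def)

lemma cring_type_ring: "cring (type_ring :: 'a::comm_ring_1 ring)"
  by (intro cringI abelian_groupI comm_monoidI)
    (auto simp: algebra_simps intro: exI[of _ "- x" for x] add.left_inverse)

lemma minus_type_ring [simp]: "x \<ominus>\<^bsub>type_ring\<^esub> y = (x - y :: 'a::comm_ring_1)"
proof -
  interpret cring "type_ring :: 'a ring" by (rule cring_type_ring)
  have "\<ominus>\<^bsub>type_ring\<^esub> y = - y"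
    by (rule minus_equality) auto
  then show ?thesis by (simp add: a_minus_def)
qed

text \<open>Since every element of the type lies in the carrier, primality reduces to closure
  conditions on a set, to which rewriting applies. Closure under negation need not be listed: it is
  multiplication by \<open>- 1\<close>.\<close>

lemma primes_iff:
  "q \<in> primes (type_ring :: 'a::comm_ring_1 ring) \<longleftrightarrow>
     0 \<in> q \<and> (\<forall>a\<in>q. \<forall>b\<in>q. a + b \<in> q) \<and> (\<forall>a b. a \<in> q \<longrightarrow> a * b \<in> q) \<and> 1 \<notin> q \<and>
     (\<forall>a b. a * b \<in> q \<longrightarrow> a \<in> q \<or> b \<in> q)" (is "?P \<longleftrightarrow> ?Q")
proof
  assume ?P
  then interpret primeideal q "type_ring :: 'a ring" by (simp add: primes_def)
  show ?Q
    using I_l_closed I_r_closed I_prime additive_subgroup.zero_closed[OF additive_subgroup_axioms]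
      additive_subgroup.a_closed[OF additive_subgroup_axioms] one_imp_carrier I_notcarr by auto
next
  assume Q: ?Q
  have *: "- a \<in> q" if "a \<in> q" for a
    using Q that by (metis mult_minus1_right)
  have "primeideal q (type_ring :: 'a ring)"
  proof (rule primeidealI2)
    show "additive_subgroup q (type_ring :: 'a ring)"
    proof (rule additive_subgroup.intro, rule group.subgroupI)
      interpret cring "type_ring :: 'a ring" by (rule cring_type_ring)
      show "group (add_monoid (type_ring :: 'a ring))" by (rule add.is_group)
      fix a assume "a \<in> q"
      moreover have "inv\<^bsub>add_monoid type_ring\<^esub> a = - a"
        using minus_type_ring[of 0 a] by (simp add: a_minus_def a_inv_def)
      ultimately show "inv\<^bsub>add_monoid type_ring\<^esub> a \<in> q" using * by simp
    qed (use Q in auto)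
  qed (use Q cring_type_ring in \<open>auto simp: mult.commute\<close>)
  then show ?P by (simp add: primes_def)
qed

lemma
  assumes "q \<in> primes (type_ring :: 'a::comm_ring_1 ring)"
  shows prime_zero: "0 \<in> q" and prime_one: "1 \<notin> q"
  using assms by (simp_all add: primes_iff)

text \<open>\<open>topology\<close> returns the intended open sets only for a predicate satisfying
  the axioms of a topology. These have to be checked before anything can be said about the points of
  a spectrum.\<close>

lemma pts_Spec [simp]: "pts (Spec (type_ring :: 'a::comm_ring_1 ring)) = primes type_ring"
proof -
  have "istopology (\<lambda>U. \<exists>I\<subseteq>carrier (type_ring :: 'a ring). U = {q \<in> primes type_ring. \<not> I \<subseteq> q})"
    unfolding istopology_def
  proof (intro conjI allI impI)
    fix S T :: "'a set set"
    assume "\<exists>I\<subseteq>carrier type_ring. S = {q \<in> primes type_ring. \<not> I \<subseteq> q}"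
      and "\<exists>I\<subseteq>carrier type_ring. T = {q \<in> primes type_ring. \<not> I \<subseteq> q}"
    then obtain I J where "S = {q \<in> primes type_ring. \<not> I \<subseteq> q}" "T = {q \<in> primes type_ring. \<not> J \<subseteq> q}"
      by blast
    \<comment> \<open>Primality makes the intersection of the open sets of \<open>I\<close> and
      \<open>J\<close> the open set of all products \<open>a * b\<close>.\<close>
    moreover have "\<not> I \<subseteq> q \<and> \<not> J \<subseteq> q \<longleftrightarrow> \<not> {a * b | a b. a \<in> I \<and> b \<in> J} \<subseteq> q"
      if "q \<in> primes type_ring" for q
    proof -
      have "a * b \<in> q \<longleftrightarrow> a \<in> q \<or> b \<in> q" for a b
        using that unfolding primes_iff by (metis mult.commute)
      then show ?thesis by blast
    qed
    ultimately have "S \<inter> T = {q \<in> primes type_ring. \<not> {a * b | a b. a \<in> I \<and> b \<in> J} \<subseteq> q}"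
      by blast
    then show "\<exists>I\<subseteq>carrier type_ring. S \<inter> T = {q \<in> primes type_ring. \<not> I \<subseteq> q}"
      by (intro exI[of _ "{a * b | a b. a \<in> I \<and> b \<in> J}"]) simp
  next
    fix \<K> :: "'a set set set"
    assume "\<forall>K\<in>\<K>. \<exists>I\<subseteq>carrier type_ring. K = {q \<in> primes type_ring. \<not> I \<subseteq> q}"
    then obtain I where I: "\<And>K. K \<in> \<K> \<Longrightarrow> K = {q \<in> primes type_ring. \<not> I K \<subseteq> q}"
      by metis
    have "q \<in> K \<longleftrightarrow> q \<in> primes type_ring \<and> \<not> I K \<subseteq> q" if "K \<in> \<K>" for q K
      by (subst I[OF that]) simp
    then have "\<Union>\<K> = {q \<in> primes type_ring. \<not> (\<Union>K\<in>\<K>. I K) \<subseteq> q}"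
      unfolding set_eq_iff Union_iff mem_Collect_eq UN_subset_iff by metis
    then show "\<exists>I\<subseteq>carrier type_ring. \<Union>\<K> = {q \<in> primes type_ring. \<not> I \<subseteq> q}"
      by (intro exI[of _ "\<Union>K\<in>\<K>. I K"]) simp
  qed
  then have op: "openin (zariski (type_ring :: 'a ring)) U \<longleftrightarrow> (\<exists>I. U = {q \<in> primes type_ring. \<not> I \<subseteq> q})" for U
    by (simp add: zariski_def topology_inverse')
  \<comment> \<open>The whole spectrum is the open set of the ideal \<open>UNIV\<close>, which is
    contained in no prime because primes omit 1.\<close>
  have "primes type_ring = {q \<in> primes (type_ring :: 'a ring). \<not> UNIV \<subseteq> q}"
    by (auto dest: prime_one)
  then have "openin (zariski (type_ring :: 'a ring)) (primes type_ring)"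
    by (subst op) blast
  then show ?thesis
    using openin_subset[of "zariski type_ring" "topspace (zariski type_ring)"] op[of "topspace (zariski type_ring)"]
    by (auto simp: Spec_def dest: openin_subset)
qed

text \<open>In a domain the multiplier \<open>u\<close> from the definition of localization can be
  cancelled: 0 lies in \<open>q\<close>, so \<open>u\<close> is nonzero. Conversely
  \<open>u = 1\<close> will do. What remains is cross-multiplication.\<close>

lemma fraction_iff:
  fixes a b :: "'a::idom"
  assumes "q \<in> primes type_ring"
  shows "(c, d) \<in> fraction type_ring q a b \<longleftrightarrow> d \<notin> q \<and> a * d = c * b"
  using assms by (auto simp: fraction_def prime_zero prime_one intro!: bexI[of _ 1])

text \<open>A class does not depend on its representative, because cross-multiplication is
  transitive when \<open>b\<close> and \<open>d\<close> are nonzero. This is required wherever a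
  representative is picked by \<open>SOME\<close>.\<close>

lemma fraction_eq:
  fixes a b :: "'a::idom"
  assumes q: "q \<in> primes type_ring" and "(c, d) \<in> fraction type_ring q a b" "b \<notin> q"
  shows "fraction type_ring q c d = fraction type_ring q a b"
proof -
  have *: "d \<noteq> 0" "b \<noteq> 0" "a * d = c * b"
    using assms by (auto simp: fraction_iff prime_zero prime_one)
  have "c * f = e * d \<longleftrightarrow> a * f = e * b" for e f
  proof -
    have "c * f = e * d \<longleftrightarrow> b * (c * f) = b * (e * d)"
      using * by simp
    also have "b * (c * f) = d * (a * f)"
      using *(3) by (metis mult.assoc mult.commute)
    also have "d * (a * f) = b * (e * d) \<longleftrightarrow> d * (a * f) = d * (e * b)"
      by (simp add: ac_simps)
    also have "\<dots> \<longleftrightarrow> a * f = e * b"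
      using * by simp
    finally show ?thesis .
  qed
  then show ?thesis
    using q by (auto simp: fraction_iff)
qed

lemma spec_fn_carrier:
  "spec_fn (type_ring :: 'a::comm_ring_1 ring) a \<in> carrier (sec (Spec type_ring) (primes type_ring))"
proof -
  have "openin (topo (Spec (type_ring :: 'a ring))) (pts (Spec (type_ring :: 'a ring)))"
    by (rule openin_topspace)
  then have "openin (zariski (type_ring :: 'a ring)) (primes type_ring)"
    unfolding pts_Spec by (simp add: Spec_def)
  then show ?thesis
    unfolding Spec_def spec_sections_def spec_fn_def
    by (simp, intro ballI exI[of _ "primes type_ring"] conjI exI[of _ a] exI[of _ 1]) (simp_all add: prime_one)
qed

text \<open>These facts are applied to the evaluation of polynomials at \<open>w\<close> and to the
  substitution that multiplies the coordinate by a constant, the two ring homomorphisms behind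
  \<open>line_point\<close> and \<open>line_mult\<close>.\<close>

lemma
  fixes f :: "'a::idom \<Rightarrow> 'b::idom"
  assumes hom: "\<And>a b. f (a + b) = f a + f b" "\<And>a b. f (a * b) = f a * f b" "f 1 = 1"
  shows pre_spec_map: "pre (Spec type_ring) (spec_map type_ring type_ring f) (primes type_ring) = primes type_ring"
    and mfn_spec_map: "mfn (spec_map type_ring type_ring f) (primes type_ring) (spec_fn type_ring a)
      = spec_fn type_ring (f a)"
proof -
  have f0: "f 0 = 0"
    by (metis add.right_neutral add_left_cancel hom(1))
  have pr: "{r. f r \<in> q} \<in> primes type_ring" if "q \<in> primes type_ring" for q
    using that unfolding primes_iff by (auto simp: hom f0)
  then show "pre (Spec type_ring) (spec_map type_ring type_ring f) (primes type_ring) = primes type_ring"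
    by (auto simp: pre_def spec_map_def Let_def)
  show "mfn (spec_map type_ring type_ring f) (primes type_ring) (spec_fn type_ring a)
      = spec_fn type_ring (f a)"
  proof
    fix q :: "'b set"
    show "mfn (spec_map type_ring type_ring f) (primes type_ring) (spec_fn type_ring a) q
      = spec_fn type_ring (f a) q"
    proof (cases "q \<in> primes type_ring")
      case True
      define q' where "q' = {r. f r \<in> q}"
      have q': "q' \<in> primes type_ring" using pr[OF True] by (simp add: q'_def)
      \<comment> \<open>The class is nonempty, so the pair chosen by \<open>SOME\<close> really
        represents it; \<open>fraction_eq\<close> then removes the dependence on the choice.\<close>
      have "(a, 1) \<in> fraction type_ring q' a 1"
        using q' by (auto simp: fraction_iff prime_one)
      then have "(SOME r. r \<in> fraction type_ring q' a 1) \<in> fraction type_ring q' a 1"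
        by (rule someI)
      moreover obtain c d where cd: "(SOME r. r \<in> fraction type_ring q' a 1) = (c, d)"
        by fastforce
      ultimately have "d \<notin> q'" "a * d = c"
        using q' by (auto simp: fraction_iff)
      then have "(f c, f d) \<in> fraction type_ring q (f a) 1"
        using True by (auto simp: fraction_iff q'_def simp flip: hom(2))
      then have "fraction type_ring q (f c) (f d) = fraction type_ring q (f a) 1"
        using True by (intro fraction_eq) (auto simp: prime_one)
      then show ?thesis
        using True q' cd by (simp add: spec_map_def spec_fn_def Let_def q'_def)
    next
      case False
      then show ?thesis
        by (simp add: spec_map_def spec_fn_def Let_def)
    qed
  qed
qed


section \<open>Evaluation at a point\<close>

text \<open>The homomorphisms \<open>e U\<close> play the part of the residue map at a complex point \<open>y\<close> of a scheme,
  and of the evaluation of functions at a point of a manifold.\<close>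

definition evaluation :: "('p, 'r) rspace \<Rightarrow> 'p \<Rightarrow> ('p set \<Rightarrow> 'r \<Rightarrow> complex) \<Rightarrow> bool" where
  "evaluation Y y e \<longleftrightarrow> y \<in> pts Y \<and>
     (\<forall>U. openin (topo Y) U \<longrightarrow> y \<in> U \<longrightarrow>
        e U \<in> ring_hom (sec Y U) type_ring \<and>
        (\<forall>V g. openin (topo Y) V \<longrightarrow> y \<in> V \<longrightarrow> V \<subseteq> U \<longrightarrow> g \<in> carrier (sec Y U) \<longrightarrow> e V (res Y U V g) = e U g))"

text \<open>If \<open>e\<close> evaluates at \<open>x\<close>, this is evaluation at the image of
  \<open>x\<close>: pull the function back, then evaluate.\<close>

definition pull_eval ::
  "('p, 'r) rspace \<Rightarrow> ('p, 'r, 'q, 's) rmor \<Rightarrow> ('p set \<Rightarrow> 'r \<Rightarrow> complex) \<Rightarrow> 'q set \<Rightarrow> 's \<Rightarrow> complex" where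
  "pull_eval X f e V g = e (pre X f V) (mfn f V g)"

section \<open>Preimages, composition and transport of evaluations along morphisms\<close>

lemma pre_Int: "pre X f (V \<inter> W) = pre X f V \<inter> pre X f W"
  by (auto simp: pre_def)

lemma morphism_pts: "morphism X Y f \<Longrightarrow> x \<in> pts X \<Longrightarrow> mpt f x \<in> pts Y"
  by (auto simp: morphism_def continuous_map_def)

lemma openin_pre: "morphism X Y f \<Longrightarrow> openin (topo Y) V \<Longrightarrow> openin (topo X) (pre X f V)"
  using openin_continuous_map_preimage[of "topo X" "topo Y" "mpt f" V] by (simp add: morphism_def pre_def)

lemma pre_pts: "morphism X Y f \<Longrightarrow> pre X f (pts Y) = pts X"
  by (auto simp: pre_def morphism_pts)

lemma morphism_hom: "morphism X Y f \<Longrightarrow> openin (topo Y) V \<Longrightarrow> mfn f V \<in> ring_hom (sec Y V) (sec X (pre X f V))"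
  by (simp add: morphism_def)

lemma morphism_res: "morphism X Y f \<Longrightarrow> openin (topo Y) V \<Longrightarrow> openin (topo Y) W \<Longrightarrow> W \<subseteq> V \<Longrightarrow>
    g \<in> carrier (sec Y V) \<Longrightarrow> mfn f W (res Y V W g) = res X (pre X f V) (pre X f W) (mfn f V g)"
  by (simp add: morphism_def)

lemma pre_mono: "W \<subseteq> V \<Longrightarrow> pre X f W \<subseteq> pre X f V"
  by (auto simp: pre_def)

lemma pre_comp: "morphism X Y f \<Longrightarrow> pre X (mor_comp Y g f) W = pre X f (pre Y g W)"
  by (auto simp: pre_def mor_comp_def morphism_pts)

lemma pre_mor_eq: "mor_eq X Y f g \<Longrightarrow> pre X f W = pre X g W"
  by (auto simp: pre_def mor_eq_def)

lemma pull_eval_comp: "morphism X Y f \<Longrightarrow> pull_eval X (mor_comp Y g f) e = pull_eval Y g (pull_eval X f e)"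
  by (simp add: pull_eval_def pre_comp fun_eq_iff) (simp add: mor_comp_def)

lemma pull_eval_mor_eq: "mor_eq X Y f g \<Longrightarrow> openin (topo Y) V \<Longrightarrow> s \<in> carrier (sec Y V) \<Longrightarrow>
    pull_eval X f e V s = pull_eval X g e V s"
  unfolding pull_eval_def by (subst pre_mor_eq, assumption) (simp add: mor_eq_def)

text \<open>Ring homomorphisms compatible with restriction compose. In this way a point of the
  manifold gives complex-valued evaluations on the fibre at 1 and on the total space without any
  construction of residue fields.\<close>

lemma evaluation_pull:
  assumes f: "morphism X Y f" and e: "evaluation X x e"
  shows "evaluation Y (mpt f x) (pull_eval X f e)"
  unfolding evaluation_def
proof (intro conjI allI impI)
  show "mpt f x \<in> pts Y"
    using f e by (simp add: evaluation_def morphism_pts)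
  fix U assume U: "openin (topo Y) U" "mpt f x \<in> U"
  have x: "x \<in> pre X f V" if "mpt f x \<in> V" for V
    using that e by (simp add: pre_def evaluation_def)
  show "pull_eval X f e U \<in> ring_hom (sec Y U) type_ring"
  proof -
    have "e (pre X f U) \<in> ring_hom (sec X (pre X f U)) type_ring"
      using e U x openin_pre[OF f] by (simp add: evaluation_def)
    from ring_hom_trans[OF morphism_hom[OF f U(1)] this]
    moreover have "pull_eval X f e U = e (pre X f U) \<circ> mfn f U"
      by (simp add: fun_eq_iff pull_eval_def)
    ultimately show ?thesis by simp
  qed
  fix V g assume V: "openin (topo Y) V" "mpt f x \<in> V" "V \<subseteq> U" "g \<in> carrier (sec Y U)"
  show "pull_eval X f e V (res Y U V g) = pull_eval X f e U g"
    using e U V x openin_pre[OF f] pre_mono[OF V(3), of X f]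
      ring_hom_closed[OF morphism_hom[OF f U(1)] V(4)]
    by (simp add: pull_eval_def morphism_res[OF f] evaluation_def)
qed

section \<open>Rules for a fixed evaluation\<close>

context
  fixes Y :: "('p, 'r) rspace" and y e
  assumes ev: "evaluation Y y e"
begin

lemma eval_hom: "openin (topo Y) U \<Longrightarrow> y \<in> U \<Longrightarrow> e U \<in> ring_hom (sec Y U) type_ring"
  using ev by (simp add: evaluation_def)

lemma eval_res: "openin (topo Y) U \<Longrightarrow> openin (topo Y) V \<Longrightarrow> y \<in> V \<Longrightarrow> V \<subseteq> U \<Longrightarrow>
    g \<in> carrier (sec Y U) \<Longrightarrow> e V (res Y U V g) = e U g"
  using ev by (auto simp: evaluation_def)

lemma eval_mult: "openin (topo Y) U \<Longrightarrow> y \<in> U \<Longrightarrow> f \<in> carrier (sec Y U) \<Longrightarrow> g \<in> carrier (sec Y U) \<Longrightarrow>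
    e U (f \<otimes>\<^bsub>sec Y U\<^esub> g) = e U f * e U g"
  using ring_hom_mult[OF eval_hom] by simp

lemma eval_pow:
  assumes Y: "ringed_space Y" and U: "openin (topo Y) U" "y \<in> U" and f: "f \<in> carrier (sec Y U)"
  shows "e U (f [^]\<^bsub>sec Y U\<^esub> (n::nat)) = e U f ^ n"
proof -
  interpret cring "sec Y U"
    using Y U by (simp add: ringed_space_def)
  show ?thesis
    using ring_hom_one[OF eval_hom[OF U]] by (induction n) (simp_all add: f eval_mult U)
qed

lemma eval_unit:
  assumes U: "openin (topo Y) U" "y \<in> U" and f: "f \<in> Units (sec Y U)"
  shows "e U f \<noteq> 0"
proof -
  obtain g where "g \<in> carrier (sec Y U)" "f \<in> carrier (sec Y U)" "g \<otimes>\<^bsub>sec Y U\<^esub> f = \<one>\<^bsub>sec Y U\<^esub>"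
    using f by (auto simp: Units_def)
  then have "e U g * e U f = 1"
    using eval_mult[OF U, of g f] ring_hom_one[OF eval_hom[OF U]] by simp
  then show ?thesis by auto
qed

lemma eval_finsum:
  assumes Y: "ringed_space Y" and U: "openin (topo Y) U" "y \<in> U"
    and "finite I" and "f \<in> I \<rightarrow> carrier (sec Y U)"
  shows "e U (finsum (sec Y U) f I) = (\<Sum>i\<in>I. e U (f i))"
proof -
  interpret ring_hom_cring "sec Y U" "type_ring :: complex ring" "e U"
    using Y U by (intro ring_hom_cringI cring_type_ring eval_hom) (simp_all add: ringed_space_def)
  have "finsum (type_ring :: complex ring) g I = sum g I" for g :: "_ \<Rightarrow> complex"
    using \<open>finite I\<close> by induction (auto simp: S.finsum_insert)
  then show ?thesis
    using hom_finsum[OF assms(5)] by (simp add: comp_def)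
qed

end

section \<open>Sections of line bundles\<close>

lemma ring_hom_Units:
  assumes "h \<in> ring_hom R S" and f: "f \<in> Units R"
  shows "h f \<in> Units S"
proof -
  obtain g where g: "g \<in> carrier R" "f \<in> carrier R" "g \<otimes>\<^bsub>R\<^esub> f = \<one>\<^bsub>R\<^esub>" "f \<otimes>\<^bsub>R\<^esub> g = \<one>\<^bsub>R\<^esub>"
    using f by (auto simp: Units_def)
  then have "h g \<otimes>\<^bsub>S\<^esub> h f = \<one>\<^bsub>S\<^esub>" "h f \<otimes>\<^bsub>S\<^esub> h g = \<one>\<^bsub>S\<^esub>"
    using ring_hom_mult[OF assms(1)] ring_hom_one[OF assms(1)] by metis+
  then show ?thesis
    using g ring_hom_closed[OF assms(1)] by (auto simp: Units_def)
qed

lemma ring_hom_nat_pow: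
  assumes "cring R" "cring S" and h: "h \<in> ring_hom R S" and f: "f \<in> carrier R"
  shows "h (f [^]\<^bsub>R\<^esub> (n::nat)) = h f [^]\<^bsub>S\<^esub> n"
proof -
  interpret R: cring R by fact
  interpret S: cring S by fact
  show ?thesis
    by (induction n) (simp_all add: ring_hom_mult[OF h] ring_hom_one[OF h] f)
qed

lemma ringed_space_cring: "ringed_space X \<Longrightarrow> openin (topo X) U \<Longrightarrow> cring (sec X U)"
  by (simp add: ringed_space_def)

lemma ringed_space_res: "ringed_space X \<Longrightarrow> openin (topo X) U \<Longrightarrow> openin (topo X) V \<Longrightarrow> V \<subseteq> U \<Longrightarrow>
    res X U V \<in> ring_hom (sec X U) (sec X V)"
  by (simp add: ringed_space_def)

lemma line_bundle_open: "line_bundle X L \<Longrightarrow> i \<in> idx L \<Longrightarrow> openin (topo X) (bdom L i)"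
  by (simp add: line_bundle_def)

lemma line_bundle_cover: "line_bundle X L \<Longrightarrow> x \<in> pts X \<Longrightarrow> \<exists>i\<in>idx L. x \<in> bdom L i"
  unfolding line_bundle_def by (metis UN_E)

lemma line_bundle_trans: "line_bundle X L \<Longrightarrow> i \<in> idx L \<Longrightarrow> j \<in> idx L \<Longrightarrow>
    btrans L i j \<in> Units (sec X (bdom L i \<inter> bdom L j))"
  by (simp add: line_bundle_def)

lemma Units_carrier: "u \<in> Units R \<Longrightarrow> u \<in> carrier R"
  by (simp add: Units_def)

lemma sections_carrier: "s \<in> sections X L k \<Longrightarrow> i \<in> idx L \<Longrightarrow> s i \<in> carrier (sec X (bdom L i))"
  by (simp add: sections_def)

lemma line_bundle_pull:
  assumes Y: "ringed_space Y" "line_bundle Y M" and f: "morphism X Y f"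
  shows "line_bundle X (pull_bundle X f M)"
  unfolding line_bundle_def
proof (intro conjI ballI)
  note op = line_bundle_open[OF Y(2)]
  show "openin (topo X) (bdom (pull_bundle X f M) i)" if "i \<in> idx (pull_bundle X f M)" for i
    using that openin_pre[OF f op] by (simp add: pull_bundle_def)
  show "(\<Union>i\<in>idx (pull_bundle X f M). bdom (pull_bundle X f M) i) = pts X"
    using line_bundle_cover[OF Y(2)] morphism_pts[OF f] by (auto simp: pull_bundle_def pre_def)
  fix i j assume "i \<in> idx (pull_bundle X f M)" "j \<in> idx (pull_bundle X f M)"
  then have ij: "i \<in> idx M" "j \<in> idx M" by (simp_all add: pull_bundle_def)
  show "btrans (pull_bundle X f M) i j \<in> Units (sec X (bdom (pull_bundle X f M) i \<inter> bdom (pull_bundle X f M) j))"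
    using ring_hom_Units[OF morphism_hom[OF f] line_bundle_trans[OF Y(2) ij]] op ij
    by (simp add: pull_bundle_def pre_Int openin_Int)
  fix l assume "l \<in> idx (pull_bundle X f M)"
  then have l: "l \<in> idx M" by (simp add: pull_bundle_def)
  define W where "W = bdom M i \<inter> bdom M j \<inter> bdom M l"
  have W: "openin (topo Y) W"
    using op ij l by (simp add: W_def openin_Int)
  \<comment> \<open>The transition functions are restricted to the triple overlap first: there the
    cocycle identity holds, and \<open>mfn f W\<close> carries it to the pulled back bundle.\<close>
  define g where "g a b = res Y (bdom M a \<inter> bdom M b) W (btrans M a b)" for a b
  have g: "g a b \<in> carrier (sec Y W)"
    "res X (pre X f (bdom M a \<inter> bdom M b)) (pre X f W) (mfn f (bdom M a \<inter> bdom M b) (btrans M a b)) = mfn f W (g a b)"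
    if "a \<in> idx M" "b \<in> idx M" "W \<subseteq> bdom M a \<inter> bdom M b" for a b
  proof -
    have ab: "openin (topo Y) (bdom M a \<inter> bdom M b)"
      using that op by (simp add: openin_Int)
    note c = Units_carrier[OF line_bundle_trans[OF Y(2) that(1,2)]]
    show "g a b \<in> carrier (sec Y W)"
      unfolding g_def by (rule ring_hom_closed[OF ringed_space_res[OF Y(1) ab W that(3)] c])
    show "res X (pre X f (bdom M a \<inter> bdom M b)) (pre X f W) (mfn f (bdom M a \<inter> bdom M b) (btrans M a b)) = mfn f W (g a b)"
      unfolding g_def by (rule morphism_res[OF f ab W that(3) c, symmetric])
  qed
  have "g i j \<otimes>\<^bsub>sec Y W\<^esub> g j l = g i l"
    using Y(2) ij l unfolding line_bundle_def W_def Let_def g_def by simp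
  then have mult: "mfn f W (g i j) \<otimes>\<^bsub>sec X (pre X f W)\<^esub> mfn f W (g j l) = mfn f W (g i l)"
    using ring_hom_mult[OF morphism_hom[OF f W], of "g i j" "g j l"] g(1) ij l by (simp add: W_def le_infI1)
  show "let W = bdom (pull_bundle X f M) i \<inter> bdom (pull_bundle X f M) j \<inter> bdom (pull_bundle X f M) l in
      res X (bdom (pull_bundle X f M) i \<inter> bdom (pull_bundle X f M) j) W (btrans (pull_bundle X f M) i j) \<otimes>\<^bsub>sec X W\<^esub>
        res X (bdom (pull_bundle X f M) j \<inter> bdom (pull_bundle X f M) l) W (btrans (pull_bundle X f M) j l)
      = res X (bdom (pull_bundle X f M) i \<inter> bdom (pull_bundle X f M) l) W (btrans (pull_bundle X f M) i l)"
    using mult g(2)[of i j] g(2)[of j l] g(2)[of i l] ij l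
    by (simp add: Let_def pull_bundle_def W_def pre_Int le_infI1 le_infI2)
qed

text \<open>Powers of the local functions transform with the powers of the transition functions.
  Hence the power of an extended basis section can be expanded in the basis for exponent
  \<open>k\<close>.\<close>

lemma sections_power:
  assumes X: "ringed_space X" and L: "line_bundle X L" and s: "s \<in> sections X L 1"
  shows "(\<lambda>i\<in>idx L. s i [^]\<^bsub>sec X (bdom L i)\<^esub> k) \<in> sections X L k"
proof -
  note op = line_bundle_open[OF L] and cr = ringed_space_cring[OF X]
  have "res X (bdom L i) (bdom L i \<inter> bdom L j) (s i [^]\<^bsub>sec X (bdom L i)\<^esub> k)
      = (btrans L i j [^]\<^bsub>sec X (bdom L i \<inter> bdom L j)\<^esub> k) \<otimes>\<^bsub>sec X (bdom L i \<inter> bdom L j)\<^esub>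
        res X (bdom L j) (bdom L i \<inter> bdom L j) (s j [^]\<^bsub>sec X (bdom L j)\<^esub> k)"
    if ij: "i \<in> idx L" "j \<in> idx L" for i j
  proof -
    define W where "W = bdom L i \<inter> bdom L j"
    have W: "openin (topo X) W" using op ij by (simp add: W_def openin_Int)
    interpret cring "sec X W" using cr W .
    have hom: "res X (bdom L l) W \<in> ring_hom (sec X (bdom L l)) (sec X W)" if "l \<in> {i, j}" for l
      using that op ij W by (intro ringed_space_res[OF X]) (auto simp: W_def)
    have p: "res X (bdom L l) W (s l [^]\<^bsub>sec X (bdom L l)\<^esub> k) = res X (bdom L l) W (s l) [^]\<^bsub>sec X W\<^esub> k"
      if "l \<in> {i, j}" for l
      using that op ij W sections_carrier[OF s] hom by (intro ring_hom_nat_pow) (auto intro: cr)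
    have g: "btrans L i j \<in> carrier (sec X W)"
      using Units_carrier[OF line_bundle_trans[OF L ij]] by (simp add: W_def)
    have sj: "res X (bdom L j) W (s j) \<in> carrier (sec X W)"
      using hom sections_carrier[OF s ij(2)] by (blast intro: ring_hom_closed)
    have "res X (bdom L i) W (s i) = btrans L i j \<otimes>\<^bsub>sec X W\<^esub> res X (bdom L j) W (s j)"
      using s ij nat_pow_eone[OF g] by (simp add: sections_def Let_def W_def del: nat_pow_Suc One_nat_def)
    then show ?thesis
      using p g sj by (simp add: nat_pow_distrib flip: W_def)
  qed
  moreover have "s i [^]\<^bsub>sec X (bdom L i)\<^esub> k \<in> carrier (sec X (bdom L i))" if "i \<in> idx L" for i
  proof -
    interpret cring "sec X (bdom L i)" using cr op that .
    show ?thesis using sections_carrier[OF s that] by simp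
  qed
  ultimately show ?thesis
    by (simp add: sections_def Let_def)
qed

section \<open>Values of sections, of bundle maps and of basis expansions at a point\<close>

lemma eval_sections:
  assumes Y: "ringed_space Y" and ev: "evaluation Y y e" and M: "line_bundle Y M" and t: "t \<in> sections Y M k"
    and ab: "a \<in> idx M" "b \<in> idx M" "y \<in> bdom M a" "y \<in> bdom M b"
  shows "e (bdom M a) (t a) = e (bdom M a \<inter> bdom M b) (btrans M a b) ^ k * e (bdom M b) (t b)"
proof -
  define W where "W = bdom M a \<inter> bdom M b"
  have op: "openin (topo Y) (bdom M a)" "openin (topo Y) (bdom M b)" "openin (topo Y) W" and W: "y \<in> W"
    using ab line_bundle_open[OF M] by (auto simp: W_def openin_Int)
  interpret cring "sec Y W" using ringed_space_cring[OF Y op(3)] .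
  have g: "btrans M a b \<in> carrier (sec Y W)"
    using Units_carrier[OF line_bundle_trans[OF M ab(1,2)]] by (simp add: W_def)
  have tb: "res Y (bdom M b) W (t b) \<in> carrier (sec Y W)"
    using ringed_space_res[OF Y op(2,3)] sections_carrier[OF t ab(2)] by (auto simp: W_def intro: ring_hom_closed)
  have "res Y (bdom M a) W (t a) = (btrans M a b [^]\<^bsub>sec Y W\<^esub> k) \<otimes>\<^bsub>sec Y W\<^esub> res Y (bdom M b) W (t b)"
    using t ab by (simp add: sections_def Let_def W_def)
  then have "e W (res Y (bdom M a) W (t a)) = e W (btrans M a b) ^ k * e W (res Y (bdom M b) W (t b))"
    using g tb by (simp add: eval_mult[OF ev op(3) W] eval_pow[OF ev Y op(3) W])
  then show ?thesis
    using eval_res[OF ev op(1,3) W _ sections_carrier[OF t ab(1)]]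
      eval_res[OF ev op(2,3) W _ sections_carrier[OF t ab(2)]] by (simp add: W_def)
qed

lemma eval_bundle_pull:
  assumes X: "ringed_space X" and ev: "evaluation X x e" and f: "morphism X Y f"
    and op: "openin (topo X) (bdom L i)" "openin (topo Y) (bdom M a)"
    and \<theta>: "\<theta> a i \<in> carrier (sec X (bdom L i \<inter> pre X f (bdom M a)))"
    and "bundle_pull X L M f \<theta> k s t"
    and s: "s i \<in> carrier (sec X (bdom L i))" and t: "t a \<in> carrier (sec Y (bdom M a))"
    and ia: "i \<in> idx L" "a \<in> idx M" "x \<in> bdom L i" "mpt f x \<in> bdom M a"
  shows "pull_eval X f e (bdom M a) (t a)
    = e (bdom L i \<inter> pre X f (bdom M a)) (\<theta> a i) ^ k * e (bdom L i) (s i)"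
proof -
  define V where "V = pre X f (bdom M a)"
  define W where "W = bdom L i \<inter> V"
  have "x \<in> pts X" using ev by (simp add: evaluation_def)
  then have op': "openin (topo X) V" "openin (topo X) W" and W: "x \<in> V" "x \<in> W"
    using ia op openin_pre[OF f] by (auto simp: W_def V_def openin_Int pre_def)
  interpret cring "sec X W" using ringed_space_cring[OF X op'(2)] .
  have ta: "mfn f (bdom M a) (t a) \<in> carrier (sec X V)"
    using ring_hom_closed[OF morphism_hom[OF f op(2)] t] by (simp add: V_def)
  have \<theta>': "\<theta> a i \<in> carrier (sec X W)"
    using \<theta> by (simp add: W_def V_def)
  have si: "res X (bdom L i) W (s i) \<in> carrier (sec X W)"
    using ringed_space_res[OF X op(1) op'(2)] s by (auto simp: W_def intro: ring_hom_closed)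
  have "res X V W (mfn f (bdom M a) (t a)) = (\<theta> a i [^]\<^bsub>sec X W\<^esub> k) \<otimes>\<^bsub>sec X W\<^esub> res X (bdom L i) W (s i)"
    using assms(7) ia by (simp add: bundle_pull_def Let_def W_def V_def)
  then have "e W (res X V W (mfn f (bdom M a) (t a))) = e W (\<theta> a i) ^ k * e W (res X (bdom L i) W (s i))"
    using \<theta>' si by (simp add: eval_mult[OF ev op'(2) W(2)] eval_pow[OF ev X op'(2) W(2)])
  then show ?thesis
    using eval_res[OF ev op' W(2) _ ta] eval_res[OF ev op(1) op'(2) W(2) _ s]
    by (simp add: pull_eval_def W_def V_def)
qed

lemma eval_scale_section:
  assumes X: "ringed_space X" and ev: "evaluation X x e"
    and op: "openin (topo X) (bdom L i)" and i: "i \<in> idx L" "x \<in> bdom L i"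
    and c: "c \<in> carrier (sec X (pts X))" and s: "s i \<in> carrier (sec X (bdom L i))"
  shows "scale_section X L c s i \<in> carrier (sec X (bdom L i))"
    and "e (bdom L i) (scale_section X L c s i) = e (pts X) c * e (bdom L i) (s i)"
proof -
  have sub: "bdom L i \<subseteq> pts X" using op by (rule openin_subset)
  interpret cring "sec X (bdom L i)" using ringed_space_cring[OF X op] .
  have c': "res X (pts X) (bdom L i) c \<in> carrier (sec X (bdom L i))"
    using ringed_space_res[OF X _ op sub] c by (auto intro: ring_hom_closed)
  then show "scale_section X L c s i \<in> carrier (sec X (bdom L i))"
    using i s by (simp add: scale_section_def)
  show "e (bdom L i) (scale_section X L c s i) = e (pts X) c * e (bdom L i) (s i)"
    using i s c' eval_res[OF ev _ op i(2) sub c] by (simp add: scale_section_def eval_mult[OF ev op i(2)])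
qed

text \<open>The coefficients are quantified before the point and the evaluation: one choice serves
  all points. The comparison of different points of an orbit depends on this.\<close>

lemma eval_section_basis:
  assumes X: "ringed_space X" and L: "line_bundle X L"
    and basis: "section_basis X L sc k N s" and t: "t \<in> sections X L k"
    and sc: "\<And>c. sc c \<in> carrier (sec X (pts X))"
  shows "\<exists>a. \<forall>x e. \<forall>i\<in>idx L. evaluation X x e \<longrightarrow> x \<in> bdom L i \<longrightarrow>
    e (bdom L i) (t i) = (\<Sum>\<alpha>\<le>N. e (pts X) (sc (a \<alpha>)) * e (bdom L i) (s \<alpha> i))"
proof -
  have s: "s \<alpha> \<in> sections X L k" if "\<alpha> \<le> N" for \<alpha>
    using basis that by (simp add: section_basis_def)
  obtain a where a: "\<forall>i\<in>idx L. t i = finsum (sec X (bdom L i)) (\<lambda>\<alpha>. scale_section X L (sc (a \<alpha>)) (s \<alpha>) i) {..N}"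
    using basis t unfolding section_basis_def by blast
  have "e (bdom L i) (t i) = (\<Sum>\<alpha>\<le>N. e (pts X) (sc (a \<alpha>)) * e (bdom L i) (s \<alpha> i))"
    if i: "i \<in> idx L" "x \<in> bdom L i" and ev: "evaluation X x e" for i x e
  proof -
    note op = line_bundle_open[OF L i(1)]
    have "scale_section X L (sc (a \<alpha>)) (s \<alpha>) i \<in> carrier (sec X (bdom L i)) \<and>
        e (bdom L i) (scale_section X L (sc (a \<alpha>)) (s \<alpha>) i) = e (pts X) (sc (a \<alpha>)) * e (bdom L i) (s \<alpha> i)"
      if "\<alpha> \<le> N" for \<alpha>
      using eval_scale_section[OF X ev op i sc, of "s \<alpha>" "a \<alpha>"] sections_carrier[OF s[OF that] i(1)] by blast
    then show ?thesis
      using i a by (simp add: eval_finsum[OF ev X op i(2)])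
  qed
  then show ?thesis by blast
qed

text \<open>\<open>germ_op\<close> multiplies arbitrarily chosen representatives, so one needs that the value depends only on
  the germ.\<close>

lemma eval_unit_at:
  assumes X: "ringed_space X" and ev: "evaluation X x e" and U: "openin (topo X) U" "x \<in> U"
    and f: "f \<in> carrier (sec X U)" and unit: "unit_at X x U f"
  shows "e U f \<noteq> 0"
proof -
  have germ_eval: "e V g = e U f" if "(V, g) \<in> germ X x U f" "openin (topo X) U" "x \<in> U" "f \<in> carrier (sec X U)"
    for V g U f
  proof -
    obtain W where W: "openin (topo X) W" "x \<in> W" "W \<subseteq> U \<inter> V" "res X U W f = res X V W g"
      and V: "openin (topo X) V" "x \<in> V" "g \<in> carrier (sec X V)"
      using \<open>(V, g) \<in> germ X x U f\<close> by (auto simp: germ_def)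
    then show ?thesis
      using eval_res[OF ev, of U W f] eval_res[OF ev, of V W g] that by auto
  qed
  have germ_self: "(V, g) \<in> germ X x V g" if "openin (topo X) V" "x \<in> V" "g \<in> carrier (sec X V)" for V g
    using that by (auto simp: germ_def)
  have some: "\<exists>V' g'. (SOME r. r \<in> germ X x V g) = (V', g') \<and> openin (topo X) V' \<and> x \<in> V' \<and>
      g' \<in> carrier (sec X V') \<and> e V' g' = e V g"
    if "openin (topo X) V" "x \<in> V" "g \<in> carrier (sec X V)" for V g
  proof -
    have *: "(SOME r. r \<in> germ X x V g) \<in> germ X x V g"
      by (rule someI[of _ "(V, g)"]) (use germ_self that in auto)
    obtain V' g' where "(SOME r. r \<in> germ X x V g) = (V', g')" by fastforce
    with * germ_eval[of V' g' V g] that show ?thesis by (auto simp: germ_def)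
  qed
  obtain B where B: "B \<in> carrier (stalk X x)" "germ X x U f \<otimes>\<^bsub>stalk X x\<^esub> B = \<one>\<^bsub>stalk X x\<^esub>"
    using unit by (auto simp: unit_at_def Units_def)
  then obtain V g where V: "B = germ X x V g" "openin (topo X) V" "x \<in> V" "g \<in> carrier (sec X V)"
    by (auto simp: stalk_def)
  obtain U' f' where U': "(SOME r. r \<in> germ X x U f) = (U', f')" "openin (topo X) U'" "x \<in> U'"
      "f' \<in> carrier (sec X U')" "e U' f' = e U f"
    using some[OF U f] by blast
  obtain V' g' where V': "(SOME r. r \<in> germ X x V g) = (V', g')" "openin (topo X) V'" "x \<in> V'"
      "g' \<in> carrier (sec X V')" "e V' g' = e V g"
    using some[OF V(2-4)] by blast
  define W where "W = U' \<inter> V'"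
  have W: "openin (topo X) W" "x \<in> W" "W \<subseteq> U'" "W \<subseteq> V'"
    using U' V' by (auto simp: W_def openin_Int)
  interpret cring "sec X W" using ringed_space_cring[OF X W(1)] .
  define p where "p = res X U' W f' \<otimes>\<^bsub>sec X W\<^esub> res X V' W g'"
  have c: "res X U' W f' \<in> carrier (sec X W)" "res X V' W g' \<in> carrier (sec X W)"
    using ringed_space_res[OF X U'(2) W(1,3)] ringed_space_res[OF X V'(2) W(1,4)] U' V'
    by (auto intro: ring_hom_closed)
  \<comment> \<open>The product \<open>p\<close> of the chosen representatives has the germ of the
    constant 1, so its value is 1 and both factors have nonzero values.\<close>
  have "germ X x W p = germ X x (pts X) \<one>\<^bsub>sec X (pts X)\<^esub>"
    using B(2) unfolding V(1) by (simp add: stalk_def germ_op_def U' V' Let_def W_def p_def)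
  then have "(W, p) \<in> germ X x (pts X) \<one>\<^bsub>sec X (pts X)\<^esub>"
    using germ_self[OF W(1,2), of p] c by (simp add: p_def)
  moreover have x: "x \<in> pts X" using ev by (simp add: evaluation_def)
  moreover have "cring (sec X (pts X))" by (rule ringed_space_cring[OF X]) simp
  ultimately have "e W p = e (pts X) \<one>\<^bsub>sec X (pts X)\<^esub>"
    by (intro germ_eval) (auto simp: cring_def ring_def monoid.one_closed)
  also have "\<dots> = 1"
    using ring_hom_one[OF eval_hom[OF ev _ x]] by simp
  finally have "e U f * e V g = 1"
    using c eval_res[OF ev U'(2) W(1,2,3) U'(4)] eval_res[OF ev V'(2) W(1,2,4) V'(4)] U'(5) V'(5)
    by (simp add: p_def eval_mult[OF ev W(1,2)])
  then show ?thesis by auto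
qed

section \<open>Holomorphic functions on a manifold\<close>

lemma hol_space_simps [simp]:
  "topo (hol_space A) = euclidean" "res (hol_space A) U V f = restrict f V"
  "carrier (sec (hol_space A) W) = {f \<in> extensional W. holomorphic_fn A W f}"
  "f \<otimes>\<^bsub>sec (hol_space A) W\<^esub> g = (\<lambda>x\<in>W. f x * g x)"
  "f \<oplus>\<^bsub>sec (hol_space A) W\<^esub> g = (\<lambda>x\<in>W. f x + g x)"
  "\<one>\<^bsub>sec (hol_space A) W\<^esub> = (\<lambda>x\<in>W. 1)" "\<zero>\<^bsub>sec (hol_space A) W\<^esub> = (\<lambda>x\<in>W. 0)"
  by (simp_all add: hol_space_def)

lemma holomorphic_fnE:
  assumes "holomorphic_fn A W f" "(U, z) \<in> A" "p \<in> z ` (U \<inter> W)"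
  obtains D where "(f \<circ> the_inv_into U z has_derivative D) (at p)" "\<And>c v. D (c *s v) = c * D v"
  using assms unfolding holomorphic_fn_def holomorphic_map_def by blast

lemma holomorphic_fnI:
  assumes "\<And>U z p. (U, z) \<in> A \<Longrightarrow> p \<in> z ` (U \<inter> W) \<Longrightarrow>
    \<exists>D. (f \<circ> the_inv_into U z has_derivative D) (at p) \<and> (\<forall>c v. D (c *s v) = c * D v)"
  shows "holomorphic_fn A W f"
  using assms unfolding holomorphic_fn_def holomorphic_map_def by blast

lemma holomorphic_fn_subset: "holomorphic_fn A W f \<Longrightarrow> V \<subseteq> W \<Longrightarrow> holomorphic_fn A V f"
  unfolding holomorphic_fn_def holomorphic_map_def by blast

lemma holomorphic_fn_const: "holomorphic_fn A W (\<lambda>x. c)"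
proof (rule holomorphic_fnI)
  fix U and z :: "'x \<Rightarrow> complex^'n" and p
  show "\<exists>D. ((\<lambda>x. c) \<circ> the_inv_into U z has_derivative D) (at p) \<and> (\<forall>c v. D (c *s v) = c * D v)"
    by (intro exI[of _ "\<lambda>_. 0"]) (simp add: comp_def)
qed

lemma holomorphic_fn_add:
  assumes "holomorphic_fn A W f" "holomorphic_fn A W g"
  shows "holomorphic_fn A W (\<lambda>x. f x + g x)"
proof (rule holomorphic_fnI)
  fix U z p assume *: "(U, z) \<in> A" "p \<in> z ` (U \<inter> W)"
  obtain D where D: "(f \<circ> the_inv_into U z has_derivative D) (at p)" "\<And>c v. D (c *s v) = c * D v"
    using holomorphic_fnE[OF assms(1) *] by blast
  obtain E where E: "(g \<circ> the_inv_into U z has_derivative E) (at p)" "\<And>c v. E (c *s v) = c * E v"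
    using holomorphic_fnE[OF assms(2) *] by blast
  show "\<exists>D. ((\<lambda>x. f x + g x) \<circ> the_inv_into U z has_derivative D) (at p) \<and> (\<forall>c v. D (c *s v) = c * D v)"
    using has_derivative_add[OF D(1) E(1)] D(2) E(2)
    by (intro exI[of _ "\<lambda>v. D v + E v"]) (simp add: comp_def algebra_simps)
qed

lemma holomorphic_fn_mult:
  assumes "holomorphic_fn A W f" "holomorphic_fn A W g"
  shows "holomorphic_fn A W (\<lambda>x. f x * g x)"
proof (rule holomorphic_fnI)
  fix U z p assume *: "(U, z) \<in> A" "p \<in> z ` (U \<inter> W)"
  obtain D where D: "(f \<circ> the_inv_into U z has_derivative D) (at p)" "\<And>c v. D (c *s v) = c * D v"
    using holomorphic_fnE[OF assms(1) *] by blast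
  obtain E where E: "(g \<circ> the_inv_into U z has_derivative E) (at p)" "\<And>c v. E (c *s v) = c * E v"
    using holomorphic_fnE[OF assms(2) *] by blast
  show "\<exists>D. ((\<lambda>x. f x * g x) \<circ> the_inv_into U z has_derivative D) (at p) \<and> (\<forall>c v. D (c *s v) = c * D v)"
    using has_derivative_mult[OF D(1) E(1)] D(2) E(2)
    by (intro exI conjI) (auto simp: comp_def algebra_simps)
qed

lemma holomorphic_fn_power: "holomorphic_fn A W f \<Longrightarrow> holomorphic_fn A W (\<lambda>x. f x ^ n)"
  by (induction n) (simp_all add: holomorphic_fn_const holomorphic_fn_mult)

section \<open>Locality and continuity of holomorphic functions, and their sheaf\<close>

context
  fixes A :: "('x::t2_space, 'n::finite) atlas"
  assumes A: "compact_complex_manifold A"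
begin

lemma chart:
  assumes "(U, z) \<in> A"
  shows "open U" "open (z ` U)" "homeomorphism U (z ` U) z (the_inv_into U z)"
  using A assms by (auto simp: compact_complex_manifold_def)

lemma chart_cover: obtains U z where "(U, z) \<in> A" "x \<in> U"
proof -
  have "x \<in> (\<Union>(U, z)\<in>A. U)"
    using A by (simp add: compact_complex_manifold_def)
  then show ?thesis using that by blast
qed

lemma open_chart_image:
  assumes "(U, z) \<in> A" "open V"
  shows "open (z ` (U \<inter> V))"
proof -
  have "openin (top_of_set (z ` U)) (z ` (U \<inter> V))"
    using homeomorphism_imp_open_map[OF chart(3)[OF assms(1)]] assms(2) by (simp add: openin_open_Int)
  then show ?thesis
    using chart(2)[OF assms(1)] openin_open_trans by blast
qed

text \<open>A derivative at a point sees only a neighbourhood of it, and charts map open sets to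
  open sets. This yields the gluing axiom, and it allows \<open>restrict\<close> to alter a function
  outside an open set.\<close>

lemma holomorphic_fn_local:
  assumes "\<And>x. x \<in> W \<Longrightarrow> \<exists>V g. open V \<and> x \<in> V \<and> holomorphic_fn A V g \<and> (\<forall>y\<in>V. f y = g y)"
  shows "holomorphic_fn A W f"
proof (rule holomorphic_fnI)
  fix U z p assume c: "(U, z) \<in> A" and "p \<in> z ` (U \<inter> W)"
  then obtain x where x: "x \<in> U" "x \<in> W" "p = z x" by blast
  obtain V g where V: "open V" "x \<in> V" "holomorphic_fn A V g" "\<forall>y\<in>V. f y = g y"
    using assms x by blast
  obtain D where D: "(g \<circ> the_inv_into U z has_derivative D) (at p)" "\<And>c v. D (c *s v) = c * D v"
    using holomorphic_fnE[OF V(3) c, of p] x V(2) by blast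
  have "(g \<circ> the_inv_into U z) q = (f \<circ> the_inv_into U z) q" if "q \<in> z ` (U \<inter> V)" for q
    using that V(4) homeomorphism_apply1[OF chart(3)[OF c]] by auto
  then have "(f \<circ> the_inv_into U z has_derivative D) (at p)"
    using has_derivative_transform_within_open[OF D(1) open_chart_image[OF c V(1)]] x V(2) by blast
  then show "\<exists>D. (f \<circ> the_inv_into U z has_derivative D) (at p) \<and> (\<forall>c v. D (c *s v) = c * D v)"
    using D(2) by blast
qed

lemma holomorphic_fn_restrict: "open W \<Longrightarrow> holomorphic_fn A W f \<Longrightarrow> holomorphic_fn A W (restrict f W)"
  by (rule holomorphic_fn_local) (metis restrict_apply)

text \<open>On a chart domain \<open>f\<close> is its coordinate expression composed with the chart,
  and the chart domains form an open cover.\<close>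

lemma continuous_on_charts:
  fixes f :: "'x \<Rightarrow> 'b::topological_space"
  assumes W: "open W" and f: "\<And>U z. (U, z) \<in> A \<Longrightarrow> continuous_on (z ` (U \<inter> W)) (f \<circ> the_inv_into U z)"
  shows "continuous_on W f"
proof -
  have "continuous_on (U \<inter> W) f" if c: "(U, z) \<in> A" for U z
  proof -
    have "continuous_on (U \<inter> W) z"
      using homeomorphism_cont1[OF chart(3)[OF c]] by (rule continuous_on_subset) simp
    then have "continuous_on (U \<inter> W) (\<lambda>x. (f \<circ> the_inv_into U z) (z x))"
      using continuous_on_compose2[OF f[OF c]] by blast
    moreover have "(f \<circ> the_inv_into U z) (z x) = f x" if "x \<in> U \<inter> W" for x
      using that homeomorphism_apply1[OF chart(3)[OF c]] by simp
    ultimately show ?thesis by (metis (no_types, lifting) continuous_on_cong)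
  qed
  then have "continuous_on (\<Union>c\<in>A. fst c \<inter> W) f"
    using chart(1) W by (intro continuous_on_open_UN) auto
  moreover have "(\<Union>c\<in>A. fst c \<inter> W) = W"
  proof -
    have "x \<in> (\<Union>c\<in>A. fst c)" for x
      by (rule chart_cover[of x]) (simp, metis fst_conv)
    then show ?thesis by blast
  qed
  ultimately show ?thesis by simp
qed

lemma holomorphic_fn_continuous:
  assumes "open W" "holomorphic_fn A W f"
  shows "continuous_on W f"
proof (rule continuous_on_charts[OF assms(1)])
  fix U z assume "(U, z) \<in> A"
  then show "continuous_on (z ` (U \<inter> W)) (f \<circ> the_inv_into U z)"
    using holomorphic_fnE[OF assms(2)]
    by (metis continuous_at_imp_continuous_on has_derivative_continuous)
qed

lemma cring_hol_sec:
  assumes W: "open W"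
  shows "cring (sec (hol_space A) W)"
proof (intro cringI abelian_groupI comm_monoidI)
  fix f assume f: "f \<in> carrier (sec (hol_space A) W)"
  then have "holomorphic_fn A W (\<lambda>x\<in>W. - 1 * f x)"
    by (intro holomorphic_fn_restrict holomorphic_fn_mult holomorphic_fn_const W) simp
  then show "\<exists>g\<in>carrier (sec (hol_space A) W). g \<oplus>\<^bsub>sec (hol_space A) W\<^esub> f = \<zero>\<^bsub>sec (hol_space A) W\<^esub>"
    by (intro bexI[of _ "\<lambda>x\<in>W. - 1 * f x"]) auto
qed (auto simp: W extensional_def algebra_simps
  intro!: holomorphic_fn_restrict holomorphic_fn_add holomorphic_fn_mult holomorphic_fn_const)

lemma ringed_space_hol: "ringed_space (hol_space A)"
  unfolding ringed_space_def
proof (intro conjI allI impI)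
  show "cring (sec (hol_space A) U)" if "openin (topo (hol_space A)) U" for U
    using that by (simp add: cring_hol_sec)
  show "res (hol_space A) U V \<in> ring_hom (sec (hol_space A) U) (sec (hol_space A) V)"
    if "openin (topo (hol_space A)) U" "openin (topo (hol_space A)) V" "V \<subseteq> U" for U V
    using that by (auto intro!: ring_hom_memI holomorphic_fn_restrict elim!: holomorphic_fn_subset simp: fun_eq_iff)
  show "res (hol_space A) U U f = f" if "f \<in> carrier (sec (hol_space A) U)" for U f
    using that by (simp add: extensional_restrict)
  show "res (hol_space A) V W (res (hol_space A) U V f) = res (hol_space A) U W f"
    if "W \<subseteq> V" for U V W f
    using that by (auto simp: fun_eq_iff)
  fix \<U> s
  assume "\<forall>U\<in>\<U>. openin (topo (hol_space A)) U \<and> s U \<in> carrier (sec (hol_space A) U)"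
    and "\<forall>U\<in>\<U>. \<forall>V\<in>\<U>. res (hol_space A) U (U \<inter> V) (s U) = res (hol_space A) V (U \<inter> V) (s V)"
  then have U: "\<And>U. U \<in> \<U> \<Longrightarrow> open U" "\<And>U. U \<in> \<U> \<Longrightarrow> s U \<in> extensional U"
      "\<And>U. U \<in> \<U> \<Longrightarrow> holomorphic_fn A U (s U)"
    and eq: "\<And>U V. U \<in> \<U> \<Longrightarrow> V \<in> \<U> \<Longrightarrow> restrict (s U) (U \<inter> V) = restrict (s V) (U \<inter> V)"
    by auto
  \<comment> \<open>The glued function takes at \<open>x\<close> the value given by some member of
    the cover containing \<open>x\<close>; agreement on overlaps makes the choice
    irrelevant.\<close>
  define t where "t = (\<lambda>x\<in>\<Union>\<U>. s (SOME U. U \<in> \<U> \<and> x \<in> U) x)"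
  have t: "t x = s U x" if "U \<in> \<U>" "x \<in> U" for U x
  proof -
    define V where "V = (SOME U. U \<in> \<U> \<and> x \<in> U)"
    have V: "V \<in> \<U> \<and> x \<in> V"
      unfolding V_def by (rule someI[of _ U]) (use that in simp)
    then have "restrict (s V) (V \<inter> U) x = restrict (s U) (V \<inter> U) x"
      using eq that by metis
    then show ?thesis
      using that V by (auto simp: t_def V_def)
  qed
  show "\<exists>!t. t \<in> carrier (sec (hol_space A) (\<Union>\<U>)) \<and> (\<forall>U\<in>\<U>. res (hol_space A) (\<Union>\<U>) U t = s U)"
  proof (rule ex1I[of _ t])
    have "holomorphic_fn A (\<Union>\<U>) t"
      by (rule holomorphic_fn_local) (metis U(1,3) t UnionE)
    moreover have "restrict t U = s U" if "U \<in> \<U>" for U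
      using U(2)[OF that] t[OF that] by (auto simp: fun_eq_iff extensional_def)
    ultimately show "t \<in> carrier (sec (hol_space A) (\<Union>\<U>)) \<and> (\<forall>U\<in>\<U>. res (hol_space A) (\<Union>\<U>) U t = s U)"
      by (simp add: t_def)
    fix t' assume t': "t' \<in> carrier (sec (hol_space A) (\<Union>\<U>)) \<and> (\<forall>U\<in>\<U>. res (hol_space A) (\<Union>\<U>) U t' = s U)"
    show "t' = t"
    proof
      fix x
      show "t' x = t x"
      proof (cases "x \<in> \<Union>\<U>")
        case True
        then obtain U where "U \<in> \<U>" "x \<in> U" by blast
        then show ?thesis using t t' by (metis hol_space_simps(2) restrict_apply')
      next
        case False
        then show ?thesis using t' by (simp add: t_def extensional_def)
      qed
    qed
  qed
qed

section \<open>Holomorphic line bundles and pullback of sections to the manifold\<close>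

lemma evaluation_hol: "evaluation (hol_space A) x (\<lambda>U f. f x)"
  unfolding evaluation_def by (auto intro!: ring_hom_memI)

text \<open>The cocycle identity with three equal indices makes the value idempotent, and it is
  nonzero as the value of a unit.\<close>

lemma line_bundle_trans_self:
  assumes L: "line_bundle (hol_space A) L" and i: "i \<in> idx L" "x \<in> bdom L i"
  shows "btrans L i i x = 1"
proof -
  have "restrict (btrans L i i) (bdom L i) \<otimes>\<^bsub>sec (hol_space A) (bdom L i)\<^esub> restrict (btrans L i i) (bdom L i)
      = restrict (btrans L i i) (bdom L i)"
    using L i(1) unfolding line_bundle_def Let_def hol_space_simps(2) by (metis Int_absorb)
  then have "btrans L i i x * btrans L i i x = btrans L i i x"
    using i by (auto dest: fun_cong[of _ _ x])
  moreover have "btrans L i i x \<noteq> 0"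
    using eval_unit[OF evaluation_hol _ _ line_bundle_trans[OF L i(1,1)]] line_bundle_open[OF L i(1)] i by simp
  ultimately show ?thesis by simp
qed

text \<open>The pullback is \<open>u\<close> composed with \<open>f\<close>, divided by the
  \<open>m\<close>-th power of the fibre coordinate factor \<open>\<theta>\<close>. It turns
  algebraic sections over the fibre at 1 into holomorphic sections of \<open>L\<close>.\<close>

lemma bundle_map_pull_section:
  assumes L: "line_bundle (hol_space A) L" and Y: "ringed_space Y" and M: "line_bundle Y M"
    and bm: "bundle_map (hol_space A) L Y M f \<theta>" and u: "u \<in> sections Y M m"
  shows "\<exists>t\<in>sections (hol_space A) L m. \<forall>x. \<forall>i\<in>idx L. \<forall>a\<in>idx M. x \<in> bdom L i \<longrightarrow> mpt f x \<in> bdom M a \<longrightarrow>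
    mfn f (bdom M a) (u a) x = \<theta> a i x ^ m * t i x"
proof -
  let ?X = "hol_space A"
  have f: "morphism ?X Y f" using bm by (simp add: bundle_map_def)
  have unit: "\<theta> a i \<in> Units (sec ?X (bdom L i \<inter> pre ?X f (bdom M a)))" if "i \<in> idx L" "a \<in> idx M" for i a
    using bm that by (simp add: bundle_map_def)
  have opL: "open (bdom L i)" if "i \<in> idx L" for i
    using line_bundle_open[OF L that] by simp
  have opM: "openin (topo Y) (bdom M a)" "open (pre ?X f (bdom M a))" if "a \<in> idx M" for a
    using line_bundle_open[OF M that] openin_pre[OF f line_bundle_open[OF M that]] by simp_all
  have nz: "\<theta> a i x \<noteq> 0" if "i \<in> idx L" "a \<in> idx M" "x \<in> bdom L i" "mpt f x \<in> bdom M a" for a i x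
    using eval_unit[OF evaluation_hol _ _ unit[OF that(1,2)], of x] that opL opM by (auto simp: pre_def open_Int)
  \<comment> \<open>The candidate in the trivializations \<open>a\<close> of \<open>M\<close> and
    \<open>i\<close> of \<open>L\<close>. Compatibility of \<open>\<theta>\<close> with both
    families of transition functions gives its transformation rule.\<close>
  define v where "v a i x = mfn f (bdom M a) (u a) x / \<theta> a i x ^ m" for a i x
  have v: "v a i x = btrans L i j x ^ m * v b j x"
    if ij: "i \<in> idx L" "j \<in> idx L" and ab: "a \<in> idx M" "b \<in> idx M"
      and x: "x \<in> bdom L i" "x \<in> bdom L j" "mpt f x \<in> bdom M a" "mpt f x \<in> bdom M b" for a b i j x
  proof -
    define G where "G = mfn f (bdom M a \<inter> bdom M b) (btrans M a b) x"
    have "mfn f (bdom M a) (u a) x = G ^ m * mfn f (bdom M b) (u b) x"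
      using eval_sections[OF Y evaluation_pull[OF f evaluation_hol] M u ab x(3,4)]
      by (simp add: pull_eval_def G_def)
    moreover have "\<theta> a i x * btrans L i j x = G * \<theta> b j x"
    proof -
      define W where "W = bdom L i \<inter> bdom L j \<inter> pre ?X f (bdom M a) \<inter> pre ?X f (bdom M b)"
      have "res ?X (bdom L i \<inter> pre ?X f (bdom M a)) W (\<theta> a i) \<otimes>\<^bsub>sec ?X W\<^esub> res ?X (bdom L i \<inter> bdom L j) W (btrans L i j)
        = res ?X (pre ?X f (bdom M a \<inter> bdom M b)) W (mfn f (bdom M a \<inter> bdom M b) (btrans M a b))
            \<otimes>\<^bsub>sec ?X W\<^esub> res ?X (bdom L j \<inter> pre ?X f (bdom M b)) W (\<theta> b j)"
        using bm ij ab unfolding bundle_map_def Let_def W_def by blast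
      moreover have "x \<in> W" using x by (simp add: W_def pre_def)
      ultimately show ?thesis by (auto simp: G_def dest: fun_cong[of _ _ x])
    qed
    ultimately show ?thesis
      using nz[OF ij(1) ab(1) x(1,3)] nz[OF ij(2) ab(2) x(2,4)]
      by (simp add: v_def field_simps flip: power_mult_distrib)
  qed
  define c where "c x = (SOME a. a \<in> idx M \<and> mpt f x \<in> bdom M a)" for x
  have c: "c x \<in> idx M" "mpt f x \<in> bdom M (c x)" for x
  proof -
    have "\<exists>a. a \<in> idx M \<and> mpt f x \<in> bdom M a"
      using line_bundle_cover[OF M morphism_pts[OF f, of x]] by auto
    then show "c x \<in> idx M" "mpt f x \<in> bdom M (c x)"
      unfolding c_def by (metis (mono_tags, lifting) someI_ex)+
  qed
  define t where "t = (\<lambda>i\<in>idx L. \<lambda>x\<in>bdom L i. v (c x) i x)"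
  \<comment> \<open>The transformation rule with \<open>i = j\<close>, where the transition function
    is 1, shows that the trivialization of \<open>M\<close> does not matter.\<close>
  have t: "t i x = v a i x" if "i \<in> idx L" "a \<in> idx M" "x \<in> bdom L i" "mpt f x \<in> bdom M a" for i a x
    using that v[OF that(1,1) c(1) that(2,3,3) c(2) that(4)] line_bundle_trans_self[OF L that(1,3)]
    by (simp add: t_def)
  have "holomorphic_fn A (bdom L i) (t i)" if i: "i \<in> idx L" for i
  proof (rule holomorphic_fn_local)
    fix x assume x: "x \<in> bdom L i"
    define V where "V = bdom L i \<inter> pre ?X f (bdom M (c x))"
    \<comment> \<open>The inverse of \<open>\<theta>\<close> in the ring of functions on
      \<open>V\<close> is itself holomorphic, so dividing by \<open>\<theta>\<close> becomes
      multiplying by a holomorphic function.\<close>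
    obtain g where g: "g \<in> carrier (sec ?X V)" "\<theta> (c x) i \<otimes>\<^bsub>sec ?X V\<^esub> g = \<one>\<^bsub>sec ?X V\<^esub>"
      using unit[OF i c(1)] by (auto simp: Units_def V_def)
    have "v (c x) i y = mfn f (bdom M (c x)) (u (c x)) y * g y ^ m" if "y \<in> V" for y
    proof -
      have "\<theta> (c x) i y * g y = 1"
        using g(2) that by (auto dest: fun_cong[of _ _ y])
      then have "g y = inverse (\<theta> (c x) i y)"
        by (metis inverse_unique)
      then show ?thesis
        by (simp add: v_def divide_inverse power_inverse)
    qed
    moreover have "t i y = v (c x) i y" if "y \<in> V" for y
      using that t[OF i c(1)] by (simp add: V_def pre_def)
    moreover have "holomorphic_fn A V (\<lambda>y. mfn f (bdom M (c x)) (u (c x)) y * g y ^ m)"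
    proof (intro holomorphic_fn_mult holomorphic_fn_power)
      have "holomorphic_fn A (pre ?X f (bdom M (c x))) (mfn f (bdom M (c x)) (u (c x)))"
        using ring_hom_closed[OF morphism_hom[OF f opM(1)] sections_carrier[OF u]] c by simp
      then show "holomorphic_fn A V (mfn f (bdom M (c x)) (u (c x)))"
        by (rule holomorphic_fn_subset) (simp add: V_def)
    qed (use g in simp)
    moreover have "open V" "x \<in> V"
      using opL[OF i] opM(2)[OF c(1)] x c(2) by (auto simp: V_def pre_def)
    ultimately show "\<exists>V g. open V \<and> x \<in> V \<and> holomorphic_fn A V g \<and> (\<forall>y\<in>V. t i y = g y)"
      by (intro exI[of _ V] exI[of _ "\<lambda>y. mfn f (bdom M (c x)) (u (c x)) y * g y ^ m"]) simp
  qed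
  moreover have "restrict (t i) (bdom L i \<inter> bdom L j)
      = (btrans L i j [^]\<^bsub>sec ?X (bdom L i \<inter> bdom L j)\<^esub> m) \<otimes>\<^bsub>sec ?X (bdom L i \<inter> bdom L j)\<^esub>
        restrict (t j) (bdom L i \<inter> bdom L j)" if ij: "i \<in> idx L" "j \<in> idx L" for i j
  proof -
    have "(btrans L i j [^]\<^bsub>sec ?X (bdom L i \<inter> bdom L j)\<^esub> m) x = btrans L i j x ^ m"
      if "x \<in> bdom L i \<inter> bdom L j" for x
      using eval_pow[OF evaluation_hol ringed_space_hol _ that Units_carrier[OF line_bundle_trans[OF L ij]]]
        opL ij by (simp add: open_Int)
    moreover have "t i x = btrans L i j x ^ m * t j x" if "x \<in> bdom L i \<inter> bdom L j" for x
      using v[OF ij c(1) c(1), of x x x] t[OF ij(1) c(1), of x x] t[OF ij(2) c(1), of x x] that c(2) by simp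
    ultimately show ?thesis by (auto simp: fun_eq_iff)
  qed
  ultimately have "t \<in> sections ?X L m"
    unfolding sections_def by (simp add: Let_def) (simp add: t_def)
  moreover have "mfn f (bdom M a) (u a) x = \<theta> a i x ^ m * t i x"
    if "i \<in> idx L" "a \<in> idx M" "x \<in> bdom L i" "mpt f x \<in> bdom M a" for i a x
    using t[OF that] nz[OF that] by (simp add: v_def)
  ultimately show ?thesis by blast
qed

end

section \<open>Hermitian metrics and integration\<close>

lemma triv_at:
  assumes "line_bundle (hol_space A) L"
  shows "triv_at L x \<in> idx L" "x \<in> bdom L (triv_at L x)"
proof -
  have "\<exists>i. i \<in> idx L \<and> x \<in> bdom L i"
    using line_bundle_cover[OF assms, of x] by auto
  then show "triv_at L x \<in> idx L" "x \<in> bdom L (triv_at L x)"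
    unfolding triv_at_def by (metis (mono_tags, lifting) someI_ex)+
qed

context
  fixes A :: "('x::t2_space, 'n::finite) atlas" and L :: "('j, 'x) hol_bundle"
  assumes A: "compact_complex_manifold A" and L: "line_bundle (hol_space A) L"
begin

lemma open_bdom: "i \<in> idx L \<Longrightarrow> open (bdom L i)"
  using line_bundle_open[OF L] by simp

lemma hol_sections_trans:
  assumes "s \<in> sections (hol_space A) L k" "i \<in> idx L" "j \<in> idx L" "x \<in> bdom L i" "x \<in> bdom L j"
  shows "s i x = btrans L i j x ^ k * s j x"
  using eval_sections[OF ringed_space_hol[OF A] evaluation_hol[OF A] L assms] .

text \<open>Evaluation at each point of the domain turns \<open>finsum\<close> into a sum of
  numbers; elsewhere both sides are \<open>undefined\<close>.\<close>

lemma hol_finsum_scale: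
  fixes N :: nat
  assumes s: "\<And>\<alpha>. \<alpha> \<le> N \<Longrightarrow> s \<alpha> \<in> sections (hol_space A) L k" and i: "i \<in> idx L"
  shows "finsum (sec (hol_space A) (bdom L i)) (\<lambda>\<alpha>. scale_section (hol_space A) L (\<lambda>x. c \<alpha>) (s \<alpha>) i) {..N}
    = (\<lambda>x\<in>bdom L i. \<Sum>\<alpha>\<le>N. c \<alpha> * s \<alpha> i x)" (is "finsum ?R ?f _ = _")
proof -
  note X = ringed_space_hol[OF A]
  have op: "openin (topo (hol_space A)) (bdom L i)" using open_bdom[OF i] by simp
  interpret cring ?R using ringed_space_cring[OF X op] .
  have scal: "?f \<alpha> = (\<lambda>x\<in>bdom L i. c \<alpha> * s \<alpha> i x)" for \<alpha>
    using i by (auto simp: scale_section_def fun_eq_iff)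
  have f: "?f \<in> {..N} \<rightarrow> carrier ?R"
  proof
    fix \<alpha> assume "\<alpha> \<in> {..N}"
    then have "holomorphic_fn A (bdom L i) (s \<alpha> i)"
      using sections_carrier[OF s i] by simp
    then show "?f \<alpha> \<in> carrier ?R"
      unfolding scal
      by (simp add: holomorphic_fn_restrict[OF A open_bdom[OF i]] holomorphic_fn_mult holomorphic_fn_const)
  qed
  have "finsum ?R ?f {..N} x = (\<Sum>\<alpha>\<le>N. c \<alpha> * s \<alpha> i x)" if x: "x \<in> bdom L i" for x
    using eval_finsum[OF evaluation_hol[OF A] X op x finite_atMost f] x by (simp add: scal)
  moreover have "finsum ?R ?f {..N} \<in> extensional (bdom L i)"
    using finsum_closed[OF f] by simp
  ultimately show ?thesis
    by (auto simp: fun_eq_iff extensional_def)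
qed

section \<open>Expansion of holomorphic sections in a basis\<close>

lemma section_basis_expansion:
  assumes basis: "section_basis (hol_space A) L (\<lambda>c x. c) k N s" and t: "t \<in> sections (hol_space A) L k"
  shows "\<exists>a. \<forall>i\<in>idx L. \<forall>x\<in>bdom L i. t i x = (\<Sum>\<alpha>\<le>N. a \<alpha> * s \<alpha> i x)"
proof -
  have s: "\<And>\<alpha>. \<alpha> \<le> N \<Longrightarrow> s \<alpha> \<in> sections (hol_space A) L k"
    using basis by (simp add: section_basis_def)
  obtain a where "\<forall>i\<in>idx L. t i = finsum (sec (hol_space A) (bdom L i))
      (\<lambda>\<alpha>. scale_section (hol_space A) L (\<lambda>x. a \<alpha>) (s \<alpha>) i) {..N}"
    using basis t unfolding section_basis_def by blast
  then have "t i x = (\<Sum>\<alpha>\<le>N. a \<alpha> * s \<alpha> i x)" if "i \<in> idx L" "x \<in> bdom L i" for i x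
    using that by (simp add: hol_finsum_scale[OF s])
  then show ?thesis by blast
qed

text \<open>Both \<open>c\<close> and the zero family expand the zero section, and expansions are
  unique. Uniqueness holds among families extensional on \<open>{..N}\<close>, hence the
  restrictions.\<close>

lemma section_basis_independent:
  assumes basis: "section_basis (hol_space A) L (\<lambda>c x. c) k N s"
    and zero: "\<And>i x. i \<in> idx L \<Longrightarrow> x \<in> bdom L i \<Longrightarrow> (\<Sum>\<alpha>\<le>N. c \<alpha> * s \<alpha> i x) = 0" and "\<alpha> \<le> N"
  shows "c \<alpha> = 0"
proof -
  have s: "\<And>\<alpha>. \<alpha> \<le> N \<Longrightarrow> s \<alpha> \<in> sections (hol_space A) L k"
    using basis by (simp add: section_basis_def)
  define z :: "'j \<Rightarrow> 'x \<Rightarrow> complex" where "z = (\<lambda>i\<in>idx L. \<lambda>x\<in>bdom L i. 0)"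
  have z: "z \<in> sections (hol_space A) L k"
    using open_bdom
    by (auto simp: z_def sections_def Let_def fun_eq_iff holomorphic_fn_restrict[OF A] holomorphic_fn_const)
  have "\<exists>!a. a \<in> extensional {..N} \<and> (\<forall>i\<in>idx L. z i = finsum (sec (hol_space A) (bdom L i))
      (\<lambda>\<alpha>. scale_section (hol_space A) L (\<lambda>x. a \<alpha>) (s \<alpha>) i) {..N})"
    using basis z unfolding section_basis_def by blast
  then have uniq: "\<exists>!a. a \<in> extensional {..N} \<and>
      (\<forall>i\<in>idx L. z i = (\<lambda>x\<in>bdom L i. \<Sum>\<alpha>\<le>N. a \<alpha> * s \<alpha> i x))"
    by (simp add: hol_finsum_scale[OF s] cong: ball_cong)
  from uniq obtain b where "\<And>a. a \<in> extensional {..N} \<Longrightarrow>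
      (\<And>i. i \<in> idx L \<Longrightarrow> z i = (\<lambda>x\<in>bdom L i. \<Sum>\<alpha>\<le>N. a \<alpha> * s \<alpha> i x)) \<Longrightarrow> a = b"
    by (elim ex1E) blast
  note b = this
  have "restrict c {..N} = b"
    by (rule b) (auto simp: z_def zero fun_eq_iff)
  moreover have "restrict (\<lambda>\<alpha>. 0) {..N} = b"
    by (rule b) (auto simp: z_def fun_eq_iff)
  ultimately have "restrict c {..N} = restrict (\<lambda>\<alpha>. 0) {..N}"
    by simp
  then show ?thesis
    using \<open>\<alpha> \<le> N\<close> by (auto dest: fun_cong[of _ _ \<alpha>])
qed

section \<open>The pointwise Hermitian product of sections\<close>

context
  fixes h :: "'j \<Rightarrow> 'x \<Rightarrow> real"
  assumes h: "hermitian_metric A L h"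
begin

lemma metric_pos: "i \<in> idx L \<Longrightarrow> x \<in> bdom L i \<Longrightarrow> h i x > 0"
  using h unfolding hermitian_metric_def by blast

lemma metric_continuous:
  assumes i: "i \<in> idx L"
  shows "continuous_on (bdom L i) (h i)"
proof (rule continuous_on_charts[OF A open_bdom[OF i]])
  fix U z assume "(U, z) \<in> A"
  then have "smooth_fn (z ` (U \<inter> bdom L i)) (h i \<circ> the_inv_into U z)"
    using h i unfolding hermitian_metric_def by blast
  then show "continuous_on (z ` (U \<inter> bdom L i)) (h i \<circ> the_inv_into U z)"
    by (rule smooth_fn.cases) simp
qed

text \<open>Independence of the trivialization: passing from \<open>i\<close> to \<open>j\<close>
  divides \<open>s\<close> and \<open>t\<close> by the \<open>k\<close>-th power of the transition
  function and its values in the metric contribute the \<open>2 * k\<close>-th power of its modulus,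
  so the factors cancel.\<close>

lemma herm_eq:
  assumes s: "s \<in> sections (hol_space A) L k" and t: "t \<in> sections (hol_space A) L k"
    and i: "i \<in> idx L" "x \<in> bdom L i"
  shows "herm L h k s t x = s i x * cnj (t i x) * complex_of_real (h i x ^ k)"
proof -
  define j where "j = triv_at L x"
  have j: "j \<in> idx L" "x \<in> bdom L j"
    using triv_at[OF L] by (auto simp: j_def)
  have "h j x = (cmod (btrans L i j x))\<^sup>2 * h i x"
    using h i j unfolding hermitian_metric_def by blast
  then have "complex_of_real (h j x) = btrans L i j x * cnj (btrans L i j x) * complex_of_real (h i x)"
    by (simp only: of_real_mult complex_norm_square)
  then show ?thesis
    using hol_sections_trans[OF s i(1) j(1) i(2) j(2)] hol_sections_trans[OF t i(1) j(1) i(2) j(2)]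
    by (simp add: herm_def Let_def power_mult_distrib flip: j_def)
qed

text \<open>The index \<open>triv_at L x\<close> varies with \<open>x\<close> without any
  regularity. By \<open>herm_eq\<close> a fixed index may be used on each trivializing open set,
  where all factors are continuous.\<close>

lemma herm_continuous:
  assumes s: "s \<in> sections (hol_space A) L k" and t: "t \<in> sections (hol_space A) L k"
  shows "continuous_on UNIV (herm L h k s t)"
proof -
  have "continuous_on (bdom L i) (herm L h k s t)" if i: "i \<in> idx L" for i
  proof -
    have "continuous_on (bdom L i) (s i)" "continuous_on (bdom L i) (t i)"
      using sections_carrier[OF s i] sections_carrier[OF t i]
      by (auto intro!: holomorphic_fn_continuous[OF A open_bdom[OF i]])
    then have "continuous_on (bdom L i) (\<lambda>x. s i x * cnj (t i x) * complex_of_real (h i x ^ k))"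
      by (intro continuous_intros metric_continuous[OF i])
    then show ?thesis
      using herm_eq[OF s t i] by (simp cong: continuous_on_cong)
  qed
  then have "continuous_on (\<Union>i\<in>idx L. bdom L i) (herm L h k s t)"
    using open_bdom by (intro continuous_on_open_UN) auto
  moreover have "(\<Union>i\<in>idx L. bdom L i) = UNIV"
    using L by (simp add: line_bundle_def)
  ultimately show ?thesis by simp
qed

lemma herm_self:
  "herm L h k s s x = complex_of_real ((cmod (s (triv_at L x) x))\<^sup>2 * h (triv_at L x) x ^ k)"
  unfolding herm_def Let_def of_real_mult complex_norm_square by (rule refl)

lemma herm_self_power:
  assumes "\<And>i. i \<in> idx L \<Longrightarrow> x \<in> bdom L i \<Longrightarrow> t i x = s i x ^ k"
  shows "herm L h k t t x = complex_of_real (pt_norm L h s x ^ (2 * k))"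
proof -
  have "pt_norm L h s x ^ 2 = (cmod (s (triv_at L x) x))\<^sup>2 * h (triv_at L x) x"
    using metric_pos[OF triv_at[OF L]] by (simp add: pt_norm_def herm_self less_imp_le)
  then have "pt_norm L h s x ^ (2 * k) = ((cmod (s (triv_at L x) x))\<^sup>2) ^ k * h (triv_at L x) x ^ k"
    by (simp add: power_mult power_mult_distrib)
  moreover have "(cmod (t (triv_at L x) x))\<^sup>2 = ((cmod (s (triv_at L x) x))\<^sup>2) ^ k"
    by (simp add: assms[OF triv_at[OF L]] norm_power mult.commute flip: power_mult)
  ultimately show ?thesis
    by (simp only: herm_self)
qed

text \<open>Compactness of the manifold makes the supremum in the definition of \<open>M\<close> a
  genuine upper bound; real suprema of unbounded sets carry no such information.\<close>

lemma pt_norm_bdd: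
  assumes "s \<in> sections (hol_space A) L 1"
  shows "bdd_above (range (pt_norm L h s))"
proof -
  have "continuous_on UNIV (\<lambda>x. sqrt (Re (herm L h 1 s s x)))"
    by (intro continuous_intros herm_continuous assms)
  moreover have "compact (UNIV :: 'x set)"
    using A by (simp add: compact_complex_manifold_def)
  ultimately have "compact (range (pt_norm L h s))"
    unfolding pt_norm_def by (rule compact_continuous_image)
  then show ?thesis
    by (intro bounded_imp_bdd_above compact_imp_bounded)
qed

section \<open>Finiteness of the volume and Parseval's identity\<close>

context
  fixes \<nu> :: "'x measure"
  assumes \<nu>: "sets \<nu> = sets borel"
begin

lemma space_\<nu>: "space \<nu> = UNIV"
  using sets_eq_imp_space_eq[OF \<nu>] by simp

lemma herm_measurable:
  assumes "s \<in> sections (hol_space A) L k" "t \<in> sections (hol_space A) L k"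
  shows "herm L h k s t \<in> borel_measurable \<nu>"
  using borel_measurable_continuous_onI[OF herm_continuous[OF assms]] measurable_cong_sets[OF \<nu> refl] by blast

text \<open>A section of nonzero norm is square integrable (its integral is not the junk value \<open>0\<close>), so that
  the measure is finite near every point where some such section does not vanish.\<close>

lemma finite_measure_of_sections:
  assumes sec: "\<And>x. \<exists>m s. s \<in> sections (hol_space A) L m \<and> L2_inner n L h \<nu> m s s \<noteq> 0 \<and> herm L h m s s x \<noteq> 0"
  shows "finite_measure \<nu>"
proof -
  have "\<exists>V. open V \<and> x \<in> V \<and> emeasure \<nu> V < \<infinity>" for x
  proof -
    obtain m s where s: "s \<in> sections (hol_space A) L m" "L2_inner n L h \<nu> m s s \<noteq> 0" "herm L h m s s x \<noteq> 0"
      using sec by blast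
    define f where "f y = Re (herm L h m s s y)" for y
    have f: "herm L h m s s y = complex_of_real (f y)" "f y \<ge> 0" for y
      using metric_pos[OF triv_at[OF L, of y]] by (auto simp: f_def herm_self less_imp_le)
    have int: "integrable \<nu> f"
    proof -
      have "integrable \<nu> (herm L h m s s)"
        using s(2) not_integrable_integral_eq by (fastforce simp: L2_inner_def)
      then show ?thesis unfolding f_def by simp
    qed
    have fx: "f x > 0"
      using f[of x] s(3) by (auto simp: less_le)
    \<comment> \<open>On this open neighbourhood of \<open>x\<close> the integrable function
      \<open>f\<close> stays above a positive constant, so Markov's inequality bounds its
      measure.\<close>
    define V where "V = {y. f y > f x / 2}"
    have "continuous_on UNIV f"
      unfolding f_def by (intro continuous_intros herm_continuous s)
    then have "open V"
      unfolding V_def by (intro open_Collect_less continuous_intros)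
    have "x \<in> V" using fx by (simp add: V_def)
    have "emeasure \<nu> {y\<in>space \<nu>. f y \<ge> f x / 2} \<le> 1 / (f x / 2) * (\<integral>y. f y \<partial>\<nu>)"
      using fx f(2) by (intro integral_Markov_inequality[OF int]) auto
    then have "emeasure \<nu> {y\<in>space \<nu>. f y \<ge> f x / 2} < \<infinity>"
      by (rule le_less_trans) simp
    moreover have "emeasure \<nu> V \<le> emeasure \<nu> {y\<in>space \<nu>. f y \<ge> f x / 2}"
    proof (rule emeasure_mono)
      have [measurable]: "f \<in> borel_measurable \<nu>"
        using int by (rule borel_measurable_integrable)
      show "{y\<in>space \<nu>. f y \<ge> f x / 2} \<in> sets \<nu>" by measurable
    qed (auto simp: V_def space_\<nu>)
    ultimately have fin: "emeasure \<nu> V < \<infinity>"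
      by (rule le_less_trans[rotated])
    show ?thesis using \<open>open V\<close> \<open>x \<in> V\<close> fin by blast
  qed
  then obtain V where V: "\<And>x. open (V x)" "\<And>x. x \<in> V x" "\<And>x. emeasure \<nu> (V x) < \<infinity>"
    by metis
  have "compact (UNIV :: 'x set)" using A by (simp add: compact_complex_manifold_def)
  then obtain F where F: "finite F" "UNIV = (\<Union>x\<in>F. V x)"
    using compactE_image[of UNIV UNIV V] V by (metis UNIV_I UN_I subsetI top.extremum_uniqueI)
  have "emeasure \<nu> (\<Union>x\<in>F. V x) \<le> (\<Sum>x\<in>F. emeasure \<nu> (V x))"
    using V(1) by (intro emeasure_subadditive_finite F) (auto simp: \<nu>)
  also have "\<dots> < \<infinity>"
    using V(3) F(1) by (simp add: less_top)
  finally show ?thesis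
    by (intro finite_measureI) (simp add: space_\<nu> flip: F(2))
qed

text \<open>The squared norm of \<open>s1\<close> to the power \<open>k\<close> is computed in two
  ways: as the sum of the squared moduli of the coefficients, by orthonormality, and as an integral
  of at most the volume times \<open>M ^ (2 * k)\<close>.\<close>

lemma coefficient_bound:
  fixes N :: nat
  assumes fin: "finite_measure \<nu>"
    and s: "\<And>\<alpha>. \<alpha> \<le> N \<Longrightarrow> s \<alpha> \<in> sections (hol_space A) L k"
    and orth: "\<And>\<alpha> \<gamma>. \<alpha> \<le> N \<Longrightarrow> \<gamma> \<le> N \<Longrightarrow> L2_inner n L h \<nu> k (s \<alpha>) (s \<gamma>) = (if \<alpha> = \<gamma> then 1 else 0)"
    and s1: "s1 \<in> sections (hol_space A) L 1"
    and exp: "\<And>i x. i \<in> idx L \<Longrightarrow> x \<in> bdom L i \<Longrightarrow> s1 i x ^ k = (\<Sum>\<alpha>\<le>N. a \<alpha> * s \<alpha> i x)"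
    and M: "\<And>x. pt_norm L h s1 x \<le> M" and "\<alpha> \<le> N"
  shows "cmod (a \<alpha>) \<le> sqrt (measure \<nu> UNIV) * M ^ k"
proof -
  interpret finite_measure \<nu> by fact
  define t where "t i x = s1 i x ^ k" for i x
  \<comment> \<open>Continuous functions on a compact space are bounded, hence integrable for a
    finite measure. The fact serves both the complex products and the real powers of the
    norm.\<close>
  have bdd: "integrable \<nu> f" if "continuous_on UNIV f" "f \<in> borel_measurable \<nu>" for f :: "'x \<Rightarrow> 'c::{banach, second_countable_topology}"
  proof -
    have "compact (range f)"
      using that(1) A by (intro compact_continuous_image) (simp_all add: compact_complex_manifold_def)
    then obtain B where "\<And>x. norm (f x) \<le> B"
      using compact_imp_bounded bounded_iff by (metis rangeI)
    then show ?thesis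
      using that(2) by (intro integrable_const_bound[of _ B]) auto
  qed
  have int: "integrable \<nu> (herm L h k (s \<alpha>) (s \<gamma>))" if "\<alpha> \<le> N" "\<gamma> \<le> N" for \<alpha> \<gamma>
    using that by (intro bdd herm_continuous herm_measurable s)
  have expand: "herm L h k t t x = (\<Sum>\<alpha>\<le>N. \<Sum>\<gamma>\<le>N. (a \<alpha> * cnj (a \<gamma>)) * herm L h k (s \<alpha>) (s \<gamma>) x)" for x
  proof -
    have "t (triv_at L x) x = (\<Sum>\<alpha>\<le>N. a \<alpha> * s \<alpha> (triv_at L x) x)"
      unfolding t_def by (rule exp[OF triv_at[OF L]])
    then have "herm L h k t t x = (\<Sum>\<alpha>\<le>N. \<Sum>\<gamma>\<le>N. (a \<alpha> * s \<alpha> (triv_at L x) x) *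
        cnj (a \<gamma> * s \<gamma> (triv_at L x) x) * complex_of_real (h (triv_at L x) x ^ k))"
      by (simp only: herm_def Let_def cnj_sum sum_product) (simp only: sum_distrib_right)
    then show ?thesis
      by (simp add: herm_def Let_def ac_simps)
  qed
  have parseval: "(LINT x|\<nu>. herm L h k t t x) / fact n = (\<Sum>\<alpha>\<le>N. complex_of_real ((cmod (a \<alpha>))\<^sup>2))"
  proof -
    have "(LINT x|\<nu>. herm L h k t t x)
        = (\<Sum>\<alpha>\<le>N. (LINT x|\<nu>. (\<Sum>\<gamma>\<le>N. (a \<alpha> * cnj (a \<gamma>)) * herm L h k (s \<alpha>) (s \<gamma>) x)))"
      unfolding expand
      by (rule Bochner_Integration.integral_sum, rule Bochner_Integration.integrable_sum,
          rule integrable_mult_right, rule int) auto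
    also have "\<dots> = (\<Sum>\<alpha>\<le>N. \<Sum>\<gamma>\<le>N. (LINT x|\<nu>. (a \<alpha> * cnj (a \<gamma>)) * herm L h k (s \<alpha>) (s \<gamma>) x))"
      by (rule sum.cong[OF refl], rule Bochner_Integration.integral_sum, rule integrable_mult_right, rule int) auto
    finally have "(LINT x|\<nu>. herm L h k t t x) / fact n
        = (\<Sum>\<alpha>\<le>N. \<Sum>\<gamma>\<le>N. (a \<alpha> * cnj (a \<gamma>)) * L2_inner n L h \<nu> k (s \<alpha>) (s \<gamma>))"
      by (simp add: L2_inner_def sum_divide_distrib)
    also have "\<dots> = (\<Sum>\<alpha>\<le>N. \<Sum>\<gamma>\<le>N. if \<gamma> = \<alpha> then a \<alpha> * cnj (a \<gamma>) else 0)"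
      by (intro sum.cong refl) (auto simp: orth)
    also have "\<dots> = (\<Sum>\<alpha>\<le>N. complex_of_real ((cmod (a \<alpha>))\<^sup>2))"
      unfolding complex_norm_square by simp
    finally show ?thesis .
  qed
  have self: "herm L h k t t x = complex_of_real (pt_norm L h s1 x ^ (2 * k))" for x
    by (rule herm_self_power) (simp add: t_def)
  have nn: "pt_norm L h s1 x \<ge> 0" for x
    using metric_pos[OF triv_at[OF L, of x]] by (simp add: pt_norm_def herm_self less_imp_le)
  \<comment> \<open>The sign of \<open>M\<close> is needed at the end, where the square root of
    \<open>(M ^ k)\<^sup>2\<close> is taken.\<close>
  then have M0: "M \<ge> 0" using M order_trans by blast
  have "complex_of_real (LINT x|\<nu>. pt_norm L h s1 x ^ (2 * k)) = complex_of_real (fact n * (\<Sum>\<alpha>\<le>N. (cmod (a \<alpha>))\<^sup>2))"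
    using parseval unfolding self integral_complex_of_real by (simp add: field_simps)
  then have eq: "(LINT x|\<nu>. pt_norm L h s1 x ^ (2 * k)) = fact n * (\<Sum>\<alpha>\<le>N. (cmod (a \<alpha>))\<^sup>2)"
    by (simp only: of_real_eq_iff)
  have "(cmod (a \<alpha>))\<^sup>2 \<le> (\<Sum>\<alpha>\<le>N. (cmod (a \<alpha>))\<^sup>2)"
    using \<open>\<alpha> \<le> N\<close> by (intro member_le_sum) auto
  \<comment> \<open>The product uses the volume form divided by \<open>n!\<close>, while
    \<open>\<nu>\<close> is not divided. As \<open>n!\<close> is at least 1, the factor can be
    absorbed by the inequality.\<close>
  also have "\<dots> \<le> fact n * (\<Sum>\<alpha>\<le>N. (cmod (a \<alpha>))\<^sup>2)"
    using mult_right_mono[of 1 "fact n" "\<Sum>\<alpha>\<le>N. (cmod (a \<alpha>))\<^sup>2"] by (simp add: sum_nonneg fact_ge_1)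
  also have "\<dots> = (LINT x|\<nu>. pt_norm L h s1 x ^ (2 * k))"
    by (rule eq[symmetric])
  also have "\<dots> \<le> (LINT x|\<nu>. M ^ (2 * k))"
  proof (rule integral_mono)
    have c: "continuous_on UNIV (\<lambda>x. sqrt (Re (herm L h 1 s1 s1 x)))"
      by (intro continuous_intros herm_continuous s1)
    have m: "(\<lambda>x. sqrt (Re (herm L h 1 s1 s1 x))) \<in> borel_measurable \<nu>"
      using borel_measurable_continuous_onI[OF c] measurable_cong_sets[OF \<nu> refl] by blast
    show "integrable \<nu> (\<lambda>x. pt_norm L h s1 x ^ (2 * k))"
      unfolding pt_norm_def by (intro bdd continuous_on_power borel_measurable_power c m)
  qed (use M nn in \<open>auto intro: power_mono\<close>)
  also have "\<dots> = measure \<nu> UNIV * (M ^ k)\<^sup>2"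
    by (simp add: space_\<nu> power_mult[symmetric] mult.commute)
  finally have "(cmod (a \<alpha>))\<^sup>2 \<le> measure \<nu> UNIV * (M ^ k)\<^sup>2" .
  then have "sqrt ((cmod (a \<alpha>))\<^sup>2) \<le> sqrt (measure \<nu> UNIV * (M ^ k)\<^sup>2)"
    by (rule real_sqrt_le_mono)
  then show ?thesis
    using M0 by (simp add: real_sqrt_mult)
qed

end

end

end

section \<open>Test configurations\<close>

lemma is_scheme_ringed: "is_scheme X \<Longrightarrow> ringed_space X"
  by (simp add: is_scheme_def locally_ringed_space_def)

lemma pull_spec_fn:
  fixes f :: "'a::idom \<Rightarrow> 'b::idom"
  assumes hom: "\<And>a b. f (a + b) = f a + f b" "\<And>a b. f (a * b) = f a * f b" "f 1 = 1"
    and g: "morphism X (Spec type_ring) g"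
  shows "mfn (mor_comp (Spec type_ring) (spec_map type_ring type_ring f) g) (primes type_ring) (spec_fn type_ring a)
    = mfn g (primes type_ring) (spec_fn type_ring (f a))"
  using mfn_spec_map[OF hom] pre_spec_map[OF hom] by (simp add: mor_comp_def)

section \<open>Functions of the base coordinate on the total space and on the fibres\<close>

context
  fixes T :: "('p, 'r, 'i) tconf"
  assumes T: "test_configuration T"
begin

lemma tot_ringed: "ringed_space (tot T)"
  using T by (simp add: test_configuration_def is_scheme_ringed)

lemma proj_morphism: "morphism (tot T) (Spec type_ring) (proj T)"
  using T by (simp add: test_configuration_def line_def)

lemma lb_bundle: "line_bundle (tot T) (lb T)"
  using T by (simp add: test_configuration_def)

lemma fib_ringed: "ringed_space (fib T w)"
  and inc_morphism: "morphism (fib T w) (tot T) (inc T w)"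
  using T unfolding test_configuration_def fibre_product_def by (metis is_scheme_ringed)+

lemma act_bundle_map: "w \<noteq> 0 \<Longrightarrow> bundle_map (tot T) (lb T) (tot T) (lb T) (act T w) (lin T w)"
  using T by (simp add: test_configuration_def group_action_def)

lemma act_morphism: "w \<noteq> 0 \<Longrightarrow> morphism (tot T) (tot T) (act T w)"
  using act_bundle_map by (simp add: bundle_map_def)

lemma fib_lb_bundle: "line_bundle (fib T w) (fib_lb T w)"
  by (rule line_bundle_pull[OF tot_ringed lb_bundle inc_morphism])

lemma pre_proj: "pre (tot T) (proj T) (primes type_ring) = pts (tot T)"
  using pre_pts[OF proj_morphism] by simp

lemma poly_fn_carrier: "poly_fn T P \<in> carrier (sec (tot T) (pts (tot T)))"
proof -
  have "openin (topo (Spec (type_ring :: complex poly ring))) (primes type_ring)"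
    using openin_topspace[of "topo (Spec (type_ring :: complex poly ring))"] by simp
  from ring_hom_closed[OF morphism_hom[OF proj_morphism this] spec_fn_carrier]
  show ?thesis
    by (simp add: poly_fn_def line_def pre_proj)
qed

lemma openin_primes: "openin (topo (Spec (type_ring :: 'a::comm_ring_1 ring))) (primes type_ring)"
  using openin_topspace[of "topo (Spec (type_ring :: 'a ring))"] by simp

text \<open>Equivariance of the projection: \<open>\<rho>(w)\<close> multiplies the base coordinate
  by \<open>w\<close>, which on polynomials is composition with \<open>[:0, w:]\<close>.\<close>

lemma act_poly_fn:
  assumes w: "w \<noteq> 0"
  shows "mfn (act T w) (pts (tot T)) (poly_fn T P) = poly_fn T (pcompose P [:0, w:])"
proof -
  have "mor_eq (tot T) line (mor_comp (tot T) (proj T) (act T w)) (mor_comp line (line_mult w) (proj T))"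
    using T w by (simp add: test_configuration_def)
  then have "mfn (mor_comp (tot T) (proj T) (act T w)) (primes type_ring) (spec_fn type_ring P)
      = mfn (mor_comp line (line_mult w) (proj T)) (primes type_ring) (spec_fn type_ring P)"
    unfolding mor_eq_def line_def using openin_primes spec_fn_carrier by blast
  also have "\<dots> = mfn (proj T) (primes type_ring) (spec_fn type_ring (pcompose P [:0, w:]))"
    unfolding line_def line_mult_def
    by (rule pull_spec_fn[OF _ _ _ proj_morphism]) (simp_all add: pcompose_add pcompose_mult pcompose_1)
  finally show ?thesis
    by (simp add: mor_comp_def pre_proj poly_fn_def line_def)
qed

text \<open>By the commuting square of the fibre product, a polynomial restricted to the fibre over
  \<open>w\<close> comes from the point and depends only on its value at \<open>w\<close>. So it has
  the same restriction as the constant polynomial with that value.\<close>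

lemma inc_poly_fn: "mfn (inc T w) (pts (tot T)) (poly_fn T P) = const_fn T w (poly P w)"
proof -
  obtain str where fp: "fibre_product (tot T) point line (proj T) (line_point w) (fib T w) (inc T w) str"
    using T unfolding test_configuration_def by blast
  have str: "morphism (fib T w) (Spec type_ring) str"
    using fp by (simp add: fibre_product_def point_def)
  have eq: "mor_eq (fib T w) line (mor_comp (tot T) (proj T) (inc T w)) (mor_comp point (line_point w) str)"
    using fp by (simp add: fibre_product_def)
  have "mfn (inc T w) (pts (tot T)) (poly_fn T Q) = mfn str (primes type_ring) (spec_fn type_ring (poly Q w))" for Q
  proof -
    have "mfn (mor_comp (tot T) (proj T) (inc T w)) (primes type_ring) (spec_fn type_ring Q)
        = mfn (mor_comp point (line_point w) str) (primes type_ring) (spec_fn type_ring Q)"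
      using eq unfolding mor_eq_def line_def using openin_primes spec_fn_carrier by blast
    also have "\<dots> = mfn str (primes type_ring) (spec_fn type_ring (poly Q w))"
      unfolding point_def line_point_def by (rule pull_spec_fn[OF _ _ _ str]) simp_all
    finally show ?thesis
      by (simp add: mor_comp_def pre_proj poly_fn_def line_def)
  qed
  from this[of P] this[of "[:poly P w:]"] show ?thesis
    by (simp add: const_fn_def)
qed

lemma const_fn_carrier: "const_fn T w c \<in> carrier (sec (fib T w) (pts (fib T w)))"
  using ring_hom_closed[OF morphism_hom[OF inc_morphism openin_topspace] poly_fn_carrier, of w "[:c:]"]
  by (simp add: const_fn_def pre_pts[OF inc_morphism])

section \<open>Evaluation along orbits, and holomorphic sections without zeros at a given
  point\<close>

context
  fixes A :: "('x::t2_space, 'n::finite) atlas" and L :: "('j, 'x) hol_bundle"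
    and \<phi> :: "('x, 'x \<Rightarrow> complex, 'p, 'r) rmor" and \<mu> :: "'i \<Rightarrow> 'j \<Rightarrow> 'x \<Rightarrow> complex"
  assumes A: "compact_complex_manifold A" and L: "line_bundle (hol_space A) L"
    and gf: "general_fibre A L T \<phi> \<mu>"
begin

lemma \<phi>_bundle_map: "bundle_map (hol_space A) L (fib T 1) (fib_lb T 1) \<phi> \<mu>"
  using gf by (simp add: general_fibre_def)

lemma \<phi>_morphism: "morphism (hol_space A) (fib T 1) \<phi>"
  using \<phi>_bundle_map by (simp add: bundle_map_def)

text \<open>Evaluation at the point \<open>\<rho>(w) x\<close> of the total space.\<close>

lemma orbit_evaluation:
  assumes w: "w \<noteq> 0" and i: "i \<in> idx L" "x \<in> bdom L i"
  obtains y e \<kappa> b where "evaluation (tot T) y e" "b \<in> idx (lb T)" "y \<in> bdom (lb T) b" "\<kappa> \<noteq> 0"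
    "\<And>P. e (pts (tot T)) (poly_fn T P) = poly P w"
    "\<And>m s s' t S c. s \<in> sections (hol_space A) L m \<Longrightarrow> s' \<in> sections (fib T 1) (fib_lb T 1) m \<Longrightarrow>
       bundle_pull (hol_space A) L (fib_lb T 1) \<phi> \<mu> m s s' \<Longrightarrow> transported T m 1 w s' t \<Longrightarrow>
       S \<in> sections (tot T) (lb T) m \<Longrightarrow>
       pull_section (inc T w) (lb T) S = scale_section (fib T w) (fib_lb T w) (const_fn T w c) t \<Longrightarrow>
       e (bdom (lb T) b) (S b) = c * \<kappa> ^ m * s i x"
proof -
  let ?X = "hol_space A" and ?Y = "fib T 1" and ?Z = "tot T" and ?B = "bdom (lb T)"
  \<comment> \<open>The evaluations \<open>e0\<close>, \<open>e1\<close> and \<open>e\<close> belong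
    to the points \<open>y0\<close>, \<open>y1\<close> and \<open>y\<close>: the image of
    \<open>x\<close> in the fibre at 1, its image in the total space, and the translate of the
    latter by \<open>\<rho>(w)\<close>.\<close>
  define e0 where "e0 = pull_eval ?X \<phi> (\<lambda>U f. f x)"
  define e1 where "e1 = pull_eval ?Y (inc T 1) e0"
  define e where "e = pull_eval ?Z (act T w) e1"
  define y0 where "y0 = mpt \<phi> x"
  define y1 where "y1 = mpt (inc T 1) y0"
  define y where "y = mpt (act T w) y1"
  have ev0: "evaluation ?Y y0 e0"
    unfolding y0_def e0_def by (rule evaluation_pull[OF \<phi>_morphism evaluation_hol[OF A]])
  have ev1: "evaluation ?Z y1 e1"
    unfolding y1_def e1_def by (rule evaluation_pull[OF inc_morphism ev0])
  have ev: "evaluation ?Z y e"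
    unfolding y_def e_def by (rule evaluation_pull[OF act_morphism[OF w] ev1])
  have pts: "y0 \<in> pts ?Y" "y1 \<in> pts ?Z" "y \<in> pts ?Z"
    using ev0 ev1 ev by (simp_all add: evaluation_def)
  obtain a where a: "a \<in> idx (lb T)" "y1 \<in> ?B a"
    using line_bundle_cover[OF lb_bundle pts(2)] by blast
  obtain b where b: "b \<in> idx (lb T)" "y \<in> ?B b"
    using line_bundle_cover[OF lb_bundle pts(3)] by blast
  have op: "openin (topo ?Z) (?B l)" if "l \<in> idx (lb T)" for l
    using line_bundle_open[OF lb_bundle that] .
  have opf: "openin (topo (fib T v)) (bdom (fib_lb T v) l)" if "l \<in> idx (lb T)" for v l
    using line_bundle_open[OF fib_lb_bundle] that by (simp add: pull_bundle_def)
  have y0: "y0 \<in> bdom (fib_lb T 1) a"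
    using a pts by (simp add: pull_bundle_def pre_def y1_def)
  define W where "W = ?B a \<inter> pre ?Z (act T w) (?B b)"
  have W: "openin (topo ?Z) W" "y1 \<in> W"
    using op a b openin_pre[OF act_morphism[OF w]] pts by (auto simp: W_def openin_Int pre_def y_def)
  have lin: "lin T w b a \<in> Units (sec ?Z W)"
    using act_bundle_map[OF w] a b by (simp add: bundle_map_def W_def)
  have \<mu>: "\<mu> a i \<in> Units (sec ?X (bdom L i \<inter> pre ?X \<phi> (bdom (fib_lb T 1) a)))"
    using \<phi>_bundle_map a i unfolding bundle_map_def by (simp add: pull_bundle_def)
  \<comment> \<open>The scalar relating the fibre coordinate of \<open>L\<close> at \<open>x\<close>
    in the trivialization \<open>i\<close> to that of the line bundle at \<open>y\<close> in the
    trivialization \<open>b\<close>. It depends neither on the section nor on the power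
    \<open>m\<close>.\<close>
  define \<kappa> where "\<kappa> = e1 W (lin T w b a) * \<mu> a i x"
  have "\<mu> a i x \<noteq> 0"
  proof -
    have "openin (topo ?X) (bdom L i \<inter> pre ?X \<phi> (bdom (fib_lb T 1) a))"
      using line_bundle_open[OF L i(1)] openin_pre[OF \<phi>_morphism opf[OF a(1)]] by (rule openin_Int)
    moreover have "x \<in> bdom L i \<inter> pre ?X \<phi> (bdom (fib_lb T 1) a)"
      using i(2) y0 by (simp add: pre_def y0_def)
    ultimately show ?thesis
      using eval_unit[OF evaluation_hol[OF A] _ _ \<mu>] by blast
  qed
  then have \<kappa>: "\<kappa> \<noteq> 0"
    using eval_unit[OF ev1 W lin] by (simp add: \<kappa>_def)
  \<comment> \<open>Pulling back by the action substitutes \<open>w\<close> times the coordinate,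
    the fibre at 1 sets the coordinate to 1, and \<open>\<phi>\<close> preserves constants.\<close>
  have poly: "e (pts ?Z) (poly_fn T P) = poly P w" for P
  proof -
    have "mfn \<phi> (pts ?Y) (const_fn T 1 c) x = c" for c
      using gf by (simp add: general_fibre_def)
    then show ?thesis
      by (simp add: e_def e1_def e0_def pull_eval_def act_poly_fn[OF w] inc_poly_fn poly_pcompose
          pre_pts[OF act_morphism[OF w]] pre_pts[OF inc_morphism] pre_pts[OF \<phi>_morphism])
  qed
  have "e (?B b) (S b) = c * \<kappa> ^ m * s i x"
    if s: "s \<in> sections ?X L m" and s': "s' \<in> sections ?Y (fib_lb T 1) m"
      and pull: "bundle_pull ?X L (fib_lb T 1) \<phi> \<mu> m s s'" and tr: "transported T m 1 w s' t"
      and S: "S \<in> sections ?Z (lb T) m"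
      and pS: "pull_section (inc T w) (lb T) S = scale_section (fib T w) (fib_lb T w) (const_fn T w c) t"
    for m s s' t S c
  proof -
    let ?\<theta> = "\<lambda>a i. mfn (inc T 1) (?B i \<inter> pre ?Z (act T w) (?B a)) (lin T w a i)"
    obtain r where r: "morphism ?Y (fib T w) r"
      and eq: "mor_eq ?Y ?Z (mor_comp (fib T w) (inc T w) r) (mor_comp ?Z (act T w) (inc T 1))"
      and pr: "bundle_pull ?Y (fib_lb T 1) (fib_lb T w) r ?\<theta> m s' t"
      and t: "t \<in> sections (fib T w) (fib_lb T w) m"
      using tr by (auto simp: transported_def)
    define er where "er = pull_eval ?Y r e0"
    have evr: "evaluation (fib T w) (mpt r y0) er"
      unfolding er_def by (rule evaluation_pull[OF r ev0])
    \<comment> \<open>The point \<open>y\<close> is also reached through the fibre over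
      \<open>w\<close>; the commuting square for \<open>r\<close> makes both evaluations agree on
      the total space.\<close>
    have er: "pull_eval (fib T w) (inc T w) er V g = e V g"
      if "openin (topo ?Z) V" "g \<in> carrier (sec ?Z V)" for V g
      using pull_eval_mor_eq[OF eq that, of e0]
      by (simp add: pull_eval_comp[OF r] pull_eval_comp[OF inc_morphism] er_def e_def e1_def)
    have pre: "pre ?Y r (pre (fib T w) (inc T w) V) = pre ?Y (inc T 1) (pre ?Z (act T w) V)" for V
      using pre_mor_eq[OF eq, of V] by (simp add: pre_comp[OF r] pre_comp[OF inc_morphism])
    have "mpt (inc T w) (mpt r y0) = y"
      using eq pts by (simp add: mor_eq_def mor_comp_def y_def y1_def)
    then have yr: "mpt r y0 \<in> bdom (fib_lb T w) b"
      using b morphism_pts[OF r pts(1)] by (simp add: pull_bundle_def pre_def)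
    have W': "bdom (fib_lb T 1) a \<inter> pre ?Y r (bdom (fib_lb T w) b) = pre ?Y (inc T 1) W"
      by (simp add: pull_bundle_def pre W_def pre_Int)
    have \<theta>: "?\<theta> b a \<in> carrier (sec ?Y (bdom (fib_lb T 1) a \<inter> pre ?Y r (bdom (fib_lb T w) b)))"
      unfolding W' using ring_hom_closed[OF morphism_hom[OF inc_morphism W(1)] Units_carrier[OF lin]]
      by (simp add: W_def)
    have ab': "a \<in> idx (fib_lb T 1)" "b \<in> idx (fib_lb T w)"
      using a b by (simp_all add: pull_bundle_def)
    \<comment> \<open>The value is followed back from the total space to the fibre over
      \<open>w\<close>, where the factor \<open>c\<close> splits off, then through \<open>r\<close>
      to the fibre at 1 and through \<open>\<phi>\<close> to the manifold.\<close>
    have "e (?B b) (S b) = er (bdom (fib_lb T w) b) (pull_section (inc T w) (lb T) S b)"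
      using er[OF op[OF b(1)] sections_carrier[OF S b(1)]] b
      by (simp add: pull_eval_def pull_section_def pull_bundle_def)
    also have "\<dots> = er (pts (fib T w)) (const_fn T w c) * er (bdom (fib_lb T w) b) (t b)"
      unfolding pS by (rule eval_scale_section(2)[where s = t, OF fib_ringed evr opf[OF b(1)] ab'(2) yr const_fn_carrier
        sections_carrier[OF t ab'(2)]])
    also have "er (pts (fib T w)) (const_fn T w c) = c"
      using er[OF openin_topspace poly_fn_carrier, of "[:c:]"] poly[of "[:c:]"]
      by (simp add: pull_eval_def const_fn_def pre_pts[OF inc_morphism])
    also have "er (bdom (fib_lb T w) b) (t b) = e1 W (lin T w b a) ^ m * e0 (bdom (fib_lb T 1) a) (s' a)"
      using eval_bundle_pull[OF fib_ringed ev0 r opf[OF a(1)] opf[OF b(1)] \<theta> pr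
          sections_carrier[OF s' ab'(1)] sections_carrier[OF t ab'(2)] ab' y0 yr]
      unfolding W' by (simp add: er_def e1_def pull_eval_def W_def)
    also have "e0 (bdom (fib_lb T 1) a) (s' a) = \<mu> a i x ^ m * s i x"
      unfolding e0_def
      by (rule eval_bundle_pull[OF ringed_space_hol[OF A] evaluation_hol[OF A] \<phi>_morphism
          line_bundle_open[OF L i(1)] opf[OF a(1)] Units_carrier[OF \<mu>] pull sections_carrier[OF s i(1)]
          sections_carrier[OF s' ab'(1)] i(1) ab'(1) i(2) y0[unfolded y0_def]])
    finally show ?thesis
      by (simp add: \<kappa>_def power_mult_distrib)
  qed
  then show ?thesis
    using that[OF ev b \<kappa> poly] by blast
qed

text \<open>Ampleness over the fibre at 1 gives an algebraic section that is a unit at the image of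
  \<open>x\<close>. Units have nonzero values, so its pullback does not vanish at \<open>x\<close>.
  The condition \<open>m \<ge> 1\<close> matters because bases are given only for positive
  powers.\<close>

lemma nonvanishing_section:
  shows "\<exists>m\<ge>1. \<exists>t\<in>sections (hol_space A) L m. \<exists>i\<in>idx L. x \<in> bdom L i \<and> t i x \<noteq> 0"
proof -
  have "ample (fib T 1) (fib_lb T 1)"
    using T by (simp add: test_configuration_def)
  moreover have x: "mpt \<phi> x \<in> pts (fib T 1)"
    using morphism_pts[OF \<phi>_morphism] by simp
  ultimately obtain m u where m: "m \<ge> 1" and u: "u \<in> sections (fib T 1) (fib_lb T 1) m"
    and "mpt \<phi> x \<in> nonvanishing (fib T 1) (fib_lb T 1) u"
    unfolding ample_def by blast
  then obtain a where a: "a \<in> idx (fib_lb T 1)" "mpt \<phi> x \<in> bdom (fib_lb T 1) a"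
    "unit_at (fib T 1) (mpt \<phi> x) (bdom (fib_lb T 1) a) (u a)"
    by (auto simp: nonvanishing_def)
  obtain t where t: "t \<in> sections (hol_space A) L m"
    "\<forall>x. \<forall>i\<in>idx L. \<forall>a\<in>idx (fib_lb T 1). x \<in> bdom L i \<longrightarrow> mpt \<phi> x \<in> bdom (fib_lb T 1) a \<longrightarrow>
      mfn \<phi> (bdom (fib_lb T 1) a) (u a) x = \<mu> a i x ^ m * t i x"
    using bundle_map_pull_section[OF A L fib_ringed fib_lb_bundle \<phi>_bundle_map u] by blast
  have "pull_eval (hol_space A) \<phi> (\<lambda>U f. f x) (bdom (fib_lb T 1) a) (u a) \<noteq> 0"
    by (rule eval_unit_at[OF fib_ringed evaluation_pull[OF \<phi>_morphism evaluation_hol[OF A]]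
        line_bundle_open[OF fib_lb_bundle a(1)] a(2) sections_carrier[OF u a(1)] a(3)])
  then have nz: "mfn \<phi> (bdom (fib_lb T 1) a) (u a) x \<noteq> 0"
    by (simp add: pull_eval_def)
  obtain i where "i \<in> idx L" "x \<in> bdom L i"
    using line_bundle_cover[OF L, of x] by auto
  then have "t i x \<noteq> 0"
    using t(2) a nz by auto
  then show ?thesis
    using m t(1) \<open>i \<in> idx L\<close> \<open>x \<in> bdom L i\<close> by blast
qed

end

end

section \<open>Comparison of the weights\<close>

lemma poly_weight_zero:
  fixes p q :: int
  assumes eq: "\<And>w. w \<noteq> 0 \<Longrightarrow> poly P w * w powi p = w powi q * c" and "q < p"
  shows "c = (0::complex)"
proof -
  define n where "n = nat (p - q)"
  have pq: "p = q + int n"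
    using \<open>q < p\<close> by (simp add: n_def)
  \<comment> \<open>After cancelling \<open>w powi q\<close>, the hypothesis says that this
    polynomial vanishes at every nonzero \<open>w\<close>. Having infinitely many roots it is zero,
    and its value at 0 is \<open>- c\<close> because \<open>n > 0\<close>.\<close>
  define Q where "Q = [:0, 1:] ^ n * P - [:c:]"
  have "poly Q w = 0" if w: "w \<noteq> 0" for w
  proof -
    have "w powi p = w powi q * w ^ n"
      unfolding pq using w by (simp add: power_int_add)
    then have "w powi q * (w ^ n * poly P w) = w powi q * c"
      using eq[OF w] by (simp add: ac_simps)
    then show ?thesis
      using w by (simp add: Q_def poly_power)
  qed
  then have "UNIV - {0} \<subseteq> {w. poly Q w = 0}" by auto
  moreover have "infinite (UNIV - {0::complex})"
    by (simp add: infinite_UNIV_char_0)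
  ultimately have "Q = 0"
    using poly_roots_finite finite_subset by blast
  then have "poly Q 0 = 0" by simp
  then show ?thesis
    using \<open>q < p\<close> by (simp add: Q_def poly_power n_def zero_power)
qed

lemma adapted_power_expansion:
  fixes A :: "('x::t2_space, 'n::finite) atlas"
  assumes A: "compact_complex_manifold A" and L: "line_bundle (hol_space A) L"
    and T: "test_configuration T" and gf: "general_fibre A L T \<phi> \<mu>"
    and basis1: "adapted_orthonormal_basis A L h \<nu> T \<phi> \<mu> 1 N1 \<eta>1 s1"
    and basis: "adapted_orthonormal_basis A L h \<nu> T \<phi> \<mu> k N \<eta> s"
    and \<beta>: "\<beta> \<le> N1"
  obtains a where "\<And>i x. i \<in> idx L \<Longrightarrow> x \<in> bdom L i \<Longrightarrow> s1 \<beta> i x ^ k = (\<Sum>\<alpha>\<le>N. a \<alpha> * s \<alpha> i x)"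
    "\<And>\<alpha>. \<alpha> \<le> N \<Longrightarrow> int k * \<eta>1 \<beta> < \<eta> \<alpha> \<Longrightarrow> a \<alpha> = 0"
proof -
  note Z = tot_ringed[OF T] and lb = lb_bundle[OF T]
  obtain s1' S1 where s1': "\<forall>\<alpha>\<le>N1. s1' \<alpha> \<in> sections (fib T 1) (fib_lb T 1) 1 \<and>
         bundle_pull (hol_space A) L (fib_lb T 1) \<phi> \<mu> 1 (s1 \<alpha>) (s1' \<alpha>)"
      and S1: "section_basis (tot T) (lb T) (poly_fn T) 1 N1 S1"
      and t1: "\<forall>\<alpha>\<le>N1. \<forall>w. w \<noteq> 0 \<longrightarrow> (\<exists>t. transported T 1 1 w (s1' \<alpha>) t \<and>
         pull_section (inc T w) (lb T) (S1 \<alpha>) = scale_section (fib T w) (fib_lb T w) (const_fn T w (w powi \<eta>1 \<alpha>)) t)"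
    using basis1 unfolding adapted_orthonormal_basis_def by blast
  obtain s' S where s': "\<forall>\<alpha>\<le>N. s' \<alpha> \<in> sections (fib T 1) (fib_lb T 1) k \<and>
         bundle_pull (hol_space A) L (fib_lb T 1) \<phi> \<mu> k (s \<alpha>) (s' \<alpha>)"
      and S: "section_basis (tot T) (lb T) (poly_fn T) k N S"
      and t: "\<forall>\<alpha>\<le>N. \<forall>w. w \<noteq> 0 \<longrightarrow> (\<exists>t. transported T k 1 w (s' \<alpha>) t \<and>
         pull_section (inc T w) (lb T) (S \<alpha>) = scale_section (fib T w) (fib_lb T w) (const_fn T w (w powi \<eta> \<alpha>)) t)"
    using basis unfolding adapted_orthonormal_basis_def by blast
  have sec1: "section_basis (hol_space A) L (\<lambda>c x. c) 1 N1 s1"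
    and sec: "section_basis (hol_space A) L (\<lambda>c x. c) k N s"
    using basis1 basis by (simp_all add: adapted_orthonormal_basis_def)
  have in_sec: "s1 \<beta> \<in> sections (hol_space A) L 1" "S1 \<beta> \<in> sections (tot T) (lb T) 1"
    "\<And>\<alpha>. \<alpha> \<le> N \<Longrightarrow> s \<alpha> \<in> sections (hol_space A) L k" "\<And>\<alpha>. \<alpha> \<le> N \<Longrightarrow> S \<alpha> \<in> sections (tot T) (lb T) k"
    using sec1 sec S1 S \<beta> by (simp_all add: section_basis_def)
  \<comment> \<open>The polynomial coefficients of the power of \<open>S1 \<beta>\<close>; they are
    fixed before any \<open>w\<close> or point is chosen.\<close>
  obtain P where P: "\<forall>y e. \<forall>b\<in>idx (lb T). evaluation (tot T) y e \<longrightarrow> y \<in> bdom (lb T) b \<longrightarrow>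
      e (bdom (lb T) b) ((\<lambda>b\<in>idx (lb T). S1 \<beta> b [^]\<^bsub>sec (tot T) (bdom (lb T) b)\<^esub> k) b)
      = (\<Sum>\<alpha>\<le>N. e (pts (tot T)) (poly_fn T (P \<alpha>)) * e (bdom (lb T) b) (S \<alpha> b))"
    using eval_section_basis[OF Z lb S sections_power[OF Z lb in_sec(2)] poly_fn_carrier[OF T]] by blast
  have key: "w powi (int k * \<eta>1 \<beta>) * s1 \<beta> i x ^ k = (\<Sum>\<alpha>\<le>N. poly (P \<alpha>) w * w powi \<eta> \<alpha> * s \<alpha> i x)"
    if w: "w \<noteq> 0" and i: "i \<in> idx L" "x \<in> bdom L i" for w i x
  proof -
    obtain y e \<kappa> b where ev: "evaluation (tot T) y e" and b: "b \<in> idx (lb T)" "y \<in> bdom (lb T) b"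
      and \<kappa>: "\<kappa> \<noteq> 0" and poly: "\<And>P. e (pts (tot T)) (poly_fn T P) = poly P w"
      and eval: "\<And>m s s' t S c. s \<in> sections (hol_space A) L m \<Longrightarrow> s' \<in> sections (fib T 1) (fib_lb T 1) m \<Longrightarrow>
       bundle_pull (hol_space A) L (fib_lb T 1) \<phi> \<mu> m s s' \<Longrightarrow> transported T m 1 w s' t \<Longrightarrow>
       S \<in> sections (tot T) (lb T) m \<Longrightarrow>
       pull_section (inc T w) (lb T) S = scale_section (fib T w) (fib_lb T w) (const_fn T w c) t \<Longrightarrow>
       e (bdom (lb T) b) (S b) = c * \<kappa> ^ m * s i x"
      by (rule orbit_evaluation[OF T A L gf w i]) blast
    have "e (bdom (lb T) b) (S1 \<beta> b) = w powi \<eta>1 \<beta> * \<kappa> ^ 1 * s1 \<beta> i x"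
      using eval[OF in_sec(1) _ _ _ in_sec(2)] s1' t1 w \<beta> by blast
    moreover have "e (bdom (lb T) b) (S \<alpha> b) = w powi \<eta> \<alpha> * \<kappa> ^ k * s \<alpha> i x" if "\<alpha> \<le> N" for \<alpha>
      using eval[OF in_sec(3)[OF that] _ _ _ in_sec(4)[OF that]] s' t w that by blast
    moreover have "e (bdom (lb T) b) (S1 \<beta> b) ^ k = (\<Sum>\<alpha>\<le>N. poly (P \<alpha>) w * e (bdom (lb T) b) (S \<alpha> b))"
      using P[rule_format, OF b(1) ev b(2)] b(1)
        eval_pow[OF ev Z line_bundle_open[OF lb b(1)] b(2) sections_carrier[OF in_sec(2) b(1)], of k]
      by (simp add: poly)
    ultimately have "(w powi \<eta>1 \<beta> * \<kappa> ^ 1 * s1 \<beta> i x) ^ k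
        = (\<Sum>\<alpha>\<le>N. poly (P \<alpha>) w * (w powi \<eta> \<alpha> * \<kappa> ^ k * s \<alpha> i x))"
      by simp
    \<comment> \<open>The same \<open>\<kappa>\<close> enters to the first power for
      \<open>S1 \<beta>\<close> and to the \<open>k\<close>-th power for each
      \<open>S \<alpha>\<close>, so after raising to the power \<open>k\<close> it is a common
      factor.\<close>
    also have "\<dots> = \<kappa> ^ k * (\<Sum>\<alpha>\<le>N. poly (P \<alpha>) w * w powi \<eta> \<alpha> * s \<alpha> i x)"
      by (simp add: sum_distrib_left ac_simps)
    also have "(w powi \<eta>1 \<beta> * \<kappa> ^ 1 * s1 \<beta> i x) ^ k = \<kappa> ^ k * (w powi (int k * \<eta>1 \<beta>) * s1 \<beta> i x ^ k)"
      by (simp add: power_mult_distrib power_int_power' ac_simps)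
    finally show ?thesis
      using \<kappa> by simp
  qed
  \<comment> \<open>At \<open>w = 1\<close> all powers of \<open>w\<close> are 1, so the
    coefficients sought are the values of the polynomials at 1.\<close>
  have exp: "s1 \<beta> i x ^ k = (\<Sum>\<alpha>\<le>N. poly (P \<alpha>) 1 * s \<alpha> i x)" if "i \<in> idx L" "x \<in> bdom L i" for i x
    using key[of 1, OF _ that] by simp
  have "poly (P \<alpha>) w * w powi \<eta> \<alpha> = w powi (int k * \<eta>1 \<beta>) * poly (P \<alpha>) 1" if w: "w \<noteq> 0" and \<alpha>: "\<alpha> \<le> N" for w \<alpha>
  proof -
    \<comment> \<open>For fixed \<open>w\<close>, the identity \<open>key\<close> and
      \<open>w powi (int k * \<eta>1 \<beta>)\<close> times its instance at 1 expand the same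
      section; their difference is a linear relation among the \<open>s \<alpha>\<close> with
      constant coefficients.\<close>
    have "poly (P \<alpha>) w * w powi \<eta> \<alpha> - w powi (int k * \<eta>1 \<beta>) * poly (P \<alpha>) 1 = 0"
    proof (rule section_basis_independent[OF A L sec _ \<alpha>])
      fix i x assume i: "i \<in> idx L" "x \<in> bdom L i"
      have "w powi (int k * \<eta>1 \<beta>) * (\<Sum>\<alpha>\<le>N. poly (P \<alpha>) 1 * s \<alpha> i x)
          = (\<Sum>\<alpha>\<le>N. poly (P \<alpha>) w * w powi \<eta> \<alpha> * s \<alpha> i x)"
        using key[OF w i] exp[OF i] by simp
      then show "(\<Sum>\<alpha>\<le>N. (poly (P \<alpha>) w * w powi \<eta> \<alpha> - w powi (int k * \<eta>1 \<beta>) * poly (P \<alpha>) 1) * s \<alpha> i x) = 0"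
        by (simp only: left_diff_distrib sum_subtractf) (simp add: sum_distrib_left mult.assoc)
    qed
    then show ?thesis by simp
  qed
  then have "poly (P \<alpha>) 1 = 0" if "\<alpha> \<le> N" "int k * \<eta>1 \<beta> < \<eta> \<alpha>" for \<alpha>
    using poly_weight_zero[OF _ that(2)] that(1) by blast
  with exp show ?thesis by (rule that)
qed

section \<open>The expansion and the finite volume combined into the coefficient bound\<close>

theorem lemma2:
  fixes A :: "('x::t2_space, 'n::finite) atlas"
    and L :: "('j, 'x) hol_bundle"
    and h :: "'j \<Rightarrow> 'x \<Rightarrow> real"
    and \<nu> :: "'x measure"
    and T :: "('p, 'r, 'i) tconf"
    and \<phi> :: "('x, 'x \<Rightarrow> complex, 'p, 'r) rmor"
    and \<mu> :: "'i \<Rightarrow> 'j \<Rightarrow> 'x \<Rightarrow> complex"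
    and N :: "nat \<Rightarrow> nat"
    and \<eta> :: "nat \<Rightarrow> nat \<Rightarrow> int"
    and s :: "nat \<Rightarrow> nat \<Rightarrow> 'j \<Rightarrow> 'x \<Rightarrow> complex"
    and \<beta> k :: nat
  assumes "compact_complex_manifold A"
    and "line_bundle (hol_space A) L"
    and "hermitian_metric A L h" and "positive_curvature A L h"
    and "curvature_volume A L h \<nu>"
    and "test_configuration T" and "general_fibre A L T \<phi> \<mu>"
    and "\<And>k. k \<ge> 1 \<Longrightarrow> weights T k (N k) (\<eta> k)"
    and "\<And>k. k \<ge> 1 \<Longrightarrow> adapted_orthonormal_basis A L h \<nu> T \<phi> \<mu> k (N k) (\<eta> k) (s k)"
    and "\<beta> \<le> N 1" and "k \<ge> 1"
  shows "\<exists>a :: nat \<Rightarrow> complex.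
      (\<forall>i\<in>idx L. \<forall>x\<in>bdom L i.
         s 1 \<beta> i x ^ k = (\<Sum>\<alpha> | \<alpha> \<le> N k \<and> \<eta> k \<alpha> \<le> int k * \<eta> 1 \<beta>. a \<alpha> * s k \<alpha> i x)) \<and>
      (\<forall>\<alpha>. \<alpha> \<le> N k \<and> \<eta> k \<alpha> \<le> int k * \<eta> 1 \<beta> \<longrightarrow>
         cmod (a \<alpha>) \<le> sqrt (measure \<nu> UNIV) * (SUP \<beta>'\<in>{..N 1}. SUP x. pt_norm L h (s 1 \<beta>') x) ^ k)"
proof -
  note A = assms(1) and L = assms(2) and h = assms(3) and T = assms(6) and gf = assms(7)
    and basis = assms(9) and \<beta> = assms(10) and k = assms(11)
  have \<nu>: "sets \<nu> = sets borel"
    using assms(5) by (simp add: curvature_volume_def)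
  have sec: "section_basis (hol_space A) L (\<lambda>c x. c) m (N m) (s m)" if "m \<ge> 1" for m
    using basis[OF that] by (simp add: adapted_orthonormal_basis_def)
  have in_sec: "s m \<alpha> \<in> sections (hol_space A) L m" if "m \<ge> 1" "\<alpha> \<le> N m" for m \<alpha>
    using sec[OF that(1)] that(2) by (simp add: section_basis_def)
  have orth: "L2_inner CARD('n) L h \<nu> m (s m \<alpha>) (s m \<gamma>) = (if \<alpha> = \<gamma> then 1 else 0)"
    if "m \<ge> 1" "\<alpha> \<le> N m" "\<gamma> \<le> N m" for m \<alpha> \<gamma>
    using basis[OF that(1)] that(2,3) by (simp add: adapted_orthonormal_basis_def)
  \<comment> \<open>\<open>measure\<close> takes the value 0 on sets of infinite measure, so the
    bound is meaningful only once finiteness is known.\<close>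
  have fin: "finite_measure \<nu>"
  proof (rule finite_measure_of_sections[OF A L h \<nu>])
    fix x
    obtain m t i where m: "m \<ge> 1" and t: "t \<in> sections (hol_space A) L m" and i: "i \<in> idx L" "x \<in> bdom L i"
      and nz: "t i x \<noteq> 0"
      using nonvanishing_section[OF T A L gf, of x] by blast
    obtain a where "\<forall>i\<in>idx L. \<forall>x\<in>bdom L i. t i x = (\<Sum>\<alpha>\<le>N m. a \<alpha> * s m \<alpha> i x)"
      using section_basis_expansion[OF A L sec[OF m] t] by blast
    \<comment> \<open>From the section \<open>t\<close> one passes to a basis section that does not
      vanish at \<open>x\<close>: basis sections have norm 1, so their integrals are not the default
      value 0 of a divergent integral.\<close>
    then have "(\<Sum>\<alpha>\<le>N m. a \<alpha> * s m \<alpha> i x) \<noteq> 0"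
      using i nz by simp
    then obtain \<alpha> where "\<alpha> \<in> {..N m}" "a \<alpha> * s m \<alpha> i x \<noteq> 0"
      by (rule sum.not_neutral_contains_not_neutral)
    then have \<alpha>: "\<alpha> \<le> N m" "s m \<alpha> i x \<noteq> 0" by simp_all
    have "herm L h m (s m \<alpha>) (s m \<alpha>) x \<noteq> 0"
      unfolding herm_eq[OF A L h in_sec[OF m \<alpha>(1)] in_sec[OF m \<alpha>(1)] i]
      using \<alpha>(2) metric_pos[OF A L h i] by simp
    then show "\<exists>m s. s \<in> sections (hol_space A) L m \<and> L2_inner CARD('n) L h \<nu> m s s \<noteq> 0 \<and> herm L h m s s x \<noteq> 0"
      using in_sec[OF m \<alpha>(1)] orth[OF m \<alpha>(1) \<alpha>(1)] by (metis zero_neq_one)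
  qed
  obtain a where exp: "\<And>i x. i \<in> idx L \<Longrightarrow> x \<in> bdom L i \<Longrightarrow> s 1 \<beta> i x ^ k = (\<Sum>\<alpha>\<le>N k. a \<alpha> * s k \<alpha> i x)"
    and zero: "\<And>\<alpha>. \<alpha> \<le> N k \<Longrightarrow> int k * \<eta> 1 \<beta> < \<eta> k \<alpha> \<Longrightarrow> a \<alpha> = 0"
    using adapted_power_expansion[OF A L T gf basis[OF order_refl] basis[OF k] \<beta>] by blast
  have "s 1 \<beta> i x ^ k = (\<Sum>\<alpha> | \<alpha> \<le> N k \<and> \<eta> k \<alpha> \<le> int k * \<eta> 1 \<beta>. a \<alpha> * s k \<alpha> i x)"
    if "i \<in> idx L" "x \<in> bdom L i" for i x
    unfolding exp[OF that]
  proof (rule sum.mono_neutral_right)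
    show "\<forall>\<alpha>\<in>{..N k} - {\<alpha>. \<alpha> \<le> N k \<and> \<eta> k \<alpha> \<le> int k * \<eta> 1 \<beta>}. a \<alpha> * s k \<alpha> i x = 0"
      using zero by (metis (no_types, lifting) DiffE atMost_iff linorder_not_le mem_Collect_eq mult_zero_left)
  qed auto
  \<comment> \<open>Both suprema are genuine upper bounds: the inner one by compactness, the outer
    one because its index set is finite.\<close>
  moreover have "pt_norm L h (s 1 \<beta>) x \<le> (SUP \<beta>'\<in>{..N 1}. SUP x. pt_norm L h (s 1 \<beta>') x)" for x
  proof -
    have "pt_norm L h (s 1 \<beta>) x \<le> (SUP x. pt_norm L h (s 1 \<beta>) x)"
      using pt_norm_bdd[OF A L h in_sec[OF order_refl \<beta>]] by (intro cSUP_upper) auto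
    also have "\<dots> \<le> (SUP \<beta>'\<in>{..N 1}. SUP x. pt_norm L h (s 1 \<beta>') x)"
      using \<beta> by (intro cSUP_upper bdd_above_finite) auto
    finally show ?thesis .
  qed
  ultimately show ?thesis
    using coefficient_bound[OF A L h \<nu> fin in_sec[OF k] orth[OF k] in_sec[OF order_refl \<beta>] exp]
    by blast
qed

end
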